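(* Let $N\ge 2$, let $\Omega\subset\mathbb{R}^N$ be a bounded domain with smooth boundary, let $g\in C^\infty(\overline{\Omega})$ be positive, and let $A,B,p,q$ be positive constants, all independent of $\epsilon$, satisfying $(A-B)(p-q)\ge0$ and $A\ne B$. For $\epsilon>0$ let $u_\epsilon\in C^\infty(\Omega)\cap C^1(\overline{\Omega})$ be the unique solution of problem (N) described in the context. Then there is a constant $C$ independent of $\epsilon$ such that for all sufficiently small $\epsilon>0$, $$\max_{x,y\in\overline{\Omega}}|u_\epsilon(x)-u_\epsilon(y)|\ge \frac{1}{\max\{p,q\}}\log\frac1\epsilon - C,$$ so this maximal difference blows up as $\epsilon\downarrow0$. Moreover: (I) If $0<A<B$ and $0<p\le q$, then $u_\epsilon$ attains its maximum at an interior point and its minimum at a boundary point, $0<\max_{\overline{\Omega}}u_\epsilon\le\frac1q\log\frac BA$ for all $\epsilon>0$, and there is a constant $C'$ independent of $\epsilon$ with $\min_{\partial\Omega}u_\epsilon\le -\frac1q\log\frac1\epsilon+C'$ for all sufficiently small $\epsilon>0$. (II) If $A>B>0$ and $p\ge q>0$, then $u_\epsilon$ attains its minimum at an interior point and its maximum at a boundary point, $-\frac1p\log\frac AB\le\min_{\overline{\Omega}}u_\epsilon<0$ for all $\epsilon>0$, and there is a constant $C''$ independent of $\epsilon$ with $\max_{\partial\Omega}u_\epsilon\ge \frac1p\log\frac1\epsilon-C''$ for all sufficiently small $\epsilon>0$. (III) For every compact subset $K$ of $\Omega$ there are positive constants $C_K,M_K$ independent of $\epsilon$ such that $$\frac{\max_{x,y\in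 K}|u_\epsilon(x)-u_\epsilon(y)|}{\max_{x,y\in\overline{\Omega}}|u_\epsilon(x)-u_\epsilon(y)|}\le C_Ke^{-M_K/\epsilon}.$$
   Context: Problem (N): for $\epsilon>0$, find $u_\epsilon$ with $$\epsilon^2\nabla\cdot(g\nabla u_\epsilon)=\frac{Ae^{pu_\epsilon}}{\frac{1}{|\Omega|}\int_\Omega e^{pu_\epsilon(y)}dy}-\frac{Be^{-qu_\epsilon}}{\frac{1}{|\Omega|}\int_\Omega e^{-qu_\epsilon(y)}dy}\ \text{ in }\Omega,\qquad \epsilon^2\partial_\nu u_\epsilon=C_{bd}\ \text{ on }\partial\Omega,\qquad \int_\Omega u_\epsilon\,dx=0,$$ where $\partial_\nu$ is the outward normal derivative, $|\Omega|$ the Lebesgue measure of $\Omega$, and $C_{bd}=\frac{|\Omega|(A-B)}{\int_{\partial\Omega} g\,dS_x}$. This problem has a unique solution $u_\epsilon\in C^\infty(\Omega)\cap C^1(\overline{\Omega})$ for each $\epsilon>0$. *)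

theory Defs
  imports "HOL-Analysis.Analysis"
begin

definition partial :: "'a::euclidean_space \<Rightarrow> ('a \<Rightarrow> real) \<Rightarrow> 'a \<Rightarrow> real" where
  "partial v f x = frechet_derivative f (at x) v"

fun iter_partial :: "'a::euclidean_space list \<Rightarrow> ('a \<Rightarrow> real) \<Rightarrow> 'a \<Rightarrow> real" where
  "iter_partial [] f = f"
| "iter_partial (v # vs) f = partial v (iter_partial vs f)"

text \<open>C-infinity on an open set S: all iterated derivatives exist (hence are continuous) on S.\<close>
definition smooth_on :: "'a::euclidean_space set \<Rightarrow> ('a \<Rightarrow> real) \<Rightarrow> bool" where
  "smooth_on S f \<longleftrightarrow> (\<forall>vs. \<forall>x\<in>S. iter_partial vs f differentiable (at x))"

definition grad :: "('a::euclidean_space \<Rightarrow> real) \<Rightarrow> 'a \<Rightarrow> 'a" where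
  "grad f x = (\<Sum>b\<in>Basis. partial b f x *\<^sub>R b)"

definition div_field :: "('a::euclidean_space \<Rightarrow> 'a) \<Rightarrow> 'a \<Rightarrow> real" where
  "div_field F x = (\<Sum>b\<in>Basis. partial b (\<lambda>y. F y \<bullet> b) x)"

definition local_defining_function :: "'a::euclidean_space set \<Rightarrow> 'a set \<Rightarrow> ('a \<Rightarrow> real) \<Rightarrow> 'a \<Rightarrow> bool" where
  "local_defining_function \<Omega> U \<phi> z \<longleftrightarrow>
     open U \<and> z \<in> U \<and> smooth_on U \<phi> \<and> (\<forall>x\<in>U. grad \<phi> x \<noteq> 0) \<and>
     \<Omega> \<inter> U = {x\<in>U. \<phi> x < 0}"

definition smooth_boundary :: "'a::euclidean_space set \<Rightarrow> bool" where
  "smooth_boundary \<Omega> \<longleftrightarrow> (\<forall>z\<in>frontier \<Omega>. \<exists>U \<phi>. local_defining_function \<Omega> U \<phi> z)"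

definition outward_normal :: "'a::euclidean_space set \<Rightarrow> 'a \<Rightarrow> 'a" where
  "outward_normal \<Omega> z = (SOME n. \<exists>U \<phi>. local_defining_function \<Omega> U \<phi> z \<and>
       n = (1 / norm (grad \<phi> z)) *\<^sub>R grad \<phi> z)"

definition hausdorff_pre :: "nat \<Rightarrow> real \<Rightarrow> 'a::euclidean_space set \<Rightarrow> ennreal" where
  "hausdorff_pre d \<delta> E = (INF C \<in> {C :: nat \<Rightarrow> 'a set. E \<subseteq> (\<Union>i. C i) \<and>
        (\<forall>i. bounded (C i) \<and> diameter (C i) \<le> \<delta>)}.
      (\<Sum>i. ennreal (unit_ball_vol (real d) * (diameter (C i) / 2) ^ d)))"

definition hausdorff_outer :: "nat \<Rightarrow> 'a::euclidean_space set \<Rightarrow> ennreal" where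
  "hausdorff_outer d E = (SUP \<delta> \<in> {0<..}. hausdorff_pre d \<delta> E)"

definition hausdorff_measure :: "nat \<Rightarrow> 'a::euclidean_space measure" where
  "hausdorff_measure d = measure_of UNIV (sets borel) (hausdorff_outer d)"

definition surface_integral :: "'a::euclidean_space set \<Rightarrow> ('a \<Rightarrow> real) \<Rightarrow> real" where
  "surface_integral \<Omega> g = set_lebesgue_integral (hausdorff_measure (DIM('a) - 1)) (frontier \<Omega>) g"

definition boundary_const :: "'a::euclidean_space set \<Rightarrow> ('a \<Rightarrow> real) \<Rightarrow> real \<Rightarrow> real \<Rightarrow> real" where
  "boundary_const \<Omega> g A B = measure lebesgue \<Omega> * (A - B) / surface_integral \<Omega> g"

definition solves_N :: "'a::euclidean_space set \<Rightarrow> ('a \<Rightarrow> real) \<Rightarrow> real \<Rightarrow> real \<Rightarrow> real \<Rightarrow> real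
     \<Rightarrow> real \<Rightarrow> ('a \<Rightarrow> real) \<Rightarrow> bool" where
  "solves_N \<Omega> g A B p q \<epsilon> u \<longleftrightarrow>
     smooth_on \<Omega> u \<and> continuous_on (closure \<Omega>) u \<and>
     (\<forall>x\<in>\<Omega>. \<epsilon>\<^sup>2 * div_field (\<lambda>y. g y *\<^sub>R grad u y) x =
        A * exp (p * u x) / ((1 / measure lebesgue \<Omega>) * integral \<Omega> (\<lambda>y. exp (p * u y)))
      - B * exp (- q * u x) / ((1 / measure lebesgue \<Omega>) * integral \<Omega> (\<lambda>y. exp (- q * u y)))) \<and>
     (\<exists>Du. continuous_on (closure \<Omega>) Du \<and> (\<forall>x\<in>\<Omega>. Du x = grad u x) \<and>
        (\<forall>z\<in>frontier \<Omega>. \<epsilon>\<^sup>2 * (Du z \<bullet> outward_normal \<Omega> z) = boundary_const \<Omega> g A B)) \<and>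
     integral \<Omega> u = 0"

definition osc :: "'a set \<Rightarrow> ('a \<Rightarrow> real) \<Rightarrow> real" where
  "osc K f = (if K = {} then 0 else Sup {\<bar>f x - f y\<bar> | x y. x \<in> K \<and> y \<in> K})"

end

theory Submission
  imports Defs
begin

text \<open>The argument uses only comparison principles. Exchanging \<open>u\<close> with \<open>- u\<close> (and \<open>A\<close> with \<open>B\<close>, \<open>p\<close> with \<open>q\<close>)
  we may assume \<open>A < B\<close>; the surface integral of \<open>g\<close> is positive and finite, so the normal derivative is
  negative. Hence the maximum \<open>M\<close> is interior, the right-hand side \<open>f(u)\<close> is increasing in \<open>u\<close> with \<open>f(M) \<le> 0\<close>, and
  Jensen's inequality for the mean of \<open>exp (- q u)\<close> gives the bound on \<open>M\<close>. Since
  \<open>f(u) \<le> - q A (M - u)\<close>, the minimum lies on the boundary, and \<open>M - u\<close> is exponentially small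
  in the interior by comparison with \<open>exp ((l / \<epsilon>) (|x - x\<^sub>0|\<^sup>2 - r\<^sup>2))\<close>.

  For the blow-up let \<open>m\<close> be the minimum. If \<open>exp (- q m) < 1 / \<epsilon>\<close>, then
  \<open>\<epsilon>\<^sup>2 div (g grad u) \<ge> - B / \<epsilon>\<close>, which is too weak to
  bend the boundary slope of order \<open>1 / \<epsilon>\<^sup>2\<close> within distance of order \<open>\<epsilon>\<close> from the boundary. A barrier at a
  single boundary point then shows \<open>m \<le> M - \<gamma> / \<epsilon>\<close>, which is more than required.\<close>

subsection \<open>Elliptic operator and maximum principle\<close>

text \<open>The flux \<open>boundary_const\<close> divides by \<open>surface_integral\<close>, and a
  failure there would be silent: \<open>measure_of\<close> yields the zero measure if its argument
  is not a measure, the integral of a non-integrable function is 0, and so is division by 0. Each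
  would make the flux vanish, and with it the force that drives \<open>u\<close> down at the
  boundary. Hence the long part on Hausdorff measure: it is a Borel measure, finite and positive on
  the boundary.

  The equation is nonlocal, so comparison needs a grip on the two means that is uniform in
  \<open>\<epsilon>\<close>: the mean of \<open>exp (p * u)\<close> is at most its maximum, and that
  of \<open>exp (- q * u)\<close> is at least 1.

  The threshold \<open>1 / \<epsilon>\<close> for \<open>exp (- q * m)\<close> is a balance of
  scales. Below it the operator on \<open>u\<close> is at least \<open>- D\<close> with
  \<open>D\<close> of order \<open>\<epsilon> ^ (-3)\<close>; across a layer of width
  \<open>\<rho>\<close> of order \<open>\<epsilon>\<close> this changes the slope by
  \<open>D * \<rho>\<close>, of order \<open>\<epsilon> ^ (-2)\<close>, just like the prescribed
  slope \<open>s\<close>. A small factor in \<open>\<rho>\<close> lets \<open>s\<close> win, and the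
  drop \<open>s * \<rho>\<close> is of order \<open>1 / \<epsilon>\<close>. At or above the
  threshold the logarithmic bound with rate \<open>1 / q\<close> is immediate.\<close>

definition twice_diff_on :: "'a::euclidean_space set \<Rightarrow> ('a \<Rightarrow> real) \<Rightarrow> bool" where
  "twice_diff_on S u \<longleftrightarrow>
     (\<forall>x\<in>S. u differentiable (at x) \<and> (\<forall>b\<in>Basis. partial b u differentiable (at x)))"

text \<open>Expanded form of the divergence of \<open>g\<close> times the gradient. It contains only
  pure second derivatives, so maximum principle arguments reduce to one-variable calculus along the
  coordinate lines through a point.\<close>

definition elliptic_op :: "('a::euclidean_space \<Rightarrow> real) \<Rightarrow> ('a \<Rightarrow> real) \<Rightarrow> 'a \<Rightarrow> real" where
  "elliptic_op g u x =
     (\<Sum>b\<in>Basis. partial b g x * partial b u x + g x * partial b (partial b u) x)"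

section \<open>Calculus of partial derivatives and gradients\<close>

lemma smooth_onD:
  assumes "smooth_on S f" "x \<in> S"
  shows "iter_partial vs f differentiable (at x)"
  using assms unfolding smooth_on_def by blast

lemma smooth_on_differentiable:
  assumes "smooth_on S f" "x \<in> S"
  shows "f differentiable (at x)" "partial v f differentiable (at x)"
    "partial v (partial v' f) differentiable (at x)"
  using smooth_onD[OF assms, of "[]"] smooth_onD[OF assms, of "[v]"]
    smooth_onD[OF assms, of "[v, v']"] by auto

lemma smooth_on_imp_twice_diff_on:
  "smooth_on S f \<Longrightarrow> twice_diff_on S f"
  unfolding twice_diff_on_def using smooth_on_differentiable by blast

lemma differentiable_imp_continuous_on:
  assumes "\<And>x. x \<in> S \<Longrightarrow> f differentiable (at x)"
  shows "continuous_on S f"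
  by (meson assms continuous_at_imp_continuous_on differentiable_imp_continuous_within)

lemma smooth_on_continuous_on:
  assumes "smooth_on S f"
  shows "continuous_on S f" "continuous_on S (partial v f)"
    "continuous_on S (partial v (partial v' f))"
  using smooth_on_differentiable[OF assms] by (intro differentiable_imp_continuous_on; blast)+

lemma continuous_on_grad:
  assumes "smooth_on S f"
  shows "continuous_on S (grad f)"
  unfolding grad_def by (intro continuous_intros smooth_on_continuous_on[OF assms])

lemma continuous_on_elliptic_op:
  assumes "smooth_on S f" "smooth_on S g"
  shows "continuous_on S (elliptic_op g f)"
  unfolding elliptic_op_def
  by (intro continuous_intros smooth_on_continuous_on[OF assms(1)] smooth_on_continuous_on[OF assms(2)])

lemma smooth_on_subset: "smooth_on S f \<Longrightarrow> T \<subseteq> S \<Longrightarrow> smooth_on T f"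
  unfolding smooth_on_def by blast

lemma grad_inner:
  assumes "f differentiable (at x)"
  shows "grad f x \<bullet> v = frechet_derivative f (at x) v"
proof -
  have lin: "linear (frechet_derivative f (at x))"
    using assms by (rule linear_frechet_derivative)
  have "frechet_derivative f (at x) v = frechet_derivative f (at x) (\<Sum>b\<in>Basis. (v \<bullet> b) *\<^sub>R b)"
    by (simp add: euclidean_representation)
  also have "\<dots> = (\<Sum>b\<in>Basis. (v \<bullet> b) * frechet_derivative f (at x) b)"
    by (simp add: linear_sum[OF lin] linear_scale[OF lin])
  also have "\<dots> = grad f x \<bullet> v"
    unfolding grad_def partial_def inner_sum_left by (simp add: inner_commute mult.commute)
  finally show ?thesis by simp
qed

lemma has_derivative_grad:
  assumes "f differentiable (at x)"
  shows "(f has_derivative (\<lambda>v. grad f x \<bullet> v)) (at x)"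
  using assms by (simp add: grad_inner frechet_derivative_works)

lemma grad_inner_Basis [simp]: "b \<in> Basis \<Longrightarrow> grad f x \<bullet> b = partial b f x"
  unfolding grad_def by simp

lemma has_real_derivative_line:
  assumes "f differentiable (at (x + t *\<^sub>R v))"
  shows "((\<lambda>s. f (x + s *\<^sub>R v)) has_real_derivative partial v f (x + t *\<^sub>R v)) (at t)"
proof -
  have 1: "((\<lambda>s. x + s *\<^sub>R v) has_derivative (\<lambda>h. h *\<^sub>R v)) (at t)"
    by (auto intro!: derivative_eq_intros)
  have "((\<lambda>s. f (x + s *\<^sub>R v)) has_derivative
      (\<lambda>h. frechet_derivative f (at (x + t *\<^sub>R v)) (h *\<^sub>R v))) (at t)"
    by (rule has_derivative_compose[OF 1]) (use assms frechet_derivative_works in blast)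
  moreover have "frechet_derivative f (at (x + t *\<^sub>R v)) (h *\<^sub>R v) = partial v f (x + t *\<^sub>R v) * h" for h
    by (simp add: partial_def linear_scale[OF linear_frechet_derivative[OF assms]])
  ultimately show ?thesis
    by (simp add: has_field_derivative_def mult_commute_abs)
qed

lemma partial_eqI:
  assumes "f differentiable (at x)" "((\<lambda>t. f (x + t *\<^sub>R v)) has_real_derivative D) (at 0)"
  shows "partial v f x = D"
  using has_real_derivative_line[of f x 0 v] assms DERIV_unique by fastforce

lemma partial_const_minus:
  assumes "f differentiable (at x)"
  shows "partial v (\<lambda>y. c - f y) x = - partial v f x"
  by (rule partial_eqI)
     (use assms has_real_derivative_line[of f x 0 v] in \<open>auto intro!: derivative_eq_intros\<close>)

text \<open>Needed for second derivatives: a formula for a first derivative that is known only on an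
  open set can be differentiated again through this local congruence.\<close>

lemma differentiable_cong_open:
  assumes "open S" "x \<in> S" "\<And>y. y \<in> S \<Longrightarrow> f y = h y" "h differentiable (at x)"
  shows "f differentiable (at x)" "partial v f x = partial v h x"
proof -
  have *: "(h has_derivative D) (at x) \<longleftrightarrow> (f has_derivative D) (at x)" for D
    using has_derivative_transform_within_open[of h D x UNIV S f]
      has_derivative_transform_within_open[of f D x UNIV S h] assms(1-3) by auto
  then show "f differentiable (at x)" using assms(4) unfolding differentiable_def by blast
  show "partial v f x = partial v h x"
    unfolding partial_def frechet_derivative_def by (simp add: *)
qed

lemma twice_diff_on_const_minus:
  assumes "open S" "twice_diff_on S u"
  shows "twice_diff_on S (\<lambda>x. c - u x)"
    and "x \<in> S \<Longrightarrow> elliptic_op g (\<lambda>x. c - u x) x = - elliptic_op g u x"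
    and "x \<in> S \<Longrightarrow> grad (\<lambda>x. c - u x) x = - grad u x"
proof -
  have d: "u differentiable (at x)" "b \<in> Basis \<Longrightarrow> partial b u differentiable (at x)" if "x \<in> S" for x b
    using assms(2) that unfolding twice_diff_on_def by auto
  have p: "partial v (\<lambda>x. c - u x) x = - partial v u x" if "x \<in> S" for x v
    using d(1)[OF that] by (rule partial_const_minus)
  have p2: "partial b (\<lambda>x. c - u x) differentiable (at x)"
    "partial b (partial b (\<lambda>x. c - u x)) x = - partial b (partial b u) x" if "x \<in> S" "b \<in> Basis" for x b
  proof -
    have m: "(\<lambda>y. - partial b u y) differentiable (at x)"
      using d(2)[OF that] by simp
    show "partial b (\<lambda>x. c - u x) differentiable (at x)"
      by (rule differentiable_cong_open[OF assms(1) that(1) p m])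
    have "partial b (partial b (\<lambda>x. c - u x)) x = partial b (\<lambda>y. - partial b u y) x"
      by (rule differentiable_cong_open[OF assms(1) that(1) p m])
    then show "partial b (partial b (\<lambda>x. c - u x)) x = - partial b (partial b u) x"
      using partial_const_minus[OF d(2)[OF that], of b 0] by simp
  qed
  show "twice_diff_on S (\<lambda>x. c - u x)"
    unfolding twice_diff_on_def using d p2 by auto
  show "x \<in> S \<Longrightarrow> elliptic_op g (\<lambda>x. c - u x) x = - elliptic_op g u x"
    unfolding elliptic_op_def sum_negf[symmetric] by (rule sum.cong) (auto simp: p p2 algebra_simps)
  show "x \<in> S \<Longrightarrow> grad (\<lambda>x. c - u x) x = - grad u x"
    unfolding grad_def sum_negf[symmetric] by (rule sum.cong) (auto simp: p)
qed

text \<open>The product rule in each coordinate. As \<open>grad u y \<bullet> b\<close> equals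
  \<open>partial b u y\<close> at every \<open>y\<close> by definition, the field can be rewritten
  globally before it is differentiated.\<close>

lemma div_field_eq_elliptic_op:
  assumes "g differentiable (at x)" "x \<in> S" "twice_diff_on S u"
  shows "div_field (\<lambda>y. g y *\<^sub>R grad u y) x = elliptic_op g u x"
  unfolding div_field_def elliptic_op_def
proof (rule sum.cong[OF refl])
  fix b :: 'a assume b: "b \<in> Basis"
  have d: "partial b u differentiable (at x)"
    using assms b unfolding twice_diff_on_def by auto
  have "partial b (\<lambda>y. g y * partial b u y) x =
      partial b g x * partial b u x + g x * partial b (partial b u) x"
  proof (rule partial_eqI)
    show "(\<lambda>y. g y * partial b u y) differentiable (at x)"
      using assms(1) d by simp
    show "((\<lambda>t. g (x + t *\<^sub>R b) * partial b u (x + t *\<^sub>R b)) has_real_derivative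
      partial b g x * partial b u x + g x * partial b (partial b u) x) (at 0)"
      using has_real_derivative_line[of g x 0 b] has_real_derivative_line[of "partial b u" x 0 b] assms(1) d
      by (auto intro!: derivative_eq_intros)
  qed
  then show "partial b (\<lambda>y. (g y *\<^sub>R grad u y) \<bullet> b) x =
      partial b g x * partial b u x + g x * partial b (partial b u) x"
    using b by simp
qed

text \<open>If \<open>D > 0\<close>, then \<open>h'\<close>, which vanishes at 0, is positive just
  to the right of 0, and the mean value theorem makes \<open>h\<close> exceed \<open>h 0\<close>
  there.\<close>

lemma local_max_second_derivative:
  fixes h h' :: "real \<Rightarrow> real"
  assumes "d > 0"
    and h: "\<And>t. \<bar>t\<bar> < d \<Longrightarrow> (h has_real_derivative h' t) (at t)"
    and h': "(h' has_real_derivative D) (at 0)"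
    and max: "\<And>t. \<bar>t\<bar> < d \<Longrightarrow> h t \<le> h 0"
  shows "h' 0 = 0" "D \<le> 0"
proof -
  show 0: "h' 0 = 0"
    using DERIV_local_max[of h "h' 0" 0 d] h[of 0] max \<open>d > 0\<close> by auto
  show "D \<le> 0"
  proof (rule ccontr)
    assume "\<not> D \<le> 0"
    then obtain e where e: "e > 0" "\<And>t. 0 < t \<Longrightarrow> t < e \<Longrightarrow> 0 < h' t"
      using DERIV_pos_inc_right[OF h'] 0 by auto
    define t where "t = min d e / 2"
    have t: "0 < t" "t < d" "t < e" using \<open>d > 0\<close> \<open>e > 0\<close> by (auto simp: t_def)
    obtain z where z: "0 < z" "z < t" "h t - h 0 = (t - 0) * h' z"
      using MVT2[of 0 t h h'] h t by force
    then have "h t - h 0 > 0" using e(2)[of z] t by simp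
    then show False using max[of t] t by simp
  qed
qed

text \<open>At an interior maximum of \<open>u - w\<close> the first derivatives agree along each
  coordinate line and the second ones are ordered. Barriers enter through explicit line derivatives
  \<open>w1\<close> and \<open>w2\<close>, so their formulas are differentiated in one real
  variable.\<close>

lemma elliptic_op_le_at_local_max:
  assumes S: "open S" "x \<in> S" and u: "twice_diff_on S u"
    and w1: "\<And>y b. y \<in> S \<Longrightarrow> b \<in> Basis \<Longrightarrow> ((\<lambda>t. w (y + t *\<^sub>R b)) has_real_derivative w1 b y) (at 0)"
    and w2: "\<And>b. b \<in> Basis \<Longrightarrow> ((\<lambda>t. w1 b (x + t *\<^sub>R b)) has_real_derivative w2 b) (at 0)"
    and max: "\<And>y. y \<in> S \<Longrightarrow> u y - w y \<le> u x - w x"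
    and g: "g x > 0"
  shows "elliptic_op g u x \<le> (\<Sum>b\<in>Basis. partial b g x * w1 b x + g x * w2 b)"
  unfolding elliptic_op_def
proof (rule sum_mono)
  fix b :: 'a assume b: "b \<in> Basis"
  obtain d where d: "d > 0" "ball x d \<subseteq> S" using S openE by blast
  have inS: "x + t *\<^sub>R b \<in> S" if "\<bar>t\<bar> < d" for t
    using d that b by (auto simp: subset_eq dist_norm)
  have du: "u differentiable (at y)" "partial b u differentiable (at y)" if "y \<in> S" for y
    using u that b unfolding twice_diff_on_def by auto
  \<comment> \<open>\<open>w1\<close> is the derivative at parameter 0 of a line based at
    \<open>y\<close>; rebasing the line at \<open>x + t *\<^sub>R b\<close> moves it to parameter
    \<open>t\<close>.\<close>
  have wt: "((\<lambda>s. w (x + s *\<^sub>R b)) has_real_derivative w1 b (x + t *\<^sub>R b)) (at t)" if "\<bar>t\<bar> < d" for t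
    using DERIV_shift[of "\<lambda>s. w (x + s *\<^sub>R b)" "w1 b (x + t *\<^sub>R b)" 0 t] w1[OF inS[OF that] b]
    by (simp add: algebra_simps)
  have A: "((\<lambda>s. u (x + s *\<^sub>R b) - w (x + s *\<^sub>R b)) has_real_derivative
      partial b u (x + t *\<^sub>R b) - w1 b (x + t *\<^sub>R b)) (at t)" if "\<bar>t\<bar> < d" for t
    by (intro DERIV_diff has_real_derivative_line du inS wt that)
  have B: "((\<lambda>t. partial b u (x + t *\<^sub>R b) - w1 b (x + t *\<^sub>R b)) has_real_derivative
      partial b (partial b u) x - w2 b) (at 0)"
    using has_real_derivative_line[of "partial b u" x 0 b] du(2)[OF S(2)] w2[OF b]
    by (auto intro!: DERIV_diff)
  have C: "u (x + t *\<^sub>R b) - w (x + t *\<^sub>R b) \<le> u (x + 0 *\<^sub>R b) - w (x + 0 *\<^sub>R b)" if "\<bar>t\<bar> < d" for t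
    using max[OF inS[OF that]] by simp
  from local_max_second_derivative[OF d(1) A B C]
  have "partial b u x = w1 b x" "partial b (partial b u) x \<le> w2 b" by auto
  then show "partial b g x * partial b u x + g x * partial b (partial b u) x \<le>
      partial b g x * w1 b x + g x * w2 b"
    using g by (simp add: mult_left_mono)
qed

lemma elliptic_op_nonpos_at_local_max:
  assumes "open S" "x \<in> S" "twice_diff_on S u" "\<And>y. y \<in> S \<Longrightarrow> u y \<le> u x" "g x > 0"
  shows "elliptic_op g u x \<le> 0"
  using elliptic_op_le_at_local_max[of S x u "\<lambda>_. 0" "\<lambda>_ _. 0" "\<lambda>_. 0" g] assms by auto

section \<open>Defining functions and the outward normal\<close>

lemma local_defining_functionD:
  assumes "local_defining_function \<Omega> U \<phi> z"
  shows "open U" "z \<in> U" "smooth_on U \<phi>" "x \<in> U \<Longrightarrow> grad \<phi> x \<noteq> 0"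
    "x \<in> U \<Longrightarrow> x \<in> \<Omega> \<longleftrightarrow> \<phi> x < 0"
  using assms unfolding local_defining_function_def by blast+

text \<open>A frontier point lies outside the open set \<open>\<Omega>\<close>, so
  \<open>\<phi>\<close> is nonnegative there; a positive value would give a neighbourhood free of
  points of \<open>\<Omega>\<close>. The point may be any frontier point in \<open>U\<close>, not
  only \<open>z\<close>.\<close>

lemma frontier_local_defining_function:
  assumes "open \<Omega>" "local_defining_function \<Omega> U \<phi> z" "x \<in> frontier \<Omega>" "x \<in> U"
  shows "\<phi> x = 0"
proof -
  note U = local_defining_functionD[OF assms(2)]
  have x: "x \<notin> \<Omega>" "x \<in> closure \<Omega>"
    using assms(1,3) by (auto simp: frontier_def interior_open)
  then have "\<phi> x \<ge> 0" using U(5) assms(4) by force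
  moreover have "\<not> \<phi> x > 0"
  proof
    assume "\<phi> x > 0"
    moreover have "continuous_on U \<phi>" using U(3) by (rule smooth_on_continuous_on)
    ultimately have "open (U \<inter> \<phi> -` {0<..})" "x \<in> U \<inter> \<phi> -` {0<..}"
      using U(1) assms(4) by (auto simp: continuous_on_open_vimage intro: continuous_open_preimage)
    then have "U \<inter> \<phi> -` {0<..} \<inter> \<Omega> \<noteq> {}"
      using x(2) open_Int_closure_eq_empty[of "U \<inter> \<phi> -` {0<..}" \<Omega>] by blast
    then show False using U(5) by force
  qed
  ultimately show ?thesis by simp
qed

text \<open>\<open>outward_normal\<close> is a \<open>SOME\<close> choice among all defining
  functions. These two properties hold for whichever one is chosen: against its gradient
  \<open>\<phi>\<close> decreases from 0, so a short step enters \<open>\<Omega>\<close>.\<close>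

lemma outward_normal_points_outward:
  assumes "open \<Omega>" "smooth_boundary \<Omega>" "z \<in> frontier \<Omega>"
  shows "norm (outward_normal \<Omega> z) = 1"
    and "\<exists>d>0. \<forall>t. 0 < t \<longrightarrow> t < d \<longrightarrow> z - t *\<^sub>R outward_normal \<Omega> z \<in> \<Omega>"
proof -
  define n where "n = outward_normal \<Omega> z"
  have "\<exists>n U \<phi>. local_defining_function \<Omega> U \<phi> z \<and> n = (1 / norm (grad \<phi> z)) *\<^sub>R grad \<phi> z"
    using assms(2,3) unfolding smooth_boundary_def by blast
  from someI_ex[OF this] obtain U \<phi> where U: "local_defining_function \<Omega> U \<phi> z"
    and n: "n = (1 / norm (grad \<phi> z)) *\<^sub>R grad \<phi> z"
    unfolding n_def outward_normal_def by blast
  note V = local_defining_functionD[OF U]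
  have gz: "grad \<phi> z \<noteq> 0" using V(2,4) by blast
  show n1: "norm (outward_normal \<Omega> z) = 1" unfolding n_def[symmetric] n using gz by simp
  have \<phi>z: "\<phi> z = 0" using frontier_local_defining_function[OF assms(1) U assms(3) V(2)] .
  have diff: "\<phi> differentiable (at z)" using smooth_on_differentiable(1)[OF V(3,2)] .
  have der: "((\<lambda>t. \<phi> (z + t *\<^sub>R (- n))) has_real_derivative partial (- n) \<phi> z) (at 0)"
    using has_real_derivative_line[of \<phi> z 0 "- n"] diff by simp
  have "partial (- n) \<phi> z = grad \<phi> z \<bullet> (- n)"
    unfolding partial_def grad_inner[OF diff] ..
  also have "\<dots> = - norm (grad \<phi> z)"
    unfolding n using gz by (simp add: dot_square_norm power2_eq_square)
  finally have "partial (- n) \<phi> z < 0" using gz by simp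
  from DERIV_neg_dec_right[OF der this] obtain d where
    d: "d > 0" "\<And>t. 0 < t \<Longrightarrow> t < d \<Longrightarrow> \<phi> (z - t *\<^sub>R n) < 0" using \<phi>z by auto
  obtain r where r: "r > 0" "ball z r \<subseteq> U" using V(1,2) openE by blast
  have "z - t *\<^sub>R n \<in> \<Omega>" if "0 < t" "t < min d r" for t
  proof -
    have "z - t *\<^sub>R n \<in> ball z r" using that n1 by (simp add: dist_norm n_def)
    then have "z - t *\<^sub>R n \<in> U" using r(2) by blast
    then show ?thesis using d(2)[of t] V(5)[of "z - t *\<^sub>R n"] that by simp
  qed
  then show "\<exists>d>0. \<forall>t. 0 < t \<longrightarrow> t < d \<longrightarrow> z - t *\<^sub>R outward_normal \<Omega> z \<in> \<Omega>"
    unfolding n_def[symmetric] using d(1) r(1) by (intro exI[of _ "min d r"]) auto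
qed

text \<open>The derivative is known only inside \<open>\<Omega>\<close>, so the mean value theorem
  runs along the inward normal segment, and continuity of \<open>Dh\<close> up to the boundary
  carries the sign of the normal component from \<open>z\<close> to inner points. The ball serves
  barriers that live only near one boundary point.\<close>

lemma increasing_inward:
  assumes \<Omega>: "open \<Omega>" "smooth_boundary \<Omega>" "z \<in> frontier \<Omega>" and r: "r > 0"
    and h: "continuous_on (closure \<Omega> \<inter> ball z r) h"
    and Dh: "continuous_on (closure \<Omega> \<inter> ball z r) Dh"
    and der: "\<And>x. x \<in> \<Omega> \<Longrightarrow> x \<in> ball z r \<Longrightarrow> (h has_derivative (\<lambda>v. Dh x \<bullet> v)) (at x)"
    and neg: "Dh z \<bullet> outward_normal \<Omega> z < 0"
  shows "\<exists>x\<in>\<Omega> \<inter> ball z r. h z < h x"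
proof -
  define n where "n = outward_normal \<Omega> z"
  have n1: "norm n = 1" unfolding n_def by (rule outward_normal_points_outward[OF \<Omega>])
  obtain d where d: "d > 0" "\<And>t. 0 < t \<Longrightarrow> t < d \<Longrightarrow> z - t *\<^sub>R n \<in> \<Omega>"
    unfolding n_def using outward_normal_points_outward(2)[OF \<Omega>] by blast
  have z: "z \<in> closure \<Omega> \<inter> ball z r" using \<Omega>(3) r by (auto simp: frontier_def)
  have cont: "continuous_on (closure \<Omega> \<inter> ball z r) (\<lambda>x. Dh x \<bullet> n)"
    by (intro continuous_intros Dh)
  obtain e where e: "e > 0" "\<And>x. x \<in> closure \<Omega> \<inter> ball z r \<Longrightarrow> dist x z < e \<Longrightarrow> Dh x \<bullet> n < 0"
  proof -
    have "- (Dh z \<bullet> n) > 0" using neg by (simp add: n_def)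
    then obtain e where "e > 0" "\<forall>x\<in>closure \<Omega> \<inter> ball z r. dist x z < e \<longrightarrow> dist (Dh x \<bullet> n) (Dh z \<bullet> n) < - (Dh z \<bullet> n)"
      using cont z unfolding continuous_on_iff by blast
    then show ?thesis by (intro that[of e]) (auto simp: dist_real_def)
  qed
  define t where "t = min (min d e) r / 2"
  have t: "0 < t" "t < d" "t < e" "t < r" using d(1) e(1) r by (auto simp: t_def)
  have inball: "z - s *\<^sub>R n \<in> ball z r" "dist (z - s *\<^sub>R n) z < e" if "0 \<le> s" "s \<le> t" for s
    using that t n1 by (auto simp: dist_norm)
  have incl: "z - s *\<^sub>R n \<in> closure \<Omega> \<inter> ball z r" if "0 \<le> s" "s \<le> t" for s
  proof (cases "s = 0")
    case False
    then show ?thesis using d(2)[of s] that t inball[of s] closure_subset by fastforce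
  qed (use z in simp)
  have "\<exists>y. 0 < y \<and> y < t \<and> h (z - t *\<^sub>R n) - h (z - 0 *\<^sub>R n) = (t - 0) * (- (Dh (z - y *\<^sub>R n) \<bullet> n))"
  proof -
    have "continuous_on {0..t} (\<lambda>s. h (z - s *\<^sub>R n))"
      by (rule continuous_on_compose2[OF h]) (use incl in \<open>auto intro!: continuous_intros\<close>)
    moreover have "((\<lambda>s. h (z - s *\<^sub>R n)) has_derivative (\<lambda>k. Dh (z - y *\<^sub>R n) \<bullet> - (k *\<^sub>R n))) (at y)"
      if "0 < y" "y < t" for y
    proof -
      have 1: "((\<lambda>s. z - s *\<^sub>R n) has_derivative (\<lambda>k. - (k *\<^sub>R n))) (at y)"
        by (auto intro!: derivative_eq_intros)
      have 2: "(h has_derivative (\<lambda>v. Dh (z - y *\<^sub>R n) \<bullet> v)) (at (z - y *\<^sub>R n))"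
        using der[OF d(2)] inball[of y] that t by auto
      show ?thesis
        by (rule has_derivative_compose[OF 1 2])
    qed
    ultimately obtain y where "0 < y" "y < t"
      "h (z - t *\<^sub>R n) - h (z - 0 *\<^sub>R n) = Dh (z - y *\<^sub>R n) \<bullet> - ((t - 0) *\<^sub>R n)"
      using mvt[of 0 t "\<lambda>s. h (z - s *\<^sub>R n)" "\<lambda>y k. Dh (z - y *\<^sub>R n) \<bullet> - (k *\<^sub>R n)"] t(1) by blast
    then show ?thesis by auto
  qed
  then obtain y where y: "0 < y" "y < t" "h (z - t *\<^sub>R n) - h z = t * (- (Dh (z - y *\<^sub>R n) \<bullet> n))"
    by auto
  have "Dh (z - y *\<^sub>R n) \<bullet> n < 0" using e(2) incl[of y] inball[of y] y by auto
  then have "h (z - t *\<^sub>R n) > h z" using y(3) t(1) by (smt (verit) mult_pos_pos)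
  moreover have "z - t *\<^sub>R n \<in> \<Omega> \<inter> ball z r" using d(2)[of t] t inball[of t] by auto
  ultimately show ?thesis by blast
qed

subsection \<open>Barriers at the boundary and in the interior\<close>

lemma compact_continuous_bound:
  fixes f :: "'a::topological_space \<Rightarrow> real"
  assumes "compact X" "continuous_on X f"
  obtains C where "C \<ge> 1" "\<And>x. x \<in> X \<Longrightarrow> \<bar>f x\<bar> \<le> C"
proof -
  have "bounded (f ` X)" using assms compact_continuous_image compact_imp_bounded by blast
  then obtain C where "\<And>x. x \<in> X \<Longrightarrow> \<bar>f x\<bar> \<le> C" by (auto simp: bounded_iff)
  then show ?thesis by (intro that[of "max 1 C"]) (auto simp: le_max_iff_disj)
qed

lemma norm_power2_line_derivative:
  fixes y z b :: "'a::real_inner"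
  assumes "norm b = 1"
  shows "((\<lambda>t. (norm (y + t *\<^sub>R b - z))\<^sup>2) has_real_derivative 2 * ((y - z) \<bullet> b)) (at 0)"
proof -
  have eq: "(norm (y + t *\<^sub>R b - z))\<^sup>2 = (norm (y - z))\<^sup>2 + 2 * t * ((y - z) \<bullet> b) + t\<^sup>2" for t
  proof -
    have "y + t *\<^sub>R b - z = (y - z) + t *\<^sub>R b" by simp
    moreover have "b \<bullet> b = 1" using assms by (simp add: dot_square_norm)
    ultimately show ?thesis
      unfolding power2_norm_eq_inner
      by (simp only: inner_add_left inner_add_right inner_scaleR_left inner_scaleR_right)
        (simp add: inner_commute power2_eq_square distrib_left)
  qed
  show ?thesis unfolding eq by (auto intro!: derivative_eq_intros)
qed

lemma inner_line_derivative:
  fixes y z b :: "'a::real_inner"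
  assumes "norm b = 1"
  shows "((\<lambda>t. (y + t *\<^sub>R b - z) \<bullet> b) has_real_derivative 1) (at 0)"
proof -
  have "(y + t *\<^sub>R b - z) \<bullet> b = (y - z) \<bullet> b + t" for t
    using assms by (simp add: inner_diff_left inner_add_left dot_square_norm)
  then show ?thesis by (auto intro!: derivative_eq_intros)
qed

lemma norm_power2_eq_sum_Basis: "(norm (v::'a::euclidean_space))\<^sup>2 = (\<Sum>b\<in>Basis. (v \<bullet> b)\<^sup>2)"
    by (subst power2_norm_eq_inner, subst euclidean_inner) (simp add: power2_eq_square)

text \<open>The comparison function is \<open>- \<alpha> \<phi> - \<beta> \<phi>\<^sup>2 + K |x - z\<^sub>0|\<^sup>2\<close>, where \<open>\<phi>\<close> defines the boundary near \<open>z\<^sub>0\<close>: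
  \<open>\<alpha>\<close> keeps its outward slope above \<open>- s\<close>, \<open>\<beta>\<close> makes it a strict supersolution, and the last term
  confines the maximum of the difference to the ball of radius \<open>\<rho>\<close>. All three conditions fit together
  when \<open>K \<rho>\<close> is a small multiple of \<open>s\<close>.\<close>

lemma boundary_layer:
  fixes \<Omega> :: "'a::euclidean_space set"
  assumes \<Omega>: "open \<Omega>" "smooth_boundary \<Omega>"
    and V: "closure \<Omega> \<subseteq> V" and g: "smooth_on V g" "\<forall>x\<in>closure \<Omega>. g x > 0"
    and z0: "z\<^sub>0 \<in> frontier \<Omega>"
  obtains \<theta> \<rho>\<^sub>0 where "\<theta> > 0" "\<rho>\<^sub>0 > 0"
    "\<And>\<rho> s D u Du M. 0 < \<rho> \<Longrightarrow> \<rho> \<le> \<rho>\<^sub>0 \<Longrightarrow> 0 < s \<Longrightarrow> 0 \<le> D \<Longrightarrow> D * \<rho> \<le> \<theta> * s \<Longrightarrow>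
      twice_diff_on \<Omega> u \<Longrightarrow> continuous_on (closure \<Omega>) u \<Longrightarrow> continuous_on (closure \<Omega>) Du \<Longrightarrow>
      (\<And>x. x \<in> \<Omega> \<Longrightarrow> Du x = grad u x) \<Longrightarrow>
      (\<And>z. z \<in> frontier \<Omega> \<Longrightarrow> Du z \<bullet> outward_normal \<Omega> z = - s) \<Longrightarrow>
      (\<And>x. x \<in> \<Omega> \<Longrightarrow> - D \<le> elliptic_op g u x) \<Longrightarrow>
      (\<And>x. x \<in> closure \<Omega> \<Longrightarrow> u x \<le> M) \<Longrightarrow> u z\<^sub>0 \<le> M - \<theta> * s * \<rho>"
proof -
  obtain U \<phi> where U: "local_defining_function \<Omega> U \<phi> z\<^sub>0"
    using \<Omega>(2) z0 unfolding smooth_boundary_def by blast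
  note U' = local_defining_functionD[OF U]
  obtain r where r: "r > 0" "cball z\<^sub>0 r \<subseteq> U" using U'(1,2) open_contains_cball by blast
  \<comment> \<open>The constants extracted below are extrema over fixed compact sets and involve
    only \<open>\<phi>\<close> and \<open>g\<close>; hence \<open>\<theta>\<close> and
    \<open>\<rho>\<^sub>0\<close> do not depend on \<open>u\<close>, \<open>s\<close> or
    \<open>D\<close>.\<close>
  define X where "X = closure \<Omega> \<inter> cball z\<^sub>0 r"
  have X: "compact X" "z\<^sub>0 \<in> X" "X \<subseteq> V" "X \<subseteq> U" "X \<subseteq> closure \<Omega>"
    using z0 r V by (auto simp: X_def frontier_def intro: closed_Int_compact)
  have \<phi>X: "smooth_on X \<phi>" "smooth_on X g"
    using smooth_on_subset U'(3) g(1) X by blast+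
  \<comment> \<open>Taken on the full ball, which is convex: the segment from
    \<open>z\<^sub>0\<close> to a point of \<open>X\<close> may leave the closure of
    \<open>\<Omega>\<close>.\<close>
  obtain P where P: "P \<ge> 1" "\<And>x. x \<in> cball z\<^sub>0 r \<Longrightarrow> \<bar>norm (grad \<phi> x)\<bar> \<le> P"
  proof (rule compact_continuous_bound)
    show "continuous_on (cball z\<^sub>0 r) (\<lambda>x. norm (grad \<phi> x))"
      using continuous_on_subset[OF continuous_on_grad[OF U'(3)] r(2)] by (intro continuous_intros)
  qed auto
  have lip: "\<bar>\<phi> x\<bar> \<le> P * norm (x - z\<^sub>0)" if "x \<in> cball z\<^sub>0 r" for x
  proof -
    have "norm (\<phi> x - \<phi> z\<^sub>0) \<le> P * norm (x - z\<^sub>0)"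
    proof (rule differentiable_bound[of "cball z\<^sub>0 r" \<phi> "\<lambda>y v. grad \<phi> y \<bullet> v"])
      fix y assume y: "y \<in> cball z\<^sub>0 r"
      then have "\<phi> differentiable (at y)" using smooth_on_differentiable(1)[OF U'(3)] r(2) by blast
      then show "(\<phi> has_derivative (\<bullet>) (grad \<phi> y)) (at y within cball z\<^sub>0 r)"
        using has_derivative_grad has_derivative_at_withinI by blast
      show "onorm ((\<bullet>) (grad \<phi> y)) \<le> P"
        using P(2)[OF y] P(1) by (intro onorm_le) (smt (verit) Cauchy_Schwarz_ineq2 mult_right_mono norm_ge_zero real_norm_def)
    qed (use that r in auto)
    moreover have "\<phi> z\<^sub>0 = 0" using frontier_local_defining_function[OF \<Omega>(1) U z0 U'(2)] .
    ultimately show ?thesis by simp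
  qed
  obtain H where H: "H \<ge> 1" "\<And>x. x \<in> X \<Longrightarrow> \<bar>elliptic_op g \<phi> x\<bar> \<le> H"
    using compact_continuous_bound[OF X(1) continuous_on_elliptic_op[OF \<phi>X]] by blast
  \<comment> \<open>This is the operator applied to the squared distance from
    \<open>z\<^sub>0\<close>.\<close>
  define Q where "Q x = (\<Sum>b\<in>Basis. partial b g x * (2 * ((x - z\<^sub>0) \<bullet> b)) + g x * 2)" for x
  obtain G where G: "G \<ge> 1" "\<And>x. x \<in> X \<Longrightarrow> \<bar>Q x\<bar> \<le> G"
  proof (rule compact_continuous_bound[OF X(1)])
    show "continuous_on X Q" unfolding Q_def
      by (intro continuous_intros smooth_on_continuous_on[OF \<phi>X(2)])
  qed auto
  \<comment> \<open>The quadratic term of the barrier contributes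
    \<open>- 2 * \<beta> * g x * (norm (grad \<phi> x))\<^sup>2\<close>, the only term with a
    favourable sign; \<open>\<mu>\<close> bounds its size from below.\<close>
  obtain \<mu> where \<mu>: "\<mu> > 0" "\<And>x. x \<in> X \<Longrightarrow> \<mu> \<le> g x * (norm (grad \<phi> x))\<^sup>2"
  proof -
    have "continuous_on X (\<lambda>x. g x * (norm (grad \<phi> x))\<^sup>2)"
      by (intro continuous_intros smooth_on_continuous_on[OF \<phi>X(2)] continuous_on_grad \<phi>X)
    then obtain y where y: "y \<in> X" "\<And>x. x \<in> X \<Longrightarrow> g y * (norm (grad \<phi> y))\<^sup>2 \<le> g x * (norm (grad \<phi> x))\<^sup>2"
      using continuous_attains_inf[OF X(1)] X(2) by blast
    have "g y > 0" "grad \<phi> y \<noteq> 0" using g(2) U'(4) y(1) X by auto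
    then show ?thesis using y(2) by (intro that[of "g y * (norm (grad \<phi> y))\<^sup>2"]) auto
  qed
  \<comment> \<open>With \<open>\<alpha> = s / (2 * P)\<close>, the condition
    \<open>\<beta> * P * \<rho> \<le> \<alpha>\<close> reads
    \<open>\<beta> * \<mu> * \<rho> \<le> s * \<tau>\<close>. Half of \<open>\<tau>\<close> is spent
    through \<open>\<rho>\<^sub>0\<close> on the terms with \<open>H\<close> and the surplus
    \<open>s\<close>, half through \<open>\<theta>\<close> on those with \<open>K\<close> and
    \<open>D\<close>. The bound 1/8 on \<open>\<theta>\<close> keeps the slope of the barrier above
    \<open>- s\<close>.\<close>
  define \<tau> where "\<tau> = \<mu> / (2 * P\<^sup>2)"
  have \<tau>: "\<tau> > 0" using \<mu>(1) P(1) by (simp add: \<tau>_def)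
  define \<theta> where "\<theta> = min (1/8) (\<tau> / (2 * (G + 1)))"
  define \<rho>\<^sub>0 where "\<rho>\<^sub>0 = min r (\<tau> / (2 * (H + 1)))"
  have \<theta>: "\<theta> > 0" "\<theta> \<le> 1/8" "\<theta> * (G + 1) \<le> \<tau> / 2"
  proof -
    have "\<theta> * (G + 1) \<le> \<tau> / (2 * (G + 1)) * (G + 1)"
      using G(1) by (intro mult_right_mono) (auto simp: \<theta>_def)
    also have "\<dots> = \<tau> / 2" using G(1) by (simp add: field_simps)
    finally show "\<theta> * (G + 1) \<le> \<tau> / 2" .
    have "\<tau> / (2 * (G + 1)) > 0" using \<tau> G(1) by (intro divide_pos_pos) auto
    then show "\<theta> > 0" "\<theta> \<le> 1/8" unfolding \<theta>_def by (simp_all only: min_less_iff_conj min.cobounded1) simp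
  qed
  have \<rho>0: "\<rho>\<^sub>0 > 0" "\<rho>\<^sub>0 \<le> r" "\<rho>\<^sub>0 * (H + 1) \<le> \<tau> / 2"
  proof -
    have "\<rho>\<^sub>0 * (H + 1) \<le> \<tau> / (2 * (H + 1)) * (H + 1)"
      using H(1) by (intro mult_right_mono) (auto simp: \<rho>\<^sub>0_def)
    also have "\<dots> = \<tau> / 2" using H(1) by (simp add: field_simps)
    finally show "\<rho>\<^sub>0 * (H + 1) \<le> \<tau> / 2" .
    have "\<tau> / (2 * (H + 1)) > 0" using \<tau> H(1) by (intro divide_pos_pos) auto
    then show "\<rho>\<^sub>0 > 0" "\<rho>\<^sub>0 \<le> r" using r(1) by (auto simp: \<rho>\<^sub>0_def)
  qed
  show ?thesis
  proof (rule that[OF \<theta>(1) \<rho>0(1)])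
    fix \<rho> s D :: real and u :: "'a \<Rightarrow> real" and Du :: "'a \<Rightarrow> 'a" and M :: real
    assume \<rho>: "0 < \<rho>" "\<rho> \<le> \<rho>\<^sub>0" and s: "0 < s" and D: "0 \<le> D" "D * \<rho> \<le> \<theta> * s"
      and u: "twice_diff_on \<Omega> u" "continuous_on (closure \<Omega>) u"
      and Du: "continuous_on (closure \<Omega>) Du" "\<And>x. x \<in> \<Omega> \<Longrightarrow> Du x = grad u x"
        "\<And>z. z \<in> frontier \<Omega> \<Longrightarrow> Du z \<bullet> outward_normal \<Omega> z = - s"
      and Lu: "\<And>x. x \<in> \<Omega> \<Longrightarrow> - D \<le> elliptic_op g u x"
      and uM: "\<And>x. x \<in> closure \<Omega> \<Longrightarrow> u x \<le> M"
    define \<alpha> where "\<alpha> = s / (2 * P)"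
    define K where "K = \<theta> * s / \<rho>"
    \<comment> \<open>One copy of \<open>\<beta> * \<mu>\<close> is to pay for all other terms of
      the operator and leave a surplus \<open>s\<close>, which makes the inequality
      \<open>Lw\<close> strict.\<close>
    define \<beta> where "\<beta> = (\<alpha> * H + K * G + D + s) / \<mu>"
    have pos: "\<alpha> > 0" "K > 0" "\<beta> > 0"
      using s P(1) \<theta>(1) \<rho>(1) H(1) G(1) D(1) \<mu>(1)
      by (auto simp: \<alpha>_def K_def \<beta>_def intro!: divide_pos_pos add_nonneg_pos mult_pos_pos add_nonneg_nonneg mult_nonneg_nonneg)
    have K\<rho>: "K * \<rho> = \<theta> * s" using \<rho>(1) by (simp add: K_def)
    have \<beta>\<mu>: "\<beta> * \<mu> = \<alpha> * H + K * G + D + s" using \<mu>(1) by (simp add: \<beta>_def)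
    have \<rho>H: "\<rho> * (H + 1) \<le> \<tau> / 2"
      using \<rho> \<rho>0(3) H(1) by (meson add_nonneg_nonneg mult_right_mono order_trans zero_le_one)
    have \<beta>P: "\<beta> * P * \<rho> \<le> \<alpha>"
    proof -
      have "\<alpha> \<le> s" using P(1) s by (simp add: \<alpha>_def field_simps)
      then have "\<alpha> * (H * \<rho>) \<le> s * (H * \<rho>)"
        using H(1) \<rho>(1) by (intro mult_right_mono) auto
      then have "\<beta> * \<mu> * \<rho> \<le> s * (\<rho> * (H + 1) + \<theta> * (G + 1))"
        using D(2) K\<rho> unfolding \<beta>\<mu> by (simp add: algebra_simps)
      also have "\<dots> \<le> s * \<tau>" using \<rho>H \<theta>(3) s by (intro mult_left_mono) auto
      finally have "\<beta> * \<rho> \<le> s / (2 * P\<^sup>2)"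
        using \<mu>(1) P(1) by (simp add: \<tau>_def field_simps)
      then have "P * (\<beta> * \<rho>) \<le> P * (s / (2 * P\<^sup>2))" using P(1) by (intro mult_left_mono) auto
      also have "\<dots> = \<alpha>" using P(1) by (simp add: \<alpha>_def power2_eq_square)
      finally show ?thesis by (simp add: mult_ac)
    qed
    \<comment> \<open>The operator on \<open>\<phi>\<^sup>2\<close> also produces
      \<open>2 * \<phi> x * elliptic_op g \<phi> x\<close>; this lets half of the gain
      \<open>2 * \<beta> * \<mu>\<close> absorb it.\<close>
    have PH: "2 * (P * \<rho> * H) \<le> \<mu>"
    proof -
      have "\<rho> * H \<le> \<mu> / (4 * P\<^sup>2)" using \<rho>H \<rho>(1) by (simp add: \<tau>_def algebra_simps)
      then have "2 * P * (\<rho> * H) \<le> 2 * P * (\<mu> / (4 * P\<^sup>2))" using P(1) by (intro mult_left_mono) auto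
      also have "\<dots> = \<mu> / (2 * P)" using P(1) by (simp add: power2_eq_square)
      also have "\<dots> \<le> \<mu> / 1" using P(1) \<mu>(1) by (intro divide_left_mono) auto
      finally show ?thesis by (simp add: mult_ac)
    qed
    define w where "w x = - \<alpha> * \<phi> x - \<beta> * (\<phi> x)\<^sup>2 + K * (norm (x - z\<^sub>0))\<^sup>2" for x
    define w1 where "w1 b x = - \<alpha> * partial b \<phi> x - 2 * \<beta> * (\<phi> x * partial b \<phi> x) + 2 * K * ((x - z\<^sub>0) \<bullet> b)" for b x
    define Dw where "Dw x = - \<alpha> *\<^sub>R grad \<phi> x - (2 * \<beta> * \<phi> x) *\<^sub>R grad \<phi> x + (2 * K) *\<^sub>R (x - z\<^sub>0)" for x
    define Y where "Y = closure \<Omega> \<inter> cball z\<^sub>0 \<rho>"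
    have Y: "compact Y" "z\<^sub>0 \<in> Y" "Y \<subseteq> X" "Y \<subseteq> closure \<Omega>"
      using z0 \<rho> \<rho>0(2) by (auto simp: X_def Y_def frontier_def intro: closed_Int_compact)
    have \<phi>Y: "\<phi> x \<le> 0" "\<bar>\<phi> x\<bar> \<le> P * \<rho>" if "x \<in> Y" for x
    proof -
      have "x \<in> \<Omega> \<or> x \<in> frontier \<Omega>" using that Y \<Omega>(1) by (auto simp: frontier_def interior_open)
      moreover have xU: "x \<in> U" using that Y X by auto
      ultimately show "\<phi> x \<le> 0"
        using U'(5)[OF xU] frontier_local_defining_function[OF \<Omega>(1) U _ xU] by force
      have "\<bar>\<phi> x\<bar> \<le> P * norm (x - z\<^sub>0)" using that Y(3) by (intro lip) (auto simp: X_def)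
      also have "\<dots> \<le> P * \<rho>" using that P(1) by (intro mult_left_mono) (auto simp: Y_def dist_norm norm_minus_commute)
      finally show "\<bar>\<phi> x\<bar> \<le> P * \<rho>" .
    qed
    \<comment> \<open>The first two terms of \<open>w\<close> combine to
      \<open>- \<phi> x * (\<alpha> + \<beta> * \<phi> x)\<close>, a product of nonnegative factors
      by \<open>\<phi>Y\<close> and \<open>\<beta>P\<close>.\<close>
    have wY: "K * (norm (x - z\<^sub>0))\<^sup>2 \<le> w x" if "x \<in> Y" for x
    proof -
      have "\<beta> * \<bar>\<phi> x\<bar> \<le> \<beta> * (P * \<rho>)" using \<phi>Y(2)[OF that] pos by (intro mult_left_mono) auto
      then have "\<alpha> + \<beta> * \<phi> x \<ge> 0" using \<beta>P \<phi>Y(1)[OF that] by (simp add: mult.assoc)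
      then have "- \<phi> x * (\<alpha> + \<beta> * \<phi> x) \<ge> 0" using \<phi>Y(1)[OF that] by (intro mult_nonneg_nonneg) auto
      then show ?thesis by (simp add: w_def power2_eq_square algebra_simps)
    qed
    have w0: "w z\<^sub>0 = 0"
      using frontier_local_defining_function[OF \<Omega>(1) U z0 U'(2)] by (simp add: w_def)
    have wcont: "continuous_on U w"
      unfolding w_def by (intro continuous_intros smooth_on_continuous_on[OF U'(3)])
    have Dwcont: "continuous_on U Dw"
      unfolding Dw_def by (intro continuous_intros smooth_on_continuous_on[OF U'(3)] continuous_on_grad[OF U'(3)])
    have wder: "(w has_derivative (\<lambda>v. Dw x \<bullet> v)) (at x)" if "x \<in> U" for x
      unfolding w_def Dw_def power2_norm_eq_inner
      by (auto intro!: derivative_eq_intros has_derivative_grad smooth_on_differentiable(1)[OF U'(3) that]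
          simp: fun_eq_iff inner_add_left inner_diff_left inner_commute algebra_simps power2_eq_square)
    have w1: "((\<lambda>t. w (y + t *\<^sub>R b)) has_real_derivative w1 b y) (at 0)"
      if "y \<in> U" "b \<in> Basis" for y b
    proof -
      define N where "N t = (norm (y + t *\<^sub>R b - z\<^sub>0))\<^sup>2" for t
      have "(N has_real_derivative 2 * ((y - z\<^sub>0) \<bullet> b)) (at 0)"
        unfolding N_def using that(2) by (intro norm_power2_line_derivative) simp
      moreover have "((\<lambda>t. \<phi> (y + t *\<^sub>R b)) has_real_derivative partial b \<phi> y) (at 0)"
        using has_real_derivative_line[of \<phi> y 0 b] smooth_on_differentiable(1)[OF U'(3) that(1)] by simp
      ultimately show ?thesis
        unfolding w_def w1_def N_def[symmetric] by (auto intro!: derivative_eq_intros)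
    qed
    define w2 where "w2 x b = - \<alpha> * partial b (partial b \<phi>) x
        - 2 * \<beta> * ((partial b \<phi> x)\<^sup>2 + \<phi> x * partial b (partial b \<phi>) x) + 2 * K" for x b
    have w2: "((\<lambda>t. w1 b (x + t *\<^sub>R b)) has_real_derivative w2 x b) (at 0)"
      if "x \<in> U" "b \<in> Basis" for x b
      using has_real_derivative_line[of \<phi> x 0 b] has_real_derivative_line[of "partial b \<phi>" x 0 b]
        smooth_on_differentiable(1,2)[OF U'(3) that(1)]
        inner_line_derivative[of b x z\<^sub>0] that(2)
      unfolding w1_def w2_def by (auto intro!: derivative_eq_intros simp: algebra_simps power2_eq_square)
    have Lw: "(\<Sum>b\<in>Basis. partial b g x * w1 b x + g x * w2 x b) < - D" if "x \<in> Y" for x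
    proof -
      have "(\<Sum>b\<in>Basis. partial b g x * w1 b x + g x * w2 x b) =
        (\<Sum>b\<in>Basis. - (\<alpha> + 2 * \<beta> * \<phi> x) * (partial b g x * partial b \<phi> x + g x * partial b (partial b \<phi>) x)
          + (- 2 * \<beta> * g x) * (grad \<phi> x \<bullet> b)\<^sup>2
          + K * (partial b g x * (2 * ((x - z\<^sub>0) \<bullet> b)) + g x * 2))"
        by (intro sum.cong refl) (simp add: w1_def w2_def algebra_simps)
      also have "\<dots> = - (\<alpha> + 2 * \<beta> * \<phi> x) * elliptic_op g \<phi> x - 2 * \<beta> * (g x * (norm (grad \<phi> x))\<^sup>2) + K * Q x"
        unfolding sum.distrib unfolding sum_distrib_left[symmetric]
        unfolding elliptic_op_def Q_def norm_power2_eq_sum_Basis by (simp add: mult.assoc)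
      also have "\<dots> \<le> (\<alpha> + 2 * (\<beta> * (P * \<rho>))) * H - 2 * \<beta> * \<mu> + K * G"
      proof -
        have xX: "x \<in> X" using that Y by blast
        have "- (\<alpha> + 2 * \<beta> * \<phi> x) * elliptic_op g \<phi> x \<le> \<bar>\<alpha> + 2 * \<beta> * \<phi> x\<bar> * \<bar>elliptic_op g \<phi> x\<bar>"
          by (metis abs_ge_self abs_minus_cancel abs_mult)
        also have "\<dots> \<le> (\<alpha> + 2 * (\<beta> * (P * \<rho>))) * H"
        proof (intro mult_mono H(2) xX)
          have "\<bar>\<alpha> + 2 * \<beta> * \<phi> x\<bar> \<le> \<alpha> + 2 * (\<beta> * \<bar>\<phi> x\<bar>)"
            using pos by (simp add: abs_mult abs_triangle_ineq[THEN order_trans])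
          also have "\<beta> * \<bar>\<phi> x\<bar> \<le> \<beta> * (P * \<rho>)"
            using \<phi>Y(2)[OF that] pos by (intro mult_left_mono) auto
          finally show "\<bar>\<alpha> + 2 * \<beta> * \<phi> x\<bar> \<le> \<alpha> + 2 * (\<beta> * (P * \<rho>))" by simp
          show "0 \<le> \<alpha> + 2 * (\<beta> * (P * \<rho>))" using pos P(1) \<rho>(1) by simp
        qed simp
        moreover have "\<beta> * \<mu> \<le> \<beta> * (g x * (norm (grad \<phi> x))\<^sup>2)"
          using \<mu>(2)[OF xX] pos by (intro mult_left_mono) auto
        moreover have "K * Q x \<le> K * G" using G(2)[OF xX] pos by (intro mult_left_mono) auto
        ultimately show ?thesis by linarith
      qed
      also have "\<dots> = \<alpha> * H + \<beta> * (2 * (P * \<rho> * H)) - 2 * (\<beta> * \<mu>) + K * G"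
        by (simp add: algebra_simps)
      also have "\<dots> \<le> \<alpha> * H + \<beta> * \<mu> - 2 * (\<beta> * \<mu>) + K * G"
        using mult_left_mono[OF PH, of \<beta>] pos by simp
      also have "\<dots> < - D" using \<beta>\<mu> s by simp
      finally show ?thesis .
    qed
    have ucont: "continuous_on Y u" using u(2) Y(4) by (rule continuous_on_subset)
    have wcont': "continuous_on Y w" using wcont by (rule continuous_on_subset) (use X Y in blast)
    obtain x where x: "x \<in> Y" "\<And>y. y \<in> Y \<Longrightarrow> u y - w y \<le> u x - w x"
      using continuous_attains_sup[OF Y(1), of "\<lambda>x. u x - w x"] Y(2) continuous_on_diff[OF ucont wcont'] by blast
    have xU: "x \<in> U" using x X Y by auto
    \<comment> \<open>Only the sphere can carry the maximum of \<open>u - w\<close>. In the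
      interior, the operator on \<open>u\<close> would be both at least \<open>- D\<close> and below
      it; at a frontier point in the open ball, \<open>u - w\<close> still increases inward. On the
      sphere \<open>w\<close> is at least \<open>\<theta> * s * \<rho>\<close>, and \<open>w\<close>
      vanishes at \<open>z\<^sub>0\<close>, which transfers the bound there.\<close>
    consider "dist z\<^sub>0 x = \<rho>" | "x \<in> \<Omega>" "x \<in> ball z\<^sub>0 \<rho>" | "x \<in> frontier \<Omega>" "x \<in> ball z\<^sub>0 \<rho>"
      using x(1) \<Omega>(1) by (force simp: Y_def frontier_def interior_open)
    then have "u x - w x \<le> M - \<theta> * s * \<rho>"
    proof cases
      case 1
      then have "K * \<rho>\<^sup>2 \<le> w x" using wY[OF x(1)] by (simp add: dist_norm norm_minus_commute)
      moreover have "K * \<rho>\<^sup>2 = \<theta> * s * \<rho>" using K\<rho> by (simp add: power2_eq_square flip: mult.assoc)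
      ultimately show ?thesis using uM[of x] x(1) Y(4) by auto
    next
      case 2
      define S where "S = \<Omega> \<inter> ball z\<^sub>0 \<rho> \<inter> U"
      have S: "open S" "S \<subseteq> \<Omega>" "S \<subseteq> U" "x \<in> S" "S \<subseteq> Y"
        using \<Omega>(1) U'(1) 2 xU closure_subset by (auto simp: S_def Y_def)
      have "elliptic_op g u x \<le> (\<Sum>b\<in>Basis. partial b g x * w1 b x + g x * w2 x b)"
      proof (rule elliptic_op_le_at_local_max[OF S(1) S(4)])
        show "twice_diff_on S u" using u(1) S(2) unfolding twice_diff_on_def by blast
        show "g x > 0" using g(2) x(1) Y by blast
      qed (use w1[OF subsetD[OF S(3)]] w2[OF subsetD[OF S(3) S(4)]] x(2)[OF subsetD[OF S(5)]] S(4) in auto)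
      then show ?thesis using Lw[OF x(1)] Lu[OF 2(1)] by linarith
    next
      case 3
      define e where "e = \<rho> - dist z\<^sub>0 x"
      have e: "e > 0" "ball x e \<subseteq> ball z\<^sub>0 \<rho>"
        using 3(2) by (auto simp: e_def ball_subset_ball_iff dist_commute)
      have eU: "ball x e \<subseteq> U" using e(2) r(2) \<rho> \<rho>0(2) by force
      have "\<exists>y\<in>\<Omega> \<inter> ball x e. u x - w x < u y - w y"
      proof (rule increasing_inward[OF \<Omega> 3(1) e(1), of _ "\<lambda>y. Du y - Dw y"])
        show "continuous_on (closure \<Omega> \<inter> ball x e) (\<lambda>y. u y - w y)"
          "continuous_on (closure \<Omega> \<inter> ball x e) (\<lambda>y. Du y - Dw y)"
          using eU by (auto intro!: continuous_intros continuous_on_subset[OF u(2)] continuous_on_subset[OF wcont]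
              continuous_on_subset[OF Du(1)] continuous_on_subset[OF Dwcont])
        fix y assume y: "y \<in> \<Omega>" "y \<in> ball x e"
        have "u differentiable (at y)" using u(1) y unfolding twice_diff_on_def by blast
        then have "(u has_derivative (\<lambda>v. Du y \<bullet> v)) (at y)" using has_derivative_grad Du(2)[OF y(1)] by simp
        then show "((\<lambda>y. u y - w y) has_derivative (\<lambda>v. (Du y - Dw y) \<bullet> v)) (at y)"
          unfolding inner_diff_left by (rule has_derivative_diff) (use wder y eU in blast)
      next
        define n where "n = outward_normal \<Omega> x"
        have n1: "norm n = 1" unfolding n_def by (rule outward_normal_points_outward[OF \<Omega> 3(1)])
        have xr: "x \<in> cball z\<^sub>0 r" using x(1) Y(3) by (auto simp: X_def)
        have \<phi>0: "\<phi> x = 0" by (rule frontier_local_defining_function[OF \<Omega>(1) U 3(1) xU])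
        have "Dw x \<bullet> n = - (\<alpha> * (grad \<phi> x \<bullet> n)) + 2 * (K * ((x - z\<^sub>0) \<bullet> n))"
          by (simp add: Dw_def \<phi>0 inner_add_left inner_diff_left)
        \<comment> \<open>Only the size of this product enters, so \<open>n\<close> may stem from a
          defining function other than \<open>\<phi>\<close>.\<close>
        moreover have "\<bar>grad \<phi> x \<bullet> n\<bar> \<le> P"
          using Cauchy_Schwarz_ineq2[of "grad \<phi> x" n] P(2)[OF xr] n1 by simp
        then have "\<alpha> * (grad \<phi> x \<bullet> n) \<le> \<alpha> * P" using pos by (intro mult_left_mono) auto
        moreover have "\<bar>(x - z\<^sub>0) \<bullet> n\<bar> \<le> \<rho>"
          using Cauchy_Schwarz_ineq2[of "x - z\<^sub>0" n] 3(2) n1 by (simp add: dist_norm norm_minus_commute)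
        then have "K * (- ((x - z\<^sub>0) \<bullet> n)) \<le> K * \<rho>" using pos by (intro mult_left_mono) auto
        then have "- (K * ((x - z\<^sub>0) \<bullet> n)) \<le> K * \<rho>" by simp
        moreover have "\<alpha> * P = s / 2" using P(1) by (simp add: \<alpha>_def)
        moreover have "\<theta> * s \<le> 1/8 * s" using \<theta>(2) s by (intro mult_right_mono) auto
        ultimately have "Dw x \<bullet> n > - s" using K\<rho> s by linarith
        then show "(Du x - Dw x) \<bullet> outward_normal \<Omega> x < 0"
          using Du(3)[OF 3(1)] by (simp add: inner_diff_left n_def)
      qed
      then obtain y where y: "y \<in> \<Omega>" "y \<in> ball x e" "u x - w x < u y - w y" by blast
      then have "y \<in> Y" using e(2) closure_subset by (auto simp: Y_def)
      then show ?thesis using x(2)[of y] y(3) by linarith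
    qed
    then show "u z\<^sub>0 \<le> M - \<theta> * s * \<rho>" using x(2)[OF Y(2)] w0 by simp
  qed
qed

text \<open>At the exponent scale \<open>l / \<epsilon>\<close>, the operator times
  \<open>\<epsilon>\<^sup>2\<close> multiplies the barrier by at most a quantity of order
  \<open>l\<close>, uniformly in \<open>\<epsilon> \<le> 1\<close>; a small \<open>l\<close>
  therefore gives a strict supersolution for the rate \<open>k\<close>. The barrier equals
  \<open>V\<close> on the sphere, and its value at the centre is the claimed bound.\<close>

lemma interior_decay:
  fixes \<Omega> :: "'a::euclidean_space set"
  assumes \<Omega>: "open \<Omega>" and r: "0 < r" "r \<le> 1" "cball x\<^sub>0 r \<subseteq> \<Omega>"
    and G: "\<And>x. x \<in> \<Omega> \<Longrightarrow> 0 < g x \<and> g x \<le> G"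
      "\<And>x b. x \<in> \<Omega> \<Longrightarrow> b \<in> Basis \<Longrightarrow> \<bar>partial b g x\<bar> \<le> G"
    and l: "0 < l" "l \<le> 1" "8 * real DIM('a) * G * l < k"
    and \<epsilon>: "0 < \<epsilon>" "\<epsilon> \<le> 1"
    and v: "twice_diff_on \<Omega> v" "\<And>x. x \<in> \<Omega> \<Longrightarrow> k * v x \<le> \<epsilon>\<^sup>2 * elliptic_op g v x"
      "\<And>x. x \<in> \<Omega> \<Longrightarrow> v x \<le> V" and V: "V > 0"
  shows "v x\<^sub>0 \<le> V * exp (- (l * r\<^sup>2) / \<epsilon>)"
proof -
  define c where "c = l / \<epsilon>"
  define w where "w x = V * exp (c * ((norm (x - x\<^sub>0))\<^sup>2 - r\<^sup>2))" for x :: 'a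
  define w1 where "w1 b x = w x * (2 * c * ((x - x\<^sub>0) \<bullet> b))" for b x
  define w2 where "w2 x b = w x * ((2 * c * ((x - x\<^sub>0) \<bullet> b))\<^sup>2 + 2 * c)" for b x
  have w1: "((\<lambda>t. w (y + t *\<^sub>R b)) has_real_derivative w1 b y) (at 0)" if "b \<in> Basis" for y b
  proof -
    define N where "N t = (norm (y + t *\<^sub>R b - x\<^sub>0))\<^sup>2" for t
    have "(N has_real_derivative 2 * ((y - x\<^sub>0) \<bullet> b)) (at 0)"
      unfolding N_def using that by (intro norm_power2_line_derivative) simp
    moreover have "(norm (y - x\<^sub>0))\<^sup>2 = N 0" by (simp add: N_def)
    ultimately show ?thesis
      unfolding w_def w1_def N_def[symmetric] by (auto intro!: derivative_eq_intros)
  qed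
  have w2: "((\<lambda>t. w1 b (y + t *\<^sub>R b)) has_real_derivative w2 y b) (at 0)" if "b \<in> Basis" for y b
    using w1[OF that, of y] inner_line_derivative[of b y x\<^sub>0] that
    unfolding w1_def w2_def by (auto intro!: derivative_eq_intros simp: algebra_simps power2_eq_square)
  have wpos: "w x > 0" for x using V by (simp add: w_def)
  have kpos: "k > 0"
  proof -
    have "G > 0" using G(1)[of x\<^sub>0] r by force
    then show ?thesis using l by (smt (verit) mult_nonneg_nonneg of_nat_0_le_iff)
  qed
  have cont: "continuous_on (cball x\<^sub>0 r) (\<lambda>x. v x - w x)"
    unfolding w_def
    by (intro continuous_intros differentiable_imp_continuous_on)
      (use v(1) r(3) in \<open>auto simp: twice_diff_on_def\<close>)
  obtain x where x: "x \<in> cball x\<^sub>0 r" "\<And>y. y \<in> cball x\<^sub>0 r \<Longrightarrow> v y - w y \<le> v x - w x"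
    using continuous_attains_sup[OF _ _ cont] r(1) by (metis all_not_in_conv centre_in_cball compact_cball less_imp_le)
  have "v x - w x \<le> 0"
  proof (cases "dist x\<^sub>0 x = r")
    case True
    then have "w x = V" by (simp add: w_def dist_norm norm_minus_commute)
    then show ?thesis using v(3)[of x] x(1) r(3) by force
  next
    case False
    then have xb: "x \<in> ball x\<^sub>0 r" using x(1) by auto
    have x\<Omega>: "x \<in> \<Omega>" using x(1) r(3) by blast
    have "elliptic_op g v x \<le> (\<Sum>b\<in>Basis. partial b g x * w1 b x + g x * w2 x b)"
    proof (rule elliptic_op_le_at_local_max[OF open_ball xb])
      show "twice_diff_on (ball x\<^sub>0 r) v" using v(1) r(3) ball_subset_cball unfolding twice_diff_on_def by blast
    qed (use w1 w2 x(2)[OF subsetD[OF ball_subset_cball]] G(1)[OF x\<Omega>] in auto)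
    then have "\<epsilon>\<^sup>2 * elliptic_op g v x \<le> \<epsilon>\<^sup>2 * (\<Sum>b\<in>Basis. partial b g x * w1 b x + g x * w2 x b)"
      by (intro mult_left_mono) auto
    also have "\<dots> = (\<Sum>b\<in>Basis. w x * (partial b g x * (2 * l * \<epsilon> * ((x - x\<^sub>0) \<bullet> b))
        + g x * ((2 * l * ((x - x\<^sub>0) \<bullet> b))\<^sup>2 + 2 * l * \<epsilon>)))"
      unfolding sum_distrib_left
    proof (rule sum.cong[OF refl])
      fix b :: 'a
      have "l = c * \<epsilon>" using \<epsilon> by (simp add: c_def)
      then show "\<epsilon>\<^sup>2 * (partial b g x * w1 b x + g x * w2 x b) = w x * (partial b g x * (2 * l * \<epsilon> * ((x - x\<^sub>0) \<bullet> b))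
        + g x * ((2 * l * ((x - x\<^sub>0) \<bullet> b))\<^sup>2 + 2 * l * \<epsilon>))"
        by (simp add: w1_def w2_def algebra_simps power2_eq_square)
    qed
    \<comment> \<open>Per coordinate, the first derivative costs \<open>2 * l\<close> and the second
      \<open>4 * l + 2 * l\<close>, each times \<open>G\<close>, since \<open>r\<close>,
      \<open>l\<close> and \<open>\<epsilon>\<close> are at most 1.\<close>
    also have "\<dots> \<le> (\<Sum>b\<in>(Basis::'a set). w x * (8 * G * l))"
    proof (intro sum_mono mult_left_mono)
      fix b :: 'a assume b: "b \<in> Basis"
      define d where "d = (x - x\<^sub>0) \<bullet> b"
      have "\<bar>d\<bar> \<le> norm (x - x\<^sub>0)" unfolding d_def using b by (rule Basis_le_norm)
      then have d: "\<bar>d\<bar> \<le> 1" using x(1) r by (simp add: dist_norm norm_minus_commute)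
      have "partial b g x * (2 * l * \<epsilon> * d) \<le> \<bar>partial b g x\<bar> * \<bar>2 * l * \<epsilon> * d\<bar>"
        by (metis abs_ge_self abs_mult)
      also have "\<dots> \<le> G * (2 * l)"
      proof (intro mult_mono G(2) x\<Omega> b)
        have "\<epsilon> * \<bar>d\<bar> \<le> 1" using d \<epsilon> by (simp add: mult_le_one)
        then have "2 * l * (\<epsilon> * \<bar>d\<bar>) \<le> 2 * l * 1" using l by (intro mult_left_mono) auto
        then show "\<bar>2 * l * \<epsilon> * d\<bar> \<le> 2 * l" using l \<epsilon> by (simp add: abs_mult mult_ac)
      qed (use G(1)[OF x\<Omega>] in auto)
      moreover have "g x * ((2 * l * d)\<^sup>2 + 2 * l * \<epsilon>) \<le> G * (6 * l)"
      proof (intro mult_mono)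
        have "d\<^sup>2 \<le> 1" using d by (simp add: abs_square_le_1)
        then have "l * d\<^sup>2 \<le> 1" using l by (simp add: mult_le_one)
        then have "4 * l * (l * d\<^sup>2) \<le> 4 * l * 1" using l by (intro mult_left_mono) auto
        moreover have "2 * l * \<epsilon> \<le> 2 * l * 1" using l \<epsilon> by (intro mult_left_mono) auto
        ultimately show "(2 * l * d)\<^sup>2 + 2 * l * \<epsilon> \<le> 6 * l" by (simp add: power2_eq_square mult_ac)
      qed (use G(1)[OF x\<Omega>] l \<epsilon> in auto)
      ultimately show "partial b g x * (2 * l * \<epsilon> * ((x - x\<^sub>0) \<bullet> b)) + g x * ((2 * l * ((x - x\<^sub>0) \<bullet> b))\<^sup>2 + 2 * l * \<epsilon>)
          \<le> 8 * G * l" unfolding d_def by (simp add: algebra_simps)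
    qed (use wpos[of x] in simp)
    also have "\<dots> = w x * (8 * real DIM('a) * G * l)" by simp
    also have "\<dots> < w x * k" using l(3) wpos by simp
    finally have "k * v x < k * w x" using v(2)[OF x\<Omega>] by (simp add: mult.commute)
    then show ?thesis using kpos by simp
  qed
  then have "v x\<^sub>0 \<le> w x\<^sub>0" using x(2)[of x\<^sub>0] r(1) by simp
  then show ?thesis by (simp add: w_def c_def)
qed

subsection \<open>Hausdorff measure\<close>

definition hausdorff_weight :: "nat \<Rightarrow> 'a::metric_space set \<Rightarrow> ennreal" where
  "hausdorff_weight d C = ennreal (unit_ball_vol (real d) * (diameter C / 2) ^ d)"

lemma hausdorff_pre_alt:
  "hausdorff_pre d \<delta> E =
    (INF C \<in> {C. E \<subseteq> (\<Union>i. C i) \<and> (\<forall>i. bounded (C i) \<and> diameter (C i) \<le> \<delta>)}. \<Sum>i. hausdorff_weight d (C i))"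
  unfolding hausdorff_pre_def hausdorff_weight_def ..

lemma hausdorff_pre_le:
  assumes "E \<subseteq> (\<Union>i. C i)" "\<And>i. bounded (C i)" "\<And>i. diameter (C i) \<le> \<delta>"
  shows "hausdorff_pre d \<delta> E \<le> (\<Sum>i. hausdorff_weight d (C i))"
  unfolding hausdorff_pre_alt by (rule INF_lower) (use assms in auto)

lemma hausdorff_pre_lessE:
  assumes "hausdorff_pre d \<delta> E < a"
  obtains C where "E \<subseteq> (\<Union>i. C i)" "\<And>i. bounded (C i)" "\<And>i. diameter (C i) \<le> \<delta>"
    "(\<Sum>i. hausdorff_weight d (C i)) < a"
  using assms unfolding hausdorff_pre_alt INF_less_iff by auto

lemma hausdorff_pre_mono: "E \<subseteq> F \<Longrightarrow> hausdorff_pre d \<delta> E \<le> hausdorff_pre d \<delta> F"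
  unfolding hausdorff_pre_alt by (rule INF_superset_mono) auto

lemma hausdorff_pre_antimono: "\<delta> \<le> \<delta>' \<Longrightarrow> hausdorff_pre d \<delta>' E \<le> hausdorff_pre d \<delta> E"
  unfolding hausdorff_pre_alt by (rule INF_superset_mono) (auto intro: order_trans)

text \<open>Covers are sequences, so finite ones are padded with empty sets. As
  \<open>0 ^ 0 = 1\<close>, padding is free only for \<open>d > 0\<close>, which explains this
  assumption in what follows.\<close>

lemma hausdorff_weight_empty [simp]: "d > 0 \<Longrightarrow> hausdorff_weight d {} = 0"
  unfolding hausdorff_weight_def by simp

lemma hausdorff_pre_empty:
  assumes "d > 0" "\<delta> > 0"
  shows "hausdorff_pre d \<delta> {} = 0"
  using hausdorff_pre_le[of "{}" "\<lambda>_. {}" \<delta> d] assms by simp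

text \<open>Covers of the \<open>E n\<close> with errors \<open>e / 2 ^ (n + 1)\<close> are merged
  into one sequence by \<open>prod_decode\<close>.\<close>

lemma hausdorff_pre_countable_subadditive:
  "hausdorff_pre d \<delta> (\<Union>n. E n) \<le> (\<Sum>n. hausdorff_pre d \<delta> (E n :: 'a::euclidean_space set))"
proof (rule ennreal_le_epsilon)
  fix e :: real assume fin: "(\<Sum>n. hausdorff_pre d \<delta> (E n)) < top" and e: "0 < e"
  have "\<exists>C. E n \<subseteq> (\<Union>i. C i) \<and> (\<forall>i. bounded (C i) \<and> diameter (C i) \<le> \<delta>) \<and>
      (\<Sum>i. hausdorff_weight d (C i)) \<le> hausdorff_pre d \<delta> (E n) + ennreal (e * (1/2) ^ Suc n)" for n
  proof -
    have "hausdorff_pre d \<delta> (E n) \<noteq> top"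
      using fin by (metis ennreal_suminf_lessD less_irrefl)
    then have "hausdorff_pre d \<delta> (E n) < hausdorff_pre d \<delta> (E n) + ennreal (e * (1/2) ^ Suc n)"
      using e by (cases "hausdorff_pre d \<delta> (E n)")
        (auto simp: ennreal_less_iff simp del: ennreal_plus simp flip: ennreal_plus)
    from hausdorff_pre_lessE[OF this] show ?thesis by (metis less_imp_le)
  qed
  then obtain C where C: "\<And>n. E n \<subseteq> (\<Union>i. C n i)" "\<And>n i. bounded (C n i)" "\<And>n i. diameter (C n i) \<le> \<delta>"
    "\<And>n. (\<Sum>i. hausdorff_weight d (C n i)) \<le> hausdorff_pre d \<delta> (E n) + ennreal (e * (1/2) ^ Suc n)"
    by metis
  define B where "B k = (case prod_decode k of (n, i) \<Rightarrow> C n i)" for k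
  have "(\<Union>n. E n) \<subseteq> (\<Union>k. B k)"
  proof
    fix x assume "x \<in> (\<Union>n. E n)"
    then obtain n i where "x \<in> C n i" using C(1) by blast
    then have "x \<in> B (prod_encode (n, i))" by (simp add: B_def)
    then show "x \<in> (\<Union>k. B k)" by blast
  qed
  then have "hausdorff_pre d \<delta> (\<Union>n. E n) \<le> (\<Sum>k. hausdorff_weight d (B k))"
    by (rule hausdorff_pre_le) (auto simp: B_def C split: prod.split)
  also have "\<dots> = (\<Sum>k. (\<lambda>(n, i). hausdorff_weight d (C n i)) (prod_decode k))"
    by (intro suminf_cong) (simp add: B_def split: prod.split)
  also have "\<dots> = (\<Sum>n. \<Sum>i. hausdorff_weight d (C n i))"
    by (rule suminf_ennreal_2dimen) simp
  also have "\<dots> \<le> (\<Sum>n. hausdorff_pre d \<delta> (E n) + ennreal (e * (1/2) ^ Suc n))"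
    by (intro suminf_le C(4)) auto
  also have "\<dots> = (\<Sum>n. hausdorff_pre d \<delta> (E n)) + (\<Sum>n. ennreal (e * (1/2) ^ Suc n))"
    by (rule suminf_add[symmetric]) auto
  also have "(\<Sum>n. ennreal (e * (1/2) ^ Suc n)) = ennreal e"
  proof -
    have "(\<lambda>n. e * (1/2) ^ Suc n) sums (e * 1)" by (intro sums_mult power_half_series)
    then show ?thesis using e by (subst suminf_ennreal_eq) auto
  qed
  finally show "hausdorff_pre d \<delta> (\<Union>n. E n) \<le> (\<Sum>n. hausdorff_pre d \<delta> (E n)) + ennreal e" .
qed

text \<open>A set of diameter at most \<open>\<delta> < \<eta>\<close> cannot meet both
  \<open>A\<close> and \<open>B\<close>, so a cover of the union splits into two covers without
  using a piece twice.\<close>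

lemma hausdorff_pre_add_separated:
  fixes A B :: "'a::euclidean_space set"
  assumes d: "d > 0" and "\<delta> < \<eta>" "\<delta> > 0" and sep: "\<And>x y. x \<in> A \<Longrightarrow> y \<in> B \<Longrightarrow> \<eta> \<le> dist x y"
  shows "hausdorff_pre d \<delta> A + hausdorff_pre d \<delta> B \<le> hausdorff_pre d \<delta> (A \<union> B)"
  unfolding hausdorff_pre_alt[of d \<delta> "A \<union> B"]
proof (rule INF_greatest, clarify)
  fix C :: "nat \<Rightarrow> 'a set" assume C: "A \<union> B \<subseteq> \<Union> (range C)" "\<forall>i. bounded (C i) \<and> diameter (C i) \<le> \<delta>"
  define CA where "CA i = (if C i \<inter> A = {} then {} else C i)" for i
  define CB where "CB i = (if C i \<inter> A = {} then C i else {})" for i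
  have disj: "B \<inter> C i = {}" if "C i \<inter> A \<noteq> {}" for i
  proof (rule ccontr)
    assume "B \<inter> C i \<noteq> {}"
    then obtain x y where "x \<in> A" "x \<in> C i" "y \<in> B" "y \<in> C i" using \<open>C i \<inter> A \<noteq> {}\<close> by blast
    then have "\<eta> \<le> dist x y" "dist x y \<le> diameter (C i)" "diameter (C i) \<le> \<delta>"
      using diameter_bounded_bound[of "C i" x y] sep[of x y] C(2) by auto
    then show False using \<open>\<delta> < \<eta>\<close> by linarith
  qed
  have cov: "A \<subseteq> \<Union> (range CA)" "B \<subseteq> \<Union> (range CB)"
  proof -
    show "A \<subseteq> \<Union> (range CA)"
    proof
      fix x assume "x \<in> A"
      moreover from this obtain i where "x \<in> C i" using C(1) by blast
      ultimately have "x \<in> CA i" by (auto simp: CA_def)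
      then show "x \<in> \<Union> (range CA)" by blast
    qed
    show "B \<subseteq> \<Union> (range CB)"
    proof
      fix x assume "x \<in> B"
      moreover from this obtain i where "x \<in> C i" using C(1) by blast
      ultimately have "x \<in> CB i" using disj[of i] by (auto simp: CB_def)
      then show "x \<in> \<Union> (range CB)" by blast
    qed
  qed
  have "hausdorff_pre d \<delta> A \<le> (\<Sum>i. hausdorff_weight d (CA i))"
    by (rule hausdorff_pre_le[OF cov(1)]) (use C(2) \<open>\<delta> > 0\<close> in \<open>auto simp: CA_def\<close>)
  moreover have "hausdorff_pre d \<delta> B \<le> (\<Sum>i. hausdorff_weight d (CB i))"
    by (rule hausdorff_pre_le[OF cov(2)]) (use C(2) \<open>\<delta> > 0\<close> in \<open>auto simp: CB_def\<close>)
  ultimately have "hausdorff_pre d \<delta> A + hausdorff_pre d \<delta> B \<le>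
      (\<Sum>i. hausdorff_weight d (CA i)) + (\<Sum>i. hausdorff_weight d (CB i))"
    by (rule add_mono)
  also have "\<dots> = (\<Sum>i. hausdorff_weight d (CA i) + hausdorff_weight d (CB i))"
    by (rule suminf_add) auto
  also have "\<dots> = (\<Sum>i. hausdorff_weight d (C i))"
    by (intro suminf_cong) (simp add: CA_def CB_def d)
  finally show "hausdorff_pre d \<delta> A + hausdorff_pre d \<delta> B \<le> (\<Sum>i. hausdorff_weight d (C i))" .
qed

lemma hausdorff_pre_le_outer: "\<delta> > 0 \<Longrightarrow> hausdorff_pre d \<delta> E \<le> hausdorff_outer d E"
  unfolding hausdorff_outer_def by (rule SUP_upper) simp

lemma hausdorff_outer_leI: "(\<And>\<delta>. \<delta> > 0 \<Longrightarrow> hausdorff_pre d \<delta> E \<le> a) \<Longrightarrow> hausdorff_outer d E \<le> a"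
  unfolding hausdorff_outer_def by (rule SUP_least) simp

lemma hausdorff_outer_mono: "E \<subseteq> F \<Longrightarrow> hausdorff_outer d E \<le> hausdorff_outer d F"
  using hausdorff_pre_mono hausdorff_pre_le_outer by (intro hausdorff_outer_leI) (blast intro: order_trans)

lemma hausdorff_outer_empty: "d > 0 \<Longrightarrow> hausdorff_outer d {} = 0"
  using hausdorff_outer_leI[of d "{}" 0] hausdorff_pre_empty by auto

lemma hausdorff_outer_countable_subadditive:
  "hausdorff_outer d (\<Union>n. E n) \<le> (\<Sum>n. hausdorff_outer d (E n :: 'a::euclidean_space set))"
proof (rule hausdorff_outer_leI)
  fix \<delta> :: real assume "\<delta> > 0"
  have "hausdorff_pre d \<delta> (\<Union>n. E n) \<le> (\<Sum>n. hausdorff_pre d \<delta> (E n))"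
    by (rule hausdorff_pre_countable_subadditive)
  also have "\<dots> \<le> (\<Sum>n. hausdorff_outer d (E n))"
    by (intro suminf_le hausdorff_pre_le_outer \<open>\<delta> > 0\<close>) auto
  finally show "hausdorff_pre d \<delta> (\<Union>n. E n) \<le> (\<Sum>n. hausdorff_outer d (E n))" .
qed

lemma hausdorff_outer_subadditive:
  assumes "d > 0"
  shows "hausdorff_outer d (A \<union> B) \<le> hausdorff_outer d A + hausdorff_outer d (B :: 'a::euclidean_space set)"
  using hausdorff_outer_countable_subadditive[of d "binaryset A B"]
  by (simp add: UN_binaryset_eq suminf_binaryset_eq hausdorff_outer_empty[OF assms])

lemma hausdorff_outer_add_separated:
  assumes d: "d > 0" and \<eta>: "\<eta> > 0" and sep: "\<And>x y. x \<in> A \<Longrightarrow> y \<in> B \<Longrightarrow> \<eta> \<le> dist x y"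
  shows "hausdorff_outer d A + hausdorff_outer d B \<le> hausdorff_outer d (A \<union> B)"
proof -
  have "hausdorff_pre d \<delta> A + hausdorff_pre d \<delta>' B \<le> hausdorff_outer d (A \<union> B)"
    if "\<delta> > 0" "\<delta>' > 0" for \<delta> \<delta>'
  proof -
    \<comment> \<open>The two suprema run over independent scales; passing to a common finer scale
      below the gap \<open>\<eta>\<close> can only increase both values.\<close>
    define \<delta>'' where "\<delta>'' = min (min \<delta> \<delta>') (\<eta> / 2)"
    have *: "\<delta>'' > 0" "\<delta>'' < \<eta>" "\<delta>'' \<le> \<delta>" "\<delta>'' \<le> \<delta>'" using that \<eta> by (auto simp: \<delta>''_def)
    have "hausdorff_pre d \<delta> A + hausdorff_pre d \<delta>' B \<le> hausdorff_pre d \<delta>'' A + hausdorff_pre d \<delta>'' B"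
      by (intro add_mono hausdorff_pre_antimono *)
    also have "\<dots> \<le> hausdorff_pre d \<delta>'' (A \<union> B)"
      using hausdorff_pre_add_separated[OF d *(2,1) sep] .
    also have "\<dots> \<le> hausdorff_outer d (A \<union> B)" using *(1) by (rule hausdorff_pre_le_outer)
    finally show ?thesis .
  qed
  then have "hausdorff_outer d A + hausdorff_pre d \<delta>' B \<le> hausdorff_outer d (A \<union> B)"
    if "\<delta>' > 0" for \<delta>'
    unfolding hausdorff_outer_def[of d A] using that
    by (subst ennreal_SUP_add_left[symmetric]) (auto intro!: SUP_least)
  then show ?thesis
    unfolding hausdorff_outer_def[of d B]
    by (subst ennreal_SUP_add_right) (auto intro!: SUP_least)
qed

text \<open>The gap may shrink with \<open>i\<close>, as it does for rings that accumulate at a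
  closed set.\<close>

lemma hausdorff_outer_sum_separated:
  assumes d: "d > 0"
    and sep: "\<And>i. \<exists>\<eta>>0. \<forall>j<i. \<forall>x\<in>R j. \<forall>y\<in>R i. \<eta> \<le> dist x y"
  shows "(\<Sum>j<n. hausdorff_outer d (R j)) \<le> hausdorff_outer d (\<Union>j<n::nat. R j)"
proof (induction n)
  case (Suc n)
  obtain \<eta> where \<eta>: "\<eta> > 0" "\<And>j x y. j < n \<Longrightarrow> x \<in> R j \<Longrightarrow> y \<in> R n \<Longrightarrow> \<eta> \<le> dist x y"
    using sep[of n] by blast
  have "(\<Sum>j<Suc n. hausdorff_outer d (R j)) \<le> hausdorff_outer d (\<Union>j<n. R j) + hausdorff_outer d (R n)"
    using Suc by (simp add: add_right_mono)
  also have "\<dots> \<le> hausdorff_outer d ((\<Union>j<n. R j) \<union> R n)"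
    by (rule hausdorff_outer_add_separated[OF d \<eta>(1)]) (use \<eta>(2) in auto)
  also have "(\<Union>j<n. R j) \<union> R n = (\<Union>j<Suc n. R j)" by (auto simp: lessThan_Suc)
  finally show ?case .
qed (simp add: hausdorff_outer_empty[OF d])

text \<open>The classical proof that closed sets are measurable for a metric outer measure. Rings
  around \<open>F\<close> whose indices differ by at least 2 have a positive gap, so the even ones
  and the odd ones each sum to at most the measure of \<open>E\<close>. Hence the rings close to
  \<open>F\<close> have small total measure, and the rest of \<open>E - F\<close> has positive
  distance from \<open>F\<close>.\<close>

lemma hausdorff_outer_caratheodory:
  fixes E F :: "'a::euclidean_space set"
  assumes d: "d > 0" and F: "closed F"
  shows "hausdorff_outer d (E \<inter> F) + hausdorff_outer d (E - F) = hausdorff_outer d E"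
proof (rule antisym)
  have "E = (E \<inter> F) \<union> (E - F)" by blast
  then show "hausdorff_outer d E \<le> hausdorff_outer d (E \<inter> F) + hausdorff_outer d (E - F)"
    using hausdorff_outer_subadditive[OF d] by metis
next
  let ?H = "hausdorff_outer d"
  show "?H (E \<inter> F) + ?H (E - F) \<le> ?H E"
  \<comment> \<open>\<open>infdist x {}\<close> is 0 by convention, so distances carry no
    information for the empty set.\<close>
  proof (cases "F = {} \<or> ?H E = top")
    case True
    then show ?thesis by (auto simp: hausdorff_outer_empty[OF d])
  next
    case False
    then have ne: "F \<noteq> {}" and fin: "?H E < top" by (auto simp: top.not_eq_extremum)
    define f where "f x = infdist x F" for x
    have lip: "f x \<le> f y + dist x y" for x y unfolding f_def by (rule infdist_triangle)
    define E' where "E' k = {x\<in>E. 1 / real (k + 1) \<le> f x}" for k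
    define R where "R k = {x\<in>E. 1 / real (k + 2) \<le> f x \<and> f x < 1 / real (k + 1)}" for k
    have sepR: "\<exists>\<eta>>0. \<forall>x\<in>R j. \<forall>y\<in>R i. \<eta> \<le> dist x y" if "j + 2 \<le> i" for i j
    proof (intro exI conjI ballI)
      have "1 / real (j + 3) < 1 / real (j + 2)" by (intro divide_strict_left_mono) auto
      then show "1 / real (j + 2) - 1 / real (j + 3) > 0" by simp
      fix x y assume "x \<in> R j" "y \<in> R i"
      then have "1 / real (j + 2) \<le> f x" "f y < 1 / real (i + 1)" by (auto simp: R_def)
      moreover have "1 / real (i + 1) \<le> 1 / real (j + 3)" using that by (intro divide_left_mono) auto
      ultimately show "1 / real (j + 2) - 1 / real (j + 3) \<le> dist x y" using lip[of x y] by linarith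
    qed
    \<comment> \<open>The values 0 and 1 of \<open>m\<close> give the two parity classes.\<close>
    have bound: "(\<Sum>j<n. ?H (R (2 * j + m))) \<le> ?H E" for n m
    proof -
      have "(\<Sum>j<n. ?H (R (2 * j + m))) \<le> ?H (\<Union>j<n. R (2 * j + m))"
      proof (rule hausdorff_outer_sum_separated[OF d])
        fix i
        have "\<forall>j\<in>{..<i}. \<exists>\<eta>>0. \<forall>x\<in>R (2 * j + m). \<forall>y\<in>R (2 * i + m). \<eta> \<le> dist x y"
          using sepR by auto
        then obtain \<eta> where \<eta>: "\<And>j. j < i \<Longrightarrow> \<eta> j > 0"
          "\<And>j x y. j < i \<Longrightarrow> x \<in> R (2 * j + m) \<Longrightarrow> y \<in> R (2 * i + m) \<Longrightarrow> \<eta> j \<le> dist x y"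
          unfolding bchoice_iff by auto
        show "\<exists>\<eta>>0. \<forall>j<i. \<forall>x\<in>R (2 * j + m). \<forall>y\<in>R (2 * i + m). \<eta> \<le> dist x y"
        proof (intro exI conjI)
          show "Min (insert 1 (\<eta> ` {..<i})) > 0" using \<eta>(1) by auto
          show "\<forall>j<i. \<forall>x\<in>R (2 * j + m). \<forall>y\<in>R (2 * i + m). Min (insert 1 (\<eta> ` {..<i})) \<le> dist x y"
          proof (intro allI impI ballI)
            fix j x y assume j: "j < i" "x \<in> R (2 * j + m)" "y \<in> R (2 * i + m)"
            have "Min (insert 1 (\<eta> ` {..<i})) \<le> \<eta> j" using j(1) by (intro Min_le) auto
            then show "Min (insert 1 (\<eta> ` {..<i})) \<le> dist x y" using \<eta>(2)[OF j] by linarith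
          qed
        qed
      qed
      also have "\<dots> \<le> ?H E" by (rule hausdorff_outer_mono) (auto simp: R_def)
      finally show ?thesis .
    qed
    have "(\<Sum>j<n. ?H (R j)) \<le> 2 * ?H E" for n
    proof -
      have "(\<Sum>j<n. ?H (R j)) \<le> (\<Sum>j<2 * n. ?H (R j))"
        by (intro sum_mono2) auto
      also have "\<dots> = (\<Sum>j<n. ?H (R (2 * j + 0))) + (\<Sum>j<n. ?H (R (2 * j + 1)))"
        by (induction n) (auto simp: algebra_simps)
      also have "\<dots> \<le> ?H E + ?H E" by (intro add_mono bound)
      finally show ?thesis by (simp add: mult_2)
    qed
    then have "(\<Sum>j. ?H (R j)) \<le> 2 * ?H E"
      by (intro suminf_le_const) auto
    also have "\<dots> < top" using fin by (simp add: ennreal_mult_less_top)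
    finally have sumfin: "(\<Sum>j. ?H (R j)) < top" .
    define a where "a j = enn2real (?H (R j))" for j
    have a: "?H (R j) = ennreal (a j)" "0 \<le> a j" for j
    proof -
      have "?H (R j) \<le> ?H E" by (rule hausdorff_outer_mono) (auto simp: R_def)
      then show "?H (R j) = ennreal (a j)" using fin by (simp add: a_def le_less_trans)
    qed (simp add: a_def)
    have suma: "summable a"
      using sumfin a by (intro summable_suminf_not_top) auto
    show ?thesis
    proof (rule ennreal_le_epsilon)
      fix e :: real assume "0 < e"
      then obtain k where k: "\<And>n. n \<ge> k \<Longrightarrow> norm (\<Sum>i. a (i + n)) < e"
        using suminf_exist_split[OF _ suma] by blast
      have tail: "(\<Sum>i. ?H (R (i + k))) \<le> ennreal e"
      proof -
        have "summable (\<lambda>i. a (i + k))" using suma by (rule summable_ignore_initial_segment)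
        then have "(\<Sum>i. ?H (R (i + k))) = ennreal (\<Sum>i. a (i + k))"
          unfolding a by (intro suminf_ennreal2) (use a(2) in auto)
        then show ?thesis using k[of k] by (auto intro!: ennreal_leI)
      qed
      have "E - F \<subseteq> E' k \<union> (\<Union>i. R (i + k))"
      proof
        fix x assume x: "x \<in> E - F"
        then have pos: "f x > 0" unfolding f_def using F ne
          by (metis DiffD2 closure_closed in_closure_iff_infdist_zero infdist_nonneg less_eq_real_def)
        show "x \<in> E' k \<union> (\<Union>i. R (i + k))"
        proof (cases "1 / real (k + 1) \<le> f x")
          case False
          obtain n0 where n0: "1 / real (Suc n0) < f x"
            using nat_approx_posE[OF pos] by metis
          \<comment> \<open>The least such index locates the ring of \<open>x\<close>; it is at
            least \<open>k\<close> because \<open>f x < 1 / (k + 1)\<close>.\<close>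
          define n where "n = (LEAST n. 1 / real (n + 2) \<le> f x)"
          have ex: "1 / real (n0 + 2) \<le> f x"
          proof -
            have "1 / real (n0 + 2) \<le> 1 / real (Suc n0)" by (intro divide_left_mono) auto
            then show ?thesis using n0 by linarith
          qed
          have n1: "1 / real (n + 2) \<le> f x" unfolding n_def by (rule LeastI[of "\<lambda>n. 1 / real (n + 2) \<le> f x", OF ex])
          have nk: "n \<ge> k"
          proof (rule ccontr)
            assume "\<not> n \<ge> k"
            then have "1 / real (k + 1) \<le> 1 / real (n + 2)" by (intro divide_left_mono) auto
            then show False using n1 False by linarith
          qed
          have n2: "f x < 1 / real (n + 1)"
          proof (cases "n = k")
            case True then show ?thesis using False by simp
          next
            case neq: False
            then obtain n' where n': "n = Suc n'" using nk by (cases n) auto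
            have "n' < (LEAST n. 1 / real (n + 2) \<le> f x)" using n' unfolding n_def by linarith
            from not_less_Least[OF this] show ?thesis using n' by (simp add: add.commute)
          qed
          have "x \<in> R ((n - k) + k)" using n1 n2 x nk by (simp add: R_def)
          then show ?thesis by blast
        qed (use x in \<open>simp add: E'_def\<close>)
      qed
      then have "?H (E - F) \<le> ?H (E' k \<union> (\<Union>i. R (i + k)))" by (rule hausdorff_outer_mono)
      also have "\<dots> \<le> ?H (E' k) + ?H (\<Union>i. R (i + k))" by (rule hausdorff_outer_subadditive[OF d])
      also have "?H (\<Union>i. R (i + k)) \<le> (\<Sum>i. ?H (R (i + k)))"
        by (rule hausdorff_outer_countable_subadditive)
      also have "\<dots> \<le> ennreal e" by (rule tail)
      finally have 1: "?H (E - F) \<le> ?H (E' k) + ennreal e" by (simp add: add_left_mono)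
      have "?H (E \<inter> F) + ?H (E' k) \<le> ?H ((E \<inter> F) \<union> E' k)"
      proof (rule hausdorff_outer_add_separated[OF d])
        show "1 / real (k + 1) > 0" by simp
        fix x y assume "x \<in> E \<inter> F" "y \<in> E' k"
        then show "1 / real (k + 1) \<le> dist x y"
          using infdist_le[of x F y] by (auto simp: E'_def f_def dist_commute)
      qed
      also have "\<dots> \<le> ?H E" by (rule hausdorff_outer_mono) (auto simp: E'_def)
      finally have "?H (E \<inter> F) + ?H (E' k) + ennreal e \<le> ?H E + ennreal e" by (rule add_right_mono)
      with add_left_mono[OF 1, of "?H (E \<inter> F)"]
      show "?H (E \<inter> F) + ?H (E - F) \<le> ?H E + ennreal e"
        unfolding add.assoc by (rule order_trans)
    qed
  qed
qed

text \<open>Without this, \<open>measure_of\<close> would turn \<open>hausdorff_measure\<close> into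
  the zero measure. The Caratheodory measurable sets form a sigma-algebra that contains the closed
  sets, hence all Borel sets.\<close>

lemma hausdorff_measure_space:
  assumes d: "d > 0"
  shows "measure_space UNIV (sets (borel :: 'a::euclidean_space measure)) (hausdorff_outer d)"
proof -
  let ?L = "lambda_system UNIV UNIV (hausdorff_outer d :: 'a set \<Rightarrow> ennreal)"
  interpret sigma_algebra UNIV "UNIV :: 'a set set" using sigma_algebra_Pow[of UNIV] by simp
  have "outer_measure_space UNIV (hausdorff_outer d :: 'a set \<Rightarrow> ennreal)"
    unfolding outer_measure_space_def positive_def increasing_def countably_subadditive_def
    using hausdorff_outer_empty[OF d] hausdorff_outer_mono hausdorff_outer_countable_subadditive by blast
  then have L: "measure_space UNIV ?L (hausdorff_outer d)" by (rule caratheodory_lemma)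
  have "Collect closed \<subseteq> ?L"
    using hausdorff_outer_caratheodory[OF d] unfolding lambda_system_eq by auto
  then have "sigma_sets UNIV (Collect closed) \<subseteq> ?L"
    using L sigma_algebra.sigma_sets_subset unfolding measure_space_def by blast
  then have "sets borel \<subseteq> ?L" by (simp add: borel_eq_closed)
  then show ?thesis
    using measure_down[OF L _] sets.sigma_algebra_axioms[of "borel :: 'a measure"] by simp
qed

lemma sets_hausdorff_measure [simp]: "sets (hausdorff_measure d) = sets borel"
  unfolding hausdorff_measure_def
  using sets.sigma_sets_eq[of borel] by (simp add: sets_measure_of_conv)

lemma emeasure_hausdorff_measure:
  fixes X :: "'a::euclidean_space set"
  assumes "d > 0" "X \<in> sets borel"
  shows "emeasure (hausdorff_measure d) X = hausdorff_outer d X"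
  unfolding hausdorff_measure_def
  using hausdorff_measure_space[OF assms(1)] assms(2) unfolding measure_space_def
  by (intro emeasure_measure_of_sigma) auto

subsection \<open>Surface integrals over smooth boundaries\<close>

lemma hausdorff_pre_finite_cover:
  fixes E :: "'a::euclidean_space set"
  assumes d: "d > 0" and \<delta>: "\<delta> > 0" and I: "finite I" "E \<subseteq> (\<Union>i\<in>I. C i)"
    and C: "\<And>i. i \<in> I \<Longrightarrow> bounded (C i)" "\<And>i. i \<in> I \<Longrightarrow> diameter (C i) \<le> \<delta>"
  shows "hausdorff_pre d \<delta> E \<le> ennreal (real (card I) * (unit_ball_vol (real d) * (\<delta> / 2) ^ d))"
proof -
  obtain h where h: "bij_betw h {0..<card I} I" using ex_bij_betw_nat_finite[OF I(1)] by blast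
  then have hI: "h n \<in> I" if "n < card I" for n using that bij_betwE by fastforce
  define C' where "C' n = (if n < card I then C (h n) else {})" for n
  have "E \<subseteq> (\<Union>n. C' n)"
  proof
    fix x assume "x \<in> E"
    then obtain i where "i \<in> I" "x \<in> C i" using I(2) by blast
    then obtain n where "n < card I" "x \<in> C (h n)"
      using h by (metis atLeastLessThan_iff bij_betw_iff_bijections)
    then have "x \<in> C' n" by (simp add: C'_def)
    then show "x \<in> (\<Union>n. C' n)" by blast
  qed
  then have "hausdorff_pre d \<delta> E \<le> (\<Sum>n. hausdorff_weight d (C' n))"
    by (rule hausdorff_pre_le) (use C hI \<delta> in \<open>auto simp: C'_def\<close>)
  also have "\<dots> = (\<Sum>n<card I. hausdorff_weight d (C' n))"
    by (rule suminf_finite) (auto simp: C'_def d)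
  also have "\<dots> \<le> (\<Sum>n<card I. ennreal (unit_ball_vol (real d) * (\<delta> / 2) ^ d))"
  proof (intro sum_mono)
    fix n assume "n \<in> {..<card I}"
    then have n: "bounded (C' n)" "diameter (C' n) \<le> \<delta>" using C hI by (auto simp: C'_def)
    have "unit_ball_vol (real d) * (diameter (C' n) / 2) ^ d \<le> unit_ball_vol (real d) * (\<delta> / 2) ^ d"
      using n diameter_ge_0[OF n(1)] by (intro mult_left_mono power_mono) auto
    then show "hausdorff_weight d (C' n) \<le> ennreal (unit_ball_vol (real d) * (\<delta> / 2) ^ d)"
      unfolding hausdorff_weight_def by (rule ennreal_leI)
  qed
  also have "\<dots> = ennreal (real (card I) * (unit_ball_vol (real d) * (\<delta> / 2) ^ d))"
    using \<delta> by (simp add: ennreal_mult ennreal_of_nat_eq_real_of_nat)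
  finally show ?thesis .
qed

text \<open>A set that is Lipschitz over its coordinates other than \<open>e\<close> meets each of
  \<open>n ^ d\<close> grid cells in a piece of diameter at most \<open>W / n\<close>. The number of
  cells cancels against the \<open>d\<close>-th power of the size, so the bound is the same at every
  scale.\<close>

lemma hausdorff_outer_finite_grid:
  fixes S :: "'a::euclidean_space set"
  assumes N: "DIM('a) \<ge> 2" and e: "e \<in> Basis" and r: "r > 0"
    and near: "\<And>x b. x \<in> S \<Longrightarrow> b \<in> Basis - {e} \<Longrightarrow> \<bar>(x - z) \<bullet> b\<bar> < r"
    and L: "L > 0" "\<And>x y. x \<in> S \<Longrightarrow> y \<in> S \<Longrightarrow> norm (x - y) \<le> L * (\<Sum>b\<in>Basis - {e}. \<bar>(x - y) \<bullet> b\<bar>)"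
  shows "hausdorff_outer (DIM('a) - 1) S < top"
proof -
  define d where "d = DIM('a) - 1"
  have d: "d > 0" and cardB: "card (Basis - {e} :: 'a set) = d" using N e by (auto simp: d_def)
  define W where "W = L * (real d * (2 * r))"
  have W: "W > 0" using L r d by (simp add: W_def)
  have grid: "hausdorff_pre d (W / real n) S \<le> ennreal (unit_ball_vol (real d) * (W / 2) ^ d)" if n: "n > 0" for n :: nat
  proof -
    define I where "I = (Basis - {e} :: 'a set) \<rightarrow>\<^sub>E {..<n}"
    define C where "C j = {x\<in>S. \<forall>b\<in>Basis - {e}. nat \<lfloor>((x - z) \<bullet> b + r) / (2 * r) * real n\<rfloor> = j b}" for j
    have cardI: "card I = n ^ d" unfolding I_def using cardB by (simp add: card_PiE)
    have finI: "finite I" unfolding I_def by (intro finite_PiE) auto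
    have cov: "S \<subseteq> (\<Union>j\<in>I. C j)"
    proof
      fix x assume x: "x \<in> S"
      define j where "j = restrict (\<lambda>b. nat \<lfloor>((x - z) \<bullet> b + r) / (2 * r) * real n\<rfloor>) (Basis - {e} :: 'a set)"
      have "nat \<lfloor>((x - z) \<bullet> b + r) / (2 * r) * real n\<rfloor> < n" if b: "b \<in> Basis - {e}" for b
      proof -
        have "((x - z) \<bullet> b + r) / (2 * r) < 1" using near[OF x b] r by (simp add: field_simps)
        then have "((x - z) \<bullet> b + r) / (2 * r) * real n < 1 * real n"
          using n by (intro mult_strict_right_mono) auto
        then have "\<lfloor>((x - z) \<bullet> b + r) / (2 * r) * real n\<rfloor> < int n"
          unfolding floor_less_iff by simp
        then show ?thesis using n by linarith
      qed
      then have "j \<in> I" by (auto simp: I_def j_def)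
      moreover have "x \<in> C j" using x by (simp add: C_def j_def)
      ultimately show "x \<in> (\<Union>j\<in>I. C j)" by blast
    qed
    have dist: "norm (x - y) \<le> W / real n" if "x \<in> C j" "y \<in> C j" for x y j
    proof -
      have S: "x \<in> S" "y \<in> S" using that by (auto simp: C_def)
      have "\<bar>(x - y) \<bullet> b\<bar> \<le> 2 * r / real n" if b: "b \<in> Basis - {e}" for b
      proof -
        define tx where "tx = ((x - z) \<bullet> b + r) / (2 * r) * real n"
        define ty where "ty = ((y - z) \<bullet> b + r) / (2 * r) * real n"
        have pos: "0 \<le> tx" "0 \<le> ty"
          using near[OF S(1) b] near[OF S(2) b] r by (auto simp: tx_def ty_def intro!: mult_nonneg_nonneg divide_nonneg_nonneg)
        have "nat \<lfloor>tx\<rfloor> = nat \<lfloor>ty\<rfloor>" using \<open>x \<in> C j\<close> \<open>y \<in> C j\<close> b by (auto simp: C_def tx_def ty_def)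
        then have "\<lfloor>tx\<rfloor> = \<lfloor>ty\<rfloor>" using pos by (simp add: eq_nat_nat_iff)
        then have "\<bar>tx - ty\<bar> < 1" by linarith
        moreover have "(x - y) \<bullet> b = (tx - ty) * (2 * r / real n)"
          using r n by (simp add: tx_def ty_def field_simps inner_diff_left)
        moreover have "\<bar>tx - ty\<bar> * (2 * r / real n) \<le> 1 * (2 * r / real n)"
          using \<open>\<bar>tx - ty\<bar> < 1\<close> r by (intro mult_right_mono) auto
        ultimately show ?thesis using r n by (simp add: abs_mult)
      qed
      then have "(\<Sum>b\<in>Basis - {e}. \<bar>(x - y) \<bullet> b\<bar>) \<le> (\<Sum>b\<in>(Basis - {e} :: 'a set). 2 * r / real n)"
        by (intro sum_mono)
      also have "\<dots> = real d * (2 * r / real n)" by (simp only: sum_constant cardB)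
      finally have "L * (\<Sum>b\<in>Basis - {e}. \<bar>(x - y) \<bullet> b\<bar>) \<le> L * (real d * (2 * r / real n))"
        using L by (intro mult_left_mono) auto
      also have "\<dots> = W / real n" by (simp add: W_def)
      finally show ?thesis using L(2)[OF S] by linarith
    qed
    have bdd: "bounded (C j)" for j
      unfolding bounded_def using dist by (metis dist_norm)
    have diam: "diameter (C j) \<le> W / real n" for j
      by (rule diameter_le) (use W dist in auto)
    have "hausdorff_pre d (W / real n) S \<le>
        ennreal (real (card I) * (unit_ball_vol (real d) * ((W / real n) / 2) ^ d))"
      by (rule hausdorff_pre_finite_cover[OF d _ finI cov bdd diam]) (use W n in simp)
    also have "real (card I) * (unit_ball_vol (real d) * ((W / real n) / 2) ^ d) = unit_ball_vol (real d) * (W / 2) ^ d"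
      using n by (simp add: cardI power_divide)
    finally show ?thesis .
  qed
  have "hausdorff_outer d S \<le> ennreal (unit_ball_vol (real d) * (W / 2) ^ d)"
  proof (rule hausdorff_outer_leI)
    fix \<delta> :: real assume "\<delta> > 0"
    obtain n :: nat where n: "W / \<delta> < real n" using reals_Archimedean2 by blast
    have "n > 0" using n W \<open>\<delta> > 0\<close> by (metis divide_pos_pos less_trans of_nat_0_less_iff)
    then have "W / real n \<le> \<delta>" using n \<open>\<delta> > 0\<close> by (simp add: field_simps)
    then show "hausdorff_pre d \<delta> S \<le> ennreal (unit_ball_vol (real d) * (W / 2) ^ d)"
      using hausdorff_pre_antimono grid[OF \<open>n > 0\<close>] by (meson order_trans)
  qed
  then show ?thesis unfolding d_def by (simp add: le_less_trans)
qed

text \<open>On the zero set of a function with non-vanishing partial derivative in direction \<open>e\<close>, the mean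
  value theorem controls the \<open>e\<close>-component of a difference by the other components.\<close>

lemma hausdorff_outer_frontier_local:
  fixes \<Omega> :: "'a::euclidean_space set"
  assumes N: "DIM('a) \<ge> 2" and \<Omega>: "open \<Omega>" "smooth_boundary \<Omega>" "z \<in> frontier \<Omega>"
  shows "\<exists>r>0. hausdorff_outer (DIM('a) - 1) (frontier \<Omega> \<inter> ball z r) < top"
proof -
  obtain U \<phi> where U: "local_defining_function \<Omega> U \<phi> z"
    using \<Omega> unfolding smooth_boundary_def by blast
  note U' = local_defining_functionD[OF U]
  have "\<exists>e\<in>Basis. partial e \<phi> z \<noteq> 0"
  proof (rule ccontr)
    assume "\<not> ?thesis"
    then have "grad \<phi> z = 0" unfolding grad_def by simp
    then show False using U'(2,4) by blast
  qed
  then obtain e where e: "e \<in> Basis" "partial e \<phi> z \<noteq> 0" by blast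
  define c where "c = \<bar>partial e \<phi> z\<bar> / 2"
  have c: "c > 0" using e by (simp add: c_def)
  obtain r1 where r1: "r1 > 0" "cball z r1 \<subseteq> U" using U'(1,2) open_contains_cball by blast
  have "continuous_on U (partial e \<phi>)" by (rule smooth_on_continuous_on[OF U'(3)])
  then obtain r2 where r2: "r2 > 0" "\<And>x. x \<in> U \<Longrightarrow> dist x z < r2 \<Longrightarrow> dist (partial e \<phi> x) (partial e \<phi> z) < c"
    using U'(2) c unfolding continuous_on_iff by blast
  define r where "r = min r1 r2"
  have r: "r > 0" "ball z r \<subseteq> U" "ball z r \<subseteq> cball z r1" using r1 r2 by (auto simp: r_def)
  have lower: "c \<le> \<bar>partial e \<phi> x\<bar>" if "x \<in> ball z r" for x
  proof -
    have "\<bar>partial e \<phi> x - partial e \<phi> z\<bar> < c"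
      using r2(2)[of x] that subsetD[OF r(2) that] by (simp add: dist_real_def dist_commute r_def)
    then show ?thesis unfolding c_def by linarith
  qed
  obtain P where P: "P \<ge> 1" "\<And>x. x \<in> cball z r1 \<Longrightarrow> \<bar>norm (grad \<phi> x)\<bar> \<le> P"
  proof (rule compact_continuous_bound)
    show "continuous_on (cball z r1) (\<lambda>x. norm (grad \<phi> x))"
      using continuous_on_subset[OF continuous_on_grad[OF U'(3)] r1(2)] by (intro continuous_intros)
  qed auto
  have main: "norm (x - y) \<le> (1 + P / c) * (\<Sum>b\<in>Basis - {e}. \<bar>(x - y) \<bullet> b\<bar>)"
    if x: "x \<in> frontier \<Omega> \<inter> ball z r" and y: "y \<in> frontier \<Omega> \<inter> ball z r" for x y
  proof -
    define v where "v = x - y"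
    define s where "s = (\<Sum>b\<in>Basis - {e}. \<bar>v \<bullet> b\<bar>)"
    have zero: "\<phi> x = 0" "\<phi> y = 0"
      using frontier_local_defining_function[OF \<Omega>(1) U] x y r(2) by auto
    have seg: "y + t *\<^sub>R v \<in> ball z r" if "0 \<le> t" "t \<le> 1" for t
    proof -
      have "y + t *\<^sub>R v = (1 - t) *\<^sub>R y + t *\<^sub>R x" by (simp add: v_def algebra_simps)
      then show ?thesis using convexD_alt[OF convex_ball[of z r], of y x t] x y that by simp
    qed
    \<comment> \<open>\<open>\<phi>\<close> vanishes at both ends of the segment, so its derivative
      along \<open>v\<close> vanishes in between. In coordinates this is a linear relation that
      bounds \<open>v \<bullet> e\<close> by \<open>P / c\<close> times the sum of the other
      components.\<close>
    have "\<exists>t. 0 < t \<and> t < 1 \<and> \<phi> (y + 1 *\<^sub>R v) - \<phi> (y + 0 *\<^sub>R v) = (1 - 0) * partial v \<phi> (y + t *\<^sub>R v)"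
    proof (rule MVT2)
      fix t :: real assume "0 \<le> t" "t \<le> 1"
      then have "y + t *\<^sub>R v \<in> U" using seg r(2) by blast
      then show "((\<lambda>t. \<phi> (y + t *\<^sub>R v)) has_real_derivative partial v \<phi> (y + t *\<^sub>R v)) (at t)"
        by (intro has_real_derivative_line smooth_on_differentiable(1)[OF U'(3)])
    qed simp
    then obtain t where t: "0 < t" "t < 1" "partial v \<phi> (y + t *\<^sub>R v) = 0"
      using zero by (auto simp: v_def)
    define \<xi> where "\<xi> = y + t *\<^sub>R v"
    have \<xi>: "\<xi> \<in> ball z r" "\<xi> \<in> U" "\<xi> \<in> cball z r1" using seg[of t] t r by (auto simp: \<xi>_def)
    have "0 = grad \<phi> \<xi> \<bullet> v"
      using t(3) grad_inner[OF smooth_on_differentiable(1)[OF U'(3) \<xi>(2)], of v]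
      by (simp add: partial_def \<xi>_def)
    also have "\<dots> = (\<Sum>b\<in>Basis. partial b \<phi> \<xi> * (v \<bullet> b))"
      by (subst euclidean_inner) simp
    also have "\<dots> = partial e \<phi> \<xi> * (v \<bullet> e) + (\<Sum>b\<in>Basis - {e}. partial b \<phi> \<xi> * (v \<bullet> b))"
      using e(1) by (intro sum.remove) auto
    finally have "\<bar>partial e \<phi> \<xi>\<bar> * \<bar>v \<bullet> e\<bar> = \<bar>\<Sum>b\<in>Basis - {e}. partial b \<phi> \<xi> * (v \<bullet> b)\<bar>"
      by (simp flip: abs_mult)
    also have "\<dots> \<le> (\<Sum>b\<in>Basis - {e}. \<bar>partial b \<phi> \<xi> * (v \<bullet> b)\<bar>)" by (rule sum_abs)
    also have "\<dots> \<le> (\<Sum>b\<in>Basis - {e}. P * \<bar>v \<bullet> b\<bar>)"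
    proof (intro sum_mono)
      fix b :: 'a assume b: "b \<in> Basis - {e}"
      then have "\<bar>grad \<phi> \<xi> \<bullet> b\<bar> \<le> norm (grad \<phi> \<xi>)" by (intro Basis_le_norm) auto
      then have "\<bar>partial b \<phi> \<xi>\<bar> \<le> P" using P(2)[OF \<xi>(3)] b by simp
      then show "\<bar>partial b \<phi> \<xi> * (v \<bullet> b)\<bar> \<le> P * \<bar>v \<bullet> b\<bar>"
        unfolding abs_mult by (intro mult_right_mono) auto
    qed
    also have "\<dots> = P * s" by (simp add: s_def sum_distrib_left)
    finally have "\<bar>partial e \<phi> \<xi>\<bar> * \<bar>v \<bullet> e\<bar> \<le> P * s" .
    moreover have "c * \<bar>v \<bullet> e\<bar> \<le> \<bar>partial e \<phi> \<xi>\<bar> * \<bar>v \<bullet> e\<bar>"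
      using lower[OF \<xi>(1)] by (intro mult_right_mono) auto
    ultimately have "\<bar>v \<bullet> e\<bar> \<le> P / c * s" using c by (simp add: field_simps)
    moreover have "norm v \<le> \<bar>v \<bullet> e\<bar> + s"
      using norm_le_l1[of v] e(1) unfolding s_def by (subst (asm) sum.remove[of _ e]) auto
    ultimately show ?thesis unfolding v_def[symmetric] s_def[symmetric] by (simp add: algebra_simps)
  qed
  have "hausdorff_outer (DIM('a) - 1) (frontier \<Omega> \<inter> ball z r) < top"
  proof (rule hausdorff_outer_finite_grid[OF N e(1) r(1) _ _ main])
    show "1 + P / c > 0" using P(1) c by (simp add: add_pos_nonneg)
    fix x b assume "x \<in> frontier \<Omega> \<inter> ball z r" "b \<in> Basis - {e}"
    then show "\<bar>(x - z) \<bullet> b\<bar> < r"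
      using Basis_le_norm[of b "x - z"] by (auto simp: dist_norm norm_minus_commute)
  qed
  then show ?thesis using r(1) by blast
qed

lemma hausdorff_outer_frontier_finite:
  fixes \<Omega> :: "'a::euclidean_space set"
  assumes N: "DIM('a) \<ge> 2" and \<Omega>: "open \<Omega>" "bounded \<Omega>" "smooth_boundary \<Omega>"
  shows "hausdorff_outer (DIM('a) - 1) (frontier \<Omega>) < top"
proof -
  define d where "d = DIM('a) - 1"
  have d: "d > 0" using N by (simp add: d_def)
  obtain r where r: "\<And>z. z \<in> frontier \<Omega> \<Longrightarrow> r z > 0 \<and> hausdorff_outer d (frontier \<Omega> \<inter> ball z (r z)) < top"
    using hausdorff_outer_frontier_local[OF N \<Omega>(1,3)] unfolding d_def by metis
  have "compact (frontier \<Omega>)" using \<Omega>(2) by (rule compact_frontier_bounded)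
  then obtain F where F: "F \<subseteq> frontier \<Omega>" "finite F" "frontier \<Omega> \<subseteq> (\<Union>z\<in>F. ball z (r z))"
    by (rule compactE_image[of _ "frontier \<Omega>" "\<lambda>z. ball z (r z)"]) (use r in force)+
  have "hausdorff_outer d (\<Union>z\<in>F. frontier \<Omega> \<inter> ball z (r z)) < top"
    using F(2,1)
  proof (induction F rule: finite_induct)
    case (insert z F)
    have "hausdorff_outer d (\<Union>z\<in>insert z F. frontier \<Omega> \<inter> ball z (r z)) \<le>
        hausdorff_outer d (frontier \<Omega> \<inter> ball z (r z)) + hausdorff_outer d (\<Union>z\<in>F. frontier \<Omega> \<inter> ball z (r z))"
      using hausdorff_outer_subadditive[OF d] by simp
    also have "\<dots> < top" using insert r by simp
    finally show ?case .
  qed (simp add: hausdorff_outer_empty[OF d])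
  moreover have "frontier \<Omega> \<subseteq> (\<Union>z\<in>F. frontier \<Omega> \<inter> ball z (r z))" using F(3) by blast
  ultimately show ?thesis
    using hausdorff_outer_mono[of "frontier \<Omega>"] unfolding d_def by (meson le_less_trans)
qed

text \<open>Every line in a coordinate direction through a point of \<open>\<Omega>\<close> meets the boundary, so the cylinders
  over the members of a cover of the boundary cover \<open>\<Omega>\<close>; compare volumes.\<close>

lemma hausdorff_outer_frontier_pos:
  fixes \<Omega> :: "'a::euclidean_space set"
  assumes N: "DIM('a) \<ge> 2" and \<Omega>: "open \<Omega>" "bounded \<Omega>" "\<Omega> \<noteq> {}"
  shows "hausdorff_outer (DIM('a) - 1) (frontier \<Omega>) > 0"
proof (rule ccontr)
  define d where "d = DIM('a) - 1"
  have d: "d > 0" using N by (simp add: d_def)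
  assume "\<not> ?thesis"
  then have H0: "hausdorff_outer d (frontier \<Omega>) = 0" by (simp add: d_def)
  obtain R where R: "R > 0" "\<And>x. x \<in> \<Omega> \<Longrightarrow> norm x \<le> R" using \<Omega>(2) bounded_pos by metis
  obtain e :: 'a where e: "e \<in> Basis" using nonempty_Basis by blast
  have cardB: "card (Basis - {e} :: 'a set) = d" using e by (simp add: d_def)
  define \<omega> where "\<omega> = unit_ball_vol (real d)"
  have \<omega>: "\<omega> > 0" by (simp add: \<omega>_def)
  \<comment> \<open>Volume of a cylinder of height \<open>2 * R\<close> over a
    \<open>d\<close>-dimensional cube of side \<open>2 * D\<close>, divided by the weight of a set
    of diameter \<open>D\<close>.\<close>
  define k where "k = 2 * R * 4 ^ d / \<omega>"
  have k: "k > 0" using R(1) \<omega> by (simp add: k_def)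
  have vol: "0 < measure lborel \<Omega>" "emeasure lborel \<Omega> = ennreal (measure lborel \<Omega>)"
  proof -
    have "emeasure lborel \<Omega> < top" using emeasure_bounded_finite[OF \<Omega>(2)] by simp
    then show 1: "emeasure lborel \<Omega> = ennreal (measure lborel \<Omega>)" by (simp add: emeasure_eq_ennreal_measure)
    obtain x where "x \<in> \<Omega>" using \<Omega>(3) by blast
    then obtain a b where ab: "cbox a b \<subseteq> \<Omega>" "\<forall>i\<in>Basis. a \<bullet> i < b \<bullet> i"
      using open_contains_cbox[OF \<Omega>(1)] by metis
    have "0 < (\<Prod>i\<in>Basis. (b - a) \<bullet> i)" using ab(2) by (intro prod_pos) (simp add: inner_diff_left)
    then have "0 < emeasure lborel (cbox a b)"
      using ab(2) by (subst emeasure_lborel_cbox_eq) (auto simp: less_imp_le)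
    also have "\<dots> \<le> emeasure lborel \<Omega>" using ab(1) \<Omega>(1) by (intro emeasure_mono) auto
    finally have "0 < emeasure lborel \<Omega>" .
    then show "0 < measure lborel \<Omega>" using 1 by simp
  qed
  \<comment> \<open>A cover of total weight below \<open>a\<close> has cylinders of total volume at
    most half that of \<open>\<Omega>\<close>. The scale 1 used next is arbitrary.\<close>
  define a where "a = measure lborel \<Omega> / (2 * k)"
  have "hausdorff_pre d 1 (frontier \<Omega>) \<le> 0"
    using hausdorff_pre_le_outer[of 1 d "frontier \<Omega>"] H0 by simp
  also have "\<dots> < ennreal a" using vol(1) k by (simp add: a_def)
  finally have "hausdorff_pre d 1 (frontier \<Omega>) < ennreal a" .
  then obtain C where C: "frontier \<Omega> \<subseteq> (\<Union>i. C i)" "\<And>i. bounded (C i)"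
    "(\<Sum>i. hausdorff_weight d (C i)) < ennreal a"
    using hausdorff_pre_lessE by metis
  \<comment> \<open>For an empty \<open>C i\<close> this is an arbitrary point, and its cylinder has
    volume 0.\<close>
  define p where "p i = (SOME x. x \<in> C i)" for i
  define lo where "lo i = (\<Sum>b\<in>Basis. (if b = e then - R else p i \<bullet> b - diameter (C i)) *\<^sub>R b)" for i
  define hi where "hi i = (\<Sum>b\<in>Basis. (if b = e then R else p i \<bullet> b + diameter (C i)) *\<^sub>R b)" for i
  have lohi: "b \<in> Basis \<Longrightarrow> lo i \<bullet> b = (if b = e then - R else p i \<bullet> b - diameter (C i))"
    "b \<in> Basis \<Longrightarrow> hi i \<bullet> b = (if b = e then R else p i \<bullet> b + diameter (C i))" for i b
    by (simp_all add: lo_def hi_def)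
  have cov: "\<Omega> \<subseteq> (\<Union>i. cbox (lo i) (hi i))"
  proof
    fix x assume x: "x \<in> \<Omega>"
    obtain t where t: "x + t *\<^sub>R e \<in> frontier \<Omega>"
      using ray_to_frontier[of \<Omega> x e] \<Omega> x e nonzero_Basis by (metis interior_open)
    then obtain i where i: "x + t *\<^sub>R e \<in> C i" using C(1) by blast
    then have p: "p i \<in> C i" unfolding p_def by (rule someI)
    have "lo i \<bullet> b \<le> x \<bullet> b \<and> x \<bullet> b \<le> hi i \<bullet> b" if b: "b \<in> Basis" for b
    proof (cases "b = e")
      case True
      have "\<bar>x \<bullet> e\<bar> \<le> R" using Basis_le_norm[OF e, of x] R(2)[OF x] by linarith
      then show ?thesis using True b by (simp add: lohi abs_le_iff)
    next
      case False
      have "\<bar>(x + t *\<^sub>R e - p i) \<bullet> b\<bar> \<le> diameter (C i)"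
        using Basis_le_norm[OF b, of "x + t *\<^sub>R e - p i"] diameter_bounded_bound[OF C(2) i p] by (simp add: dist_norm)
      moreover have "(x + t *\<^sub>R e - p i) \<bullet> b = x \<bullet> b - p i \<bullet> b"
        using False b e by (simp add: inner_add_left inner_diff_left inner_not_same_Basis)
      ultimately show ?thesis using False b by (simp add: lohi abs_le_iff)
    qed
    then have "x \<in> cbox (lo i) (hi i)" by (simp add: mem_box)
    then show "x \<in> (\<Union>i. cbox (lo i) (hi i))" by blast
  qed
  have box: "emeasure lborel (cbox (lo i) (hi i)) = ennreal k * hausdorff_weight d (C i)" for i
  proof -
    define D where "D = diameter (C i)"
    have D: "D \<ge> 0" unfolding D_def by (rule diameter_ge_0[OF C(2)])
    have "emeasure lborel (cbox (lo i) (hi i)) = ennreal (\<Prod>b\<in>Basis. (hi i - lo i) \<bullet> b)"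
      using R(1) D by (subst emeasure_lborel_cbox_eq) (auto simp: lohi D_def)
    also have "(\<Prod>b\<in>Basis. (hi i - lo i) \<bullet> b) = (\<Prod>b\<in>Basis. if b = e then 2 * R else 2 * D)"
      by (intro prod.cong refl) (simp add: lohi inner_diff_left D_def)
    also have "\<dots> = 2 * R * (\<Prod>b\<in>Basis - {e}. if b = e then 2 * R else 2 * D)"
      using e by (subst prod.remove[of _ e]) auto
    also have "(\<Prod>b\<in>Basis - {e}. if b = e then 2 * R else 2 * D) = (\<Prod>b\<in>(Basis - {e} :: 'a set). 2 * D)"
      by (intro prod.cong) auto
    also have "\<dots> = (2 * D) ^ d" by (simp only: prod_constant cardB)
    also have "2 * R * (2 * D) ^ d = k * (\<omega> * (D / 2) ^ d)"
    proof -
      have "(2 * D) ^ d = 4 ^ d * (D / 2) ^ d" unfolding power_mult_distrib[symmetric] by simp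
      then show ?thesis using \<omega> by (simp add: k_def)
    qed
    finally show ?thesis
      using k D \<omega> by (simp add: hausdorff_weight_def \<omega>_def D_def flip: ennreal_mult)
  qed
  have "emeasure lborel \<Omega> \<le> emeasure lborel (\<Union>i. cbox (lo i) (hi i))"
    using cov by (intro emeasure_mono) auto
  also have "\<dots> \<le> (\<Sum>i. emeasure lborel (cbox (lo i) (hi i)))"
    by (rule emeasure_subadditive_countably) auto
  also have "\<dots> = ennreal k * (\<Sum>i. hausdorff_weight d (C i))"
    unfolding box by simp
  also have "\<dots> \<le> ennreal k * ennreal a"
    using C(3) by (intro mult_left_mono) auto
  also have "\<dots> = ennreal (measure lborel \<Omega> / 2)"
    using k vol(1) by (simp add: a_def flip: ennreal_mult)
  finally show False using vol by (simp add: ennreal_le_iff)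
qed

text \<open>Finiteness of the boundary measure matters as much as positivity, since it makes
  \<open>g\<close> integrable; then the integral is at least the minimum of \<open>g\<close> times
  the measure of the boundary.\<close>

lemma surface_integral_pos:
  fixes \<Omega> :: "'a::euclidean_space set"
  assumes N: "DIM('a) \<ge> 2" and \<Omega>: "open \<Omega>" "bounded \<Omega>" "\<Omega> \<noteq> {}" "smooth_boundary \<Omega>"
    and g: "continuous_on (frontier \<Omega>) g" "\<And>x. x \<in> frontier \<Omega> \<Longrightarrow> g x > 0"
  shows "surface_integral \<Omega> g > 0"
proof -
  define d where "d = DIM('a) - 1"
  have d: "d > 0" using N by (simp add: d_def)
  define M where "M = (hausdorff_measure d :: 'a measure)"
  have sM: "sets M = sets borel" by (simp add: M_def)
  have F: "compact (frontier \<Omega>)" using \<Omega>(2) by (rule compact_frontier_bounded)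
  then have FM: "frontier \<Omega> \<in> sets M" unfolding sM by (simp add: borel_compact)
  have em: "emeasure M (frontier \<Omega>) = hausdorff_outer d (frontier \<Omega>)"
    unfolding M_def by (rule emeasure_hausdorff_measure[OF d]) (use FM sM in simp)
  have fin: "emeasure M (frontier \<Omega>) < top" and pos: "emeasure M (frontier \<Omega>) > 0"
    unfolding em d_def using hausdorff_outer_frontier_finite[OF N \<Omega>(1,2,4)]
      hausdorff_outer_frontier_pos[OF N \<Omega>(1-3)] by auto
  have mpos: "measure M (frontier \<Omega>) > 0" using fin pos by (simp add: measure_def enn2real_positive_iff)
  have ne: "frontier \<Omega> \<noteq> {}" using pos by auto
  obtain y where y: "y \<in> frontier \<Omega>" "\<And>x. x \<in> frontier \<Omega> \<Longrightarrow> g y \<le> g x"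
    using continuous_attains_inf[OF F ne g(1)] by blast
  obtain C where C: "C \<ge> 1" "\<And>x. x \<in> frontier \<Omega> \<Longrightarrow> \<bar>g x\<bar> \<le> C"
    using compact_continuous_bound[OF F g(1)] by blast
  have ind: "integrable M (\<lambda>x. indicator (frontier \<Omega>) x *\<^sub>R c)" for c :: real
    using FM fin by (intro integrable_scaleR_left) (auto simp: integrable_indicator_iff)
  have meas: "(\<lambda>x. indicator (frontier \<Omega>) x *\<^sub>R g x) \<in> borel_measurable M"
    using borel_measurable_continuous_on_indicator[OF _ g(1)] F sM
    by (simp add: borel_compact cong: measurable_cong_sets)
  have int: "integrable M (\<lambda>x. indicator (frontier \<Omega>) x *\<^sub>R g x)"
    by (rule Bochner_Integration.integrable_bound[OF ind[of C] meas])
      (use C in \<open>auto simp: indicator_def\<close>)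
  have "0 < measure M (frontier \<Omega>) * g y" using mpos g(2)[OF y(1)] by simp
  also have "\<dots> = (LINT x|M. indicator (frontier \<Omega>) x *\<^sub>R g y)"
    using FM fin by simp
  also have "\<dots> \<le> (LINT x|M. indicator (frontier \<Omega>) x *\<^sub>R g x)"
    by (rule integral_mono[OF ind int]) (use y(2) in \<open>auto simp: indicator_def\<close>)
  finally show ?thesis
    unfolding surface_integral_def set_lebesgue_integral_def M_def d_def .
qed

subsection \<open>Solutions of the Neumann problem\<close>

lemma integrable_on_bounded_open:
  fixes f :: "'a::euclidean_space \<Rightarrow> real"
  assumes \<Omega>: "open \<Omega>" "bounded \<Omega>" and f: "continuous_on (closure \<Omega>) f"
  shows "f integrable_on \<Omega>"
proof -
  have "compact (closure \<Omega>)" using \<Omega>(2) by simp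
  then obtain C where C: "\<And>x. x \<in> closure \<Omega> \<Longrightarrow> \<bar>f x\<bar> \<le> C"
    using compact_continuous_bound[OF _ f] by blast
  have sets: "\<Omega> \<in> sets lebesgue" using \<Omega>(1) by simp
  show ?thesis
  proof (rule measurable_bounded_by_integrable_imp_integrable[OF _ _ _ sets])
    show "f \<in> borel_measurable (lebesgue_on \<Omega>)"
      by (rule continuous_imp_measurable_on_sets_lebesgue[OF continuous_on_subset[OF f closure_subset] sets])
    show "(\<lambda>_. C) integrable_on \<Omega>" by (rule integrable_on_const[OF lmeasurable_open[OF \<Omega>(2,1)]])
  qed (use C closure_subset in force)
qed

lemma integral_const_lmeasurable:
  fixes c :: real
  assumes "S \<in> lmeasurable"
  shows "integral S (\<lambda>_. c) = c * measure lebesgue S"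
  using lmeasure_integral[OF assms] integral_mult_right[of S c "\<lambda>_. 1"] by simp

lemma measure_lebesgue_open_pos:
  fixes S :: "'a::euclidean_space set"
  assumes "open S" "bounded S" "S \<noteq> {}"
  shows "measure lebesgue S > 0"
  using open_not_negligible[OF assms(1,3)] negligible_iff_measure0[OF lmeasurable_open[OF assms(2,1)]]
  by (simp add: zero_less_measure_iff)

text \<open>Unlike the statement of the theorem, this formulation has the boundary constant as a parameter
  and only second-order regularity, which makes it stable under \<open>u \<mapsto> -u\<close>.\<close>

definition neumann_solution :: "'a::euclidean_space set \<Rightarrow> ('a \<Rightarrow> real) \<Rightarrow> real \<Rightarrow> real \<Rightarrow> real \<Rightarrow> real
     \<Rightarrow> real \<Rightarrow> real \<Rightarrow> ('a \<Rightarrow> real) \<Rightarrow> bool" where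
  "neumann_solution \<Omega> g A B p q \<kappa> \<epsilon> u \<longleftrightarrow>
     twice_diff_on \<Omega> u \<and> continuous_on (closure \<Omega>) u \<and>
     (\<forall>x\<in>\<Omega>. \<epsilon>\<^sup>2 * elliptic_op g u x =
        A * exp (p * u x) / ((1 / measure lebesgue \<Omega>) * integral \<Omega> (\<lambda>y. exp (p * u y)))
      - B * exp (- q * u x) / ((1 / measure lebesgue \<Omega>) * integral \<Omega> (\<lambda>y. exp (- q * u y)))) \<and>
     (\<exists>Du. continuous_on (closure \<Omega>) Du \<and> (\<forall>x\<in>\<Omega>. Du x = grad u x) \<and>
        (\<forall>z\<in>frontier \<Omega>. \<epsilon>\<^sup>2 * (Du z \<bullet> outward_normal \<Omega> z) = \<kappa>)) \<and>
     integral \<Omega> u = 0"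

lemma solves_N_imp_neumann_solution:
  assumes "solves_N \<Omega> g A B p q \<epsilon> u" "\<And>x. x \<in> \<Omega> \<Longrightarrow> g differentiable (at x)"
  shows "neumann_solution \<Omega> g A B p q (boundary_const \<Omega> g A B) \<epsilon> u"
proof -
  have u: "twice_diff_on \<Omega> u"
    using assms(1) smooth_on_imp_twice_diff_on unfolding solves_N_def by blast
  then have "div_field (\<lambda>y. g y *\<^sub>R grad u y) x = elliptic_op g u x" if "x \<in> \<Omega>" for x
    using div_field_eq_elliptic_op assms(2) that by blast
  then show ?thesis
    using assms(1) u unfolding solves_N_def neumann_solution_def by auto
qed

lemma neumann_solution_uminus:
  assumes "open \<Omega>" "neumann_solution \<Omega> g A B p q \<kappa> \<epsilon> u"
  shows "neumann_solution \<Omega> g B A q p (- \<kappa>) \<epsilon> (\<lambda>x. - u x)"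
proof -
  obtain Du where u: "twice_diff_on \<Omega> u" "continuous_on (closure \<Omega>) u" "integral \<Omega> u = 0"
    "\<And>x. x \<in> \<Omega> \<Longrightarrow> \<epsilon>\<^sup>2 * elliptic_op g u x =
        A * exp (p * u x) / ((1 / measure lebesgue \<Omega>) * integral \<Omega> (\<lambda>y. exp (p * u y)))
      - B * exp (- q * u x) / ((1 / measure lebesgue \<Omega>) * integral \<Omega> (\<lambda>y. exp (- q * u y)))"
    and Du: "continuous_on (closure \<Omega>) Du" "\<And>x. x \<in> \<Omega> \<Longrightarrow> Du x = grad u x"
    "\<And>z. z \<in> frontier \<Omega> \<Longrightarrow> \<epsilon>\<^sup>2 * (Du z \<bullet> outward_normal \<Omega> z) = \<kappa>"
    using assms(2) unfolding neumann_solution_def by blast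
  note m = twice_diff_on_const_minus[OF assms(1) u(1), where c = 0, simplified]
  show ?thesis
    unfolding neumann_solution_def
  proof (intro conjI ballI exI)
    show "twice_diff_on \<Omega> (\<lambda>x. - u x)" by (rule m)
    show "continuous_on (closure \<Omega>) (\<lambda>x. - u x)" by (intro continuous_intros u)
    show "integral \<Omega> (\<lambda>x. - u x) = 0" using u(3) by simp
    show "continuous_on (closure \<Omega>) (\<lambda>x. - Du x)" by (intro continuous_intros Du)
    fix x assume x: "x \<in> \<Omega>"
    show "- Du x = grad (\<lambda>x. - u x) x" using m(3)[OF x] Du(2)[OF x] by simp
    show "\<epsilon>\<^sup>2 * elliptic_op g (\<lambda>x. - u x) x =
        B * exp (q * - u x) / ((1 / measure lebesgue \<Omega>) * integral \<Omega> (\<lambda>y. exp (q * - u y)))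
      - A * exp (- p * - u x) / ((1 / measure lebesgue \<Omega>) * integral \<Omega> (\<lambda>y. exp (- p * - u y)))"
      using m(2)[OF x] u(4)[OF x] by simp
  next
    fix z assume "z \<in> frontier \<Omega>"
    then show "\<epsilon>\<^sup>2 * (- Du z \<bullet> outward_normal \<Omega> z) = - \<kappa>" using Du(3) by simp
  qed
qed

text \<open>Otherwise \<open>u\<close> is nonpositive with integral 0. Its integral over a box
  around a point of \<open>\<Omega>\<close> is then 0 too, so by continuity \<open>u\<close>
  vanishes on \<open>\<Omega>\<close> and on its closure.\<close>

lemma integral_zero_attains_positive:
  fixes u :: "'a::euclidean_space \<Rightarrow> real"
  assumes \<Omega>: "open \<Omega>" "bounded \<Omega>" and u: "continuous_on (closure \<Omega>) u" "integral \<Omega> u = 0"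
    and x: "x \<in> closure \<Omega>" "u x \<noteq> 0"
  shows "\<exists>y\<in>\<Omega>. u y > 0"
proof (rule ccontr)
  assume "\<not> ?thesis"
  then have neg: "u y \<le> 0" if "y \<in> \<Omega>" for y using that by force
  have "\<not> (\<forall>y\<in>\<Omega>. u y = 0)"
    using continuous_constant_on_closure[OF u(1) _ x(1), of 0] x(2) by blast
  then obtain y where y: "y \<in> \<Omega>" "u y \<noteq> 0" by blast
  obtain a b where ab: "cbox a b \<subseteq> \<Omega>" "y \<in> box a b" using open_contains_cbox[OF \<Omega>(1) y(1)] by metis
  have cont: "continuous_on (cbox a b) (\<lambda>x. - u x)"
    using ab(1) closure_subset by (intro continuous_intros continuous_on_subset[OF u(1)]) blast
  have "integral (cbox a b) (\<lambda>x. - u x) \<le> integral \<Omega> (\<lambda>x. - u x)"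
    by (rule integral_subset_le[OF ab(1) integrable_continuous[OF cont]])
      (use neg integrable_neg[OF integrable_on_bounded_open[OF \<Omega> u(1)]] in auto)
  moreover have "integral (cbox a b) (\<lambda>x. - u x) \<ge> 0"
    by (rule integral_nonneg[OF integrable_continuous[OF cont]]) (use neg ab in force)
  ultimately have "integral (cbox a b) (\<lambda>x. - u x) = 0" using u(2) by simp
  then have "\<forall>x\<in>cbox a b. - u x = 0"
    by (subst (asm) integral_cbox_eq_0_iff[OF cont]) (use neg ab in force)+
  then show False using y(2) ab(2) box_subset_cbox by fastforce
qed

text \<open>Collects all that later estimates take from the equation. The last two bounds no longer
  contain the nonlocal means: the upper one feeds \<open>interior_decay\<close> and the lower one
  \<open>boundary_layer\<close>.\<close>

lemma neumann_solution_extrema: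
  fixes \<Omega> :: "'a::euclidean_space set"
  assumes \<Omega>: "open \<Omega>" "bounded \<Omega>" "\<Omega> \<noteq> {}" "smooth_boundary \<Omega>"
    and g: "\<And>x. x \<in> \<Omega> \<Longrightarrow> g x > 0"
    and par: "A > 0" "B > 0" "p > 0" "q > 0" "\<epsilon> > 0" "\<kappa> < 0"
    and u: "neumann_solution \<Omega> g A B p q \<kappa> \<epsilon> u"
  shows "\<exists>xM\<in>\<Omega>. \<exists>xm\<in>frontier \<Omega>.
    (\<forall>y\<in>closure \<Omega>. u xm \<le> u y \<and> u y \<le> u xM) \<and>
    0 < u xM \<and> u xM \<le> ln (B / A) / q \<and> u xm < u xM \<and>
    (\<forall>x\<in>\<Omega>. \<epsilon>\<^sup>2 * elliptic_op g u x \<le> - (q * A * (u xM - u x))) \<and>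
    (\<forall>x\<in>\<Omega>. - (B * exp (- q * u xm)) \<le> \<epsilon>\<^sup>2 * elliptic_op g u x)"
proof -
  define a where "a = (1 / measure lebesgue \<Omega>) * integral \<Omega> (\<lambda>y. exp (p * u y))"
  define b where "b = (1 / measure lebesgue \<Omega>) * integral \<Omega> (\<lambda>y. exp (- q * u y))"
  obtain Du where u2: "twice_diff_on \<Omega> u" "continuous_on (closure \<Omega>) u" "integral \<Omega> u = 0"
    and eq: "\<And>x. x \<in> \<Omega> \<Longrightarrow> \<epsilon>\<^sup>2 * elliptic_op g u x = A * exp (p * u x) / a - B * exp (- q * u x) / b"
    and Du: "continuous_on (closure \<Omega>) Du" "\<And>x. x \<in> \<Omega> \<Longrightarrow> Du x = grad u x"
    "\<And>z. z \<in> frontier \<Omega> \<Longrightarrow> \<epsilon>\<^sup>2 * (Du z \<bullet> outward_normal \<Omega> z) = \<kappa>"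
    using u unfolding neumann_solution_def a_def b_def by blast
  have comp: "compact (closure \<Omega>)" "closure \<Omega> \<noteq> {}" using \<Omega> closure_subset by auto
  have clos: "x \<in> \<Omega> \<or> x \<in> frontier \<Omega>" if "x \<in> closure \<Omega>" for x
    using that \<Omega>(1) by (auto simp: frontier_def interior_open)
  have frontier_closure: "frontier \<Omega> \<subseteq> closure \<Omega>" by (auto simp: frontier_def)
  have inward: "\<exists>x\<in>\<Omega>. u z < u x" if z: "z \<in> frontier \<Omega>" for z
  proof -
    have "\<exists>x\<in>\<Omega> \<inter> ball z 1. u z < u x"
    proof (rule increasing_inward[OF \<Omega>(1,4) z, of 1 u Du])
      show "continuous_on (closure \<Omega> \<inter> ball z 1) u" "continuous_on (closure \<Omega> \<inter> ball z 1) Du"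
        using u2(2) Du(1) by (auto intro: continuous_on_subset)
      have "\<epsilon>\<^sup>2 * (Du z \<bullet> outward_normal \<Omega> z) < 0" using Du(3)[OF z] par by simp
      then show "Du z \<bullet> outward_normal \<Omega> z < 0" using par by (simp add: mult_less_0_iff)
      fix x assume x: "x \<in> \<Omega>"
      then show "(u has_derivative (\<bullet>) (Du x)) (at x)"
        using u2(1) has_derivative_grad[of u x] Du(2)[OF x] unfolding twice_diff_on_def by auto
    qed simp
    then show ?thesis by blast
  qed
  obtain xM where xM: "xM \<in> closure \<Omega>" "\<And>y. y \<in> closure \<Omega> \<Longrightarrow> u y \<le> u xM"
    using continuous_attains_sup[OF comp u2(2)] by blast
  have xM\<Omega>: "xM \<in> \<Omega>"
    using clos[OF xM(1)] inward[of xM] xM(2) closure_subset by (meson not_less subsetD)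
  obtain xm where xm: "xm \<in> closure \<Omega>" "\<And>y. y \<in> closure \<Omega> \<Longrightarrow> u xm \<le> u y"
    using continuous_attains_inf[OF comp u2(2)] by blast
  have "frontier \<Omega> \<noteq> {}"
    using \<Omega> not_bounded_UNIV frontier_eq_empty by metis
  then obtain z where z: "z \<in> frontier \<Omega>" by blast
  have mM: "u xm < u xM"
    using inward[OF z] xm(2)[of z] xM(2) z frontier_closure closure_subset by force
  have Mpos: "0 < u xM"
  proof -
    have "u xm \<noteq> 0 \<or> u xM \<noteq> 0" using mM by linarith
    then obtain y where "y \<in> \<Omega>" "u y > 0"
      using integral_zero_attains_positive[OF \<Omega>(1,2) u2(2,3)] xm(1) xM(1) by blast
    then show ?thesis using xM(2)[of y] closure_subset by force
  qed
  have lm: "\<Omega> \<in> lmeasurable" using \<Omega> by (intro lmeasurable_open)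
  have vol: "measure lebesgue \<Omega> > 0" by (rule measure_lebesgue_open_pos[OF \<Omega>(1-3)])
  have int: "(\<lambda>y. exp (c * u y)) integrable_on \<Omega>" for c
    by (intro integrable_on_bounded_open[OF \<Omega>(1,2)] continuous_intros u2)
  have a_le: "a \<le> exp (p * u xM)"
  proof -
    have "integral \<Omega> (\<lambda>y. exp (p * u y)) \<le> integral \<Omega> (\<lambda>_. exp (p * u xM))"
      by (rule integral_le[OF int integrable_on_const[OF lm]])
        (use xM(2) closure_subset par in \<open>auto intro!: mult_left_mono\<close>)
    then show ?thesis using vol unfolding a_def integral_const_lmeasurable[OF lm] by (simp add: field_simps)
  qed
  have a_pos: "a > 0"
  proof -
    have "integral \<Omega> (\<lambda>_. exp (p * u xm)) \<le> integral \<Omega> (\<lambda>y. exp (p * u y))"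
      by (rule integral_le[OF integrable_on_const[OF lm] int])
        (use xm(2) closure_subset par in \<open>auto intro!: mult_left_mono\<close>)
    then have "integral \<Omega> (\<lambda>y. exp (p * u y)) > 0"
      using vol unfolding integral_const_lmeasurable[OF lm] by (smt (verit) exp_gt_zero mult_pos_pos)
    then show ?thesis using vol by (simp add: a_def)
  qed
  \<comment> \<open>Jensen's inequality in tangent form: \<open>exp t \<ge> 1 + t\<close>, and the
    linear term has integral 0.\<close>
  have b_ge: "b \<ge> 1"
  proof -
    have iu: "(\<lambda>y. - q * u y) integrable_on \<Omega>"
      by (intro integrable_on_bounded_open[OF \<Omega>(1,2)] continuous_intros u2)
    have "integral \<Omega> (\<lambda>y. 1 + - q * u y) \<le> integral \<Omega> (\<lambda>y. exp (- q * u y))"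
      by (rule integral_le[OF integrable_add[OF integrable_on_const[OF lm] iu] int]) (rule exp_ge_add_one_self)
    also have "integral \<Omega> (\<lambda>y. 1 + - q * u y) = integral \<Omega> (\<lambda>y. 1) + integral \<Omega> (\<lambda>y. - q * u y)"
      by (rule integral_add[OF integrable_on_const[OF lm] iu])
    also have "\<dots> = measure lebesgue \<Omega>"
      using u2(3) integral_const_lmeasurable[OF lm, of 1] integral_mult_right[of \<Omega> "- q" u] by simp
    finally show ?thesis using vol by (simp add: b_def)
  qed
  \<comment> \<open>The absorbing term of the equation at the maximum. There the operator is
    nonpositive, so \<open>\<beta>\<close> dominates the other term, which is at least
    \<open>A\<close> by \<open>a_le\<close>.\<close>
  define \<beta> where "\<beta> = B * exp (- q * u xM) / b"
  have max0: "A * exp (p * u xM) / a \<le> \<beta>"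
  proof -
    have "elliptic_op g u xM \<le> 0"
      by (rule elliptic_op_nonpos_at_local_max[OF \<Omega>(1) xM\<Omega> u2(1)])
        (use xM(2) closure_subset g[OF xM\<Omega>] in auto)
    then show ?thesis using eq[OF xM\<Omega>] par unfolding \<beta>_def by (smt (verit) mult_nonneg_nonpos zero_le_power2)
  qed
  have A\<beta>: "A \<le> \<beta>"
  proof -
    have "A * 1 \<le> A * (exp (p * u xM) / a)" using a_le a_pos par by (intro mult_left_mono) auto
    then show ?thesis using max0 by simp
  qed
  have upper: "u xM \<le> ln (B / A) / q"
  proof -
    have "A * b \<le> B * exp (- q * u xM)" using A\<beta> b_ge by (simp add: \<beta>_def field_simps)
    moreover have "A * 1 \<le> A * b" using b_ge par by (intro mult_left_mono) auto
    ultimately have "A \<le> B * exp (- q * u xM)" by simp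
    then have "A * exp (q * u xM) \<le> B * exp (- q * u xM) * exp (q * u xM)" by (intro mult_right_mono) auto
    then have "exp (q * u xM) \<le> B / A" using par by (simp add: field_simps flip: exp_add)
    then have "q * u xM \<le> ln (B / A)" using par by (simp add: ln_ge_iff)
    then show ?thesis using par by (simp add: field_simps)
  qed
  \<comment> \<open>Below the maximum the first term stays at most \<open>\<beta>\<close>, while the
    second grows to \<open>\<beta> * exp (q * (u xM - u x))\<close>; the tangent bound for the
    exponential and \<open>A \<le> \<beta>\<close> finish.\<close>
  have decay: "\<epsilon>\<^sup>2 * elliptic_op g u x \<le> - (q * A * (u xM - u x))" if x: "x \<in> \<Omega>" for x
  proof -
    have ux: "u x \<le> u xM" using x xM(2) closure_subset by blast
    have "A * exp (p * u x) / a \<le> A * exp (p * u xM) / a"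
      using ux par a_pos by (intro divide_right_mono mult_left_mono) auto
    also have "\<dots> \<le> \<beta>" by (rule max0)
    finally have 1: "A * exp (p * u x) / a \<le> \<beta>" .
    have "B * exp (- q * u x) / b = \<beta> * exp (q * (u xM - u x))"
      by (simp add: \<beta>_def algebra_simps flip: exp_add)
    moreover have "\<beta> * (1 + q * (u xM - u x)) \<le> \<beta> * exp (q * (u xM - u x))"
      using A\<beta> par by (intro mult_left_mono exp_ge_add_one_self) auto
    ultimately have "\<epsilon>\<^sup>2 * elliptic_op g u x \<le> - (\<beta> * (q * (u xM - u x)))"
      using eq[OF x] 1 by (simp add: algebra_simps)
    moreover have "A * (q * (u xM - u x)) \<le> \<beta> * (q * (u xM - u x))"
      using A\<beta> par ux by (intro mult_right_mono) auto
    ultimately show ?thesis by (simp add: algebra_simps)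
  qed
  \<comment> \<open>At an interior minimum the operator is nonnegative, but \<open>decay\<close>
    makes it negative because \<open>u xm < u xM\<close>.\<close>
  have "xm \<notin> \<Omega>"
  proof
    assume x: "xm \<in> \<Omega>"
    have "elliptic_op g (\<lambda>x. 0 - u x) xm \<le> 0"
      by (rule elliptic_op_nonpos_at_local_max[OF \<Omega>(1) x twice_diff_on_const_minus(1)[OF \<Omega>(1) u2(1)]])
        (use xm(2) closure_subset g[OF x] in auto)
    then have "elliptic_op g u xm \<ge> 0"
      using twice_diff_on_const_minus(2)[OF \<Omega>(1) u2(1) x, of g 0] by simp
    then have "\<epsilon>\<^sup>2 * elliptic_op g u xm \<ge> 0" by simp
    moreover have "q * A * (u xM - u xm) > 0" using mM par by simp
    ultimately show False using decay[OF x] by linarith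
  qed
  then have xmF: "xm \<in> frontier \<Omega>" using clos[OF xm(1)] by blast
  have lower: "- (B * exp (- q * u xm)) \<le> \<epsilon>\<^sup>2 * elliptic_op g u x" if x: "x \<in> \<Omega>" for x
  proof -
    have "B * exp (- q * u x) / b \<le> B * exp (- q * u x) / 1"
      using b_ge par by (intro divide_left_mono) auto
    also have "\<dots> \<le> B * exp (- q * u xm)"
      using xm(2)[of x] x closure_subset par by (auto intro!: mult_left_mono)
    finally have "B * exp (- q * u x) / b \<le> B * exp (- q * u xm)" .
    moreover have "A * exp (p * u x) / a \<ge> 0" using par a_pos by simp
    ultimately show ?thesis using eq[OF x] by linarith
  qed
  show ?thesis
    using xM\<Omega> xmF Mpos upper mM decay lower xm(2) xM(2) by blast
qed

lemma min_log_bound: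
  fixes \<Omega> :: "'a::euclidean_space set" and u :: "real \<Rightarrow> 'a \<Rightarrow> real"
  assumes \<Omega>: "open \<Omega>" "bounded \<Omega>" "\<Omega> \<noteq> {}" "smooth_boundary \<Omega>"
    and g: "closure \<Omega> \<subseteq> V" "smooth_on V g" "\<forall>x\<in>closure \<Omega>. g x > 0"
    and par: "A > 0" "B > 0" "p > 0" "q > 0" "\<kappa> < 0"
    and u: "\<And>\<epsilon>. \<epsilon> > 0 \<Longrightarrow> neumann_solution \<Omega> g A B p q \<kappa> \<epsilon> (u \<epsilon>)"
  obtains C where
    "eventually (\<lambda>\<epsilon>. \<exists>x\<in>frontier \<Omega>. u \<epsilon> x \<le> - ln (1 / \<epsilon>) / q + C) (at_right 0)"
proof -
  have "frontier \<Omega> \<noteq> {}"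
    using \<Omega> not_bounded_UNIV frontier_eq_empty by metis
  then obtain z where z: "z \<in> frontier \<Omega>" by blast
  obtain \<theta> \<rho>\<^sub>0 where \<theta>: "\<theta> > 0" "\<rho>\<^sub>0 > 0"
    "\<And>\<rho> s D u Du M. 0 < \<rho> \<Longrightarrow> \<rho> \<le> \<rho>\<^sub>0 \<Longrightarrow> 0 < s \<Longrightarrow> 0 \<le> D \<Longrightarrow> D * \<rho> \<le> \<theta> * s \<Longrightarrow>
      twice_diff_on \<Omega> u \<Longrightarrow> continuous_on (closure \<Omega>) u \<Longrightarrow> continuous_on (closure \<Omega>) Du \<Longrightarrow>
      (\<And>x. x \<in> \<Omega> \<Longrightarrow> Du x = grad u x) \<Longrightarrow>
      (\<And>z. z \<in> frontier \<Omega> \<Longrightarrow> Du z \<bullet> outward_normal \<Omega> z = - s) \<Longrightarrow>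
      (\<And>x. x \<in> \<Omega> \<Longrightarrow> - D \<le> elliptic_op g u x) \<Longrightarrow>
      (\<And>x. x \<in> closure \<Omega> \<Longrightarrow> u x \<le> M) \<Longrightarrow> u z \<le> M - \<theta> * s * \<rho>"
    by (rule boundary_layer[OF \<Omega>(1,4) g z]) blast
  \<comment> \<open>With \<open>s = - \<kappa> / \<epsilon>\<^sup>2\<close>,
    \<open>D = B / \<epsilon> ^ 3\<close> and \<open>\<rho> = c * \<epsilon>\<close>, this value
    gives equality in \<open>D * \<rho> \<le> \<theta> * s\<close>, and the drop
    \<open>\<theta> * s * \<rho>\<close> equals \<open>\<gamma> / \<epsilon>\<close>.\<close>
  define c where "c = \<theta> * (- \<kappa>) / B"
  define \<gamma> where "\<gamma> = \<theta> * (- \<kappa>) * c"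
  have t: "\<theta> * (- \<kappa>) > 0" using \<theta>(1) par by (intro mult_pos_pos) auto
  have "c > 0" unfolding c_def using t par(2) by (rule divide_pos_pos)
  moreover from this have "\<gamma> > 0" unfolding \<gamma>_def by (rule mult_pos_pos[OF t])
  ultimately have c: "c > 0" "\<gamma> > 0" by auto
  \<comment> \<open>The first part bounds the maximum of \<open>u\<close>; the second is the
    constant lost when \<open>\<gamma> / \<epsilon>\<close> is replaced by the logarithm.\<close>
  define C where "C = \<bar>ln (B / A)\<bar> / q + \<bar>1 + ln (\<gamma> * q)\<bar> / q"
  have C: "C \<ge> 0" using par by (simp add: C_def)
  have g': "\<And>x. x \<in> \<Omega> \<Longrightarrow> g x > 0" using g(3) closure_subset by blast
  have main: "\<exists>x\<in>frontier \<Omega>. u \<epsilon> x \<le> - ln (1 / \<epsilon>) / q + C" if \<epsilon>: "0 < \<epsilon>" "\<epsilon> < \<rho>\<^sub>0 / c" for \<epsilon>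
  proof -
    obtain xM xm where x: "xM \<in> \<Omega>" "xm \<in> frontier \<Omega>"
      "\<And>y. y \<in> closure \<Omega> \<Longrightarrow> u \<epsilon> xm \<le> u \<epsilon> y \<and> u \<epsilon> y \<le> u \<epsilon> xM"
      "0 < u \<epsilon> xM" "u \<epsilon> xM \<le> ln (B / A) / q" "u \<epsilon> xm < u \<epsilon> xM"
      "\<And>x. x \<in> \<Omega> \<Longrightarrow> \<epsilon>\<^sup>2 * elliptic_op g (u \<epsilon>) x \<le> - (q * A * (u \<epsilon> xM - u \<epsilon> x))"
      "\<And>x. x \<in> \<Omega> \<Longrightarrow> - (B * exp (- q * u \<epsilon> xm)) \<le> \<epsilon>\<^sup>2 * elliptic_op g (u \<epsilon>) x"
      using neumann_solution_extrema[OF \<Omega> g' par(1-4) \<epsilon>(1) par(5) u[OF \<epsilon>(1)]] by blast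
    show ?thesis
    proof (cases "exp (- q * u \<epsilon> xm) \<ge> 1 / \<epsilon>")
      case True
      then have "ln (1 / \<epsilon>) \<le> - q * u \<epsilon> xm" using \<epsilon>(1) by (metis exp_gt_zero ln_exp ln_le_cancel_iff zero_less_divide_1_iff)
      then have "u \<epsilon> xm \<le> - ln (1 / \<epsilon>) / q" using par by (simp add: field_simps)
      then show ?thesis using x(2) C by force
    next
      case False
      define s where "s = - \<kappa> / \<epsilon>\<^sup>2"
      define D where "D = B / \<epsilon> ^ 3"
      define \<rho> where "\<rho> = c * \<epsilon>"
      obtain Du where u2: "twice_diff_on \<Omega> (u \<epsilon>)" "continuous_on (closure \<Omega>) (u \<epsilon>)"
        and Du: "continuous_on (closure \<Omega>) Du" "\<And>x. x \<in> \<Omega> \<Longrightarrow> Du x = grad (u \<epsilon>) x"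
        "\<And>z. z \<in> frontier \<Omega> \<Longrightarrow> \<epsilon>\<^sup>2 * (Du z \<bullet> outward_normal \<Omega> z) = \<kappa>"
        using u[OF \<epsilon>(1)] unfolding neumann_solution_def by blast
      have "u \<epsilon> z \<le> u \<epsilon> xM - \<theta> * s * \<rho>"
      proof (rule \<theta>(3)[OF _ _ _ _ _ u2 Du(1,2)])
        show "0 < \<rho>" "\<rho> \<le> \<rho>\<^sub>0" using c \<epsilon> by (auto simp: \<rho>_def field_simps)
        show "0 < s" unfolding s_def using par \<epsilon> by (intro divide_pos_pos) auto
        show "0 \<le> D" using par \<epsilon> by (simp add: D_def)
        show "D * \<rho> \<le> \<theta> * s"
          using \<epsilon> par by (simp add: D_def s_def \<rho>_def c_def power3_eq_cube power2_eq_square)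
        show "Du z \<bullet> outward_normal \<Omega> z = - s" if "z \<in> frontier \<Omega>" for z
          using Du(3)[OF that] \<epsilon>(1) by (simp add: s_def field_simps)
        show "- D \<le> elliptic_op g (u \<epsilon>) y" if "y \<in> \<Omega>" for y
        proof -
          have "B * exp (- q * u \<epsilon> xm) \<le> B * (1 / \<epsilon>)" using False par by (intro mult_left_mono) auto
          then have "- (B / \<epsilon>) \<le> \<epsilon>\<^sup>2 * elliptic_op g (u \<epsilon>) y" using x(8)[OF that] by simp
          then have "- (B / \<epsilon>) / \<epsilon>\<^sup>2 \<le> elliptic_op g (u \<epsilon>) y"
            using \<epsilon>(1) by (subst pos_divide_le_eq) (simp_all add: mult.commute)
          then show ?thesis by (simp add: D_def power3_eq_cube power2_eq_square mult.assoc)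
        qed
        show "u \<epsilon> y \<le> u \<epsilon> xM" if "y \<in> closure \<Omega>" for y using x(3)[OF that] by blast
      qed
      also have "\<theta> * s * \<rho> = \<gamma> / \<epsilon>"
        using \<epsilon>(1) by (simp add: s_def \<rho>_def \<gamma>_def power2_eq_square)
      finally have "u \<epsilon> z \<le> ln (B / A) / q - \<gamma> / \<epsilon>" using x(5) by linarith
      \<comment> \<open>\<open>ln y \<le> y - 1\<close> at
        \<open>y = \<gamma> * q / \<epsilon>\<close>.\<close>
      moreover have "\<gamma> / \<epsilon> \<ge> (ln (1 / \<epsilon>) + (1 + ln (\<gamma> * q))) / q"
      proof -
        have "ln (\<gamma> * q * (1 / \<epsilon>)) \<le> \<gamma> * q * (1 / \<epsilon>) - 1"
          using c par \<epsilon>(1) by (intro ln_le_minus_one) auto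
        moreover have "ln (\<gamma> * q * (1 / \<epsilon>)) = ln (\<gamma> * q) + ln (1 / \<epsilon>)"
          using c par \<epsilon>(1) by (intro ln_mult_pos) auto
        ultimately have "ln (1 / \<epsilon>) + (1 + ln (\<gamma> * q)) \<le> \<gamma> / \<epsilon> * q" by simp
        then show ?thesis using par by (simp add: pos_divide_le_eq)
      qed
      moreover have "ln (B / A) / q \<le> \<bar>ln (B / A)\<bar> / q" "- (1 + ln (\<gamma> * q)) / q \<le> \<bar>1 + ln (\<gamma> * q)\<bar> / q"
        using par by (intro divide_right_mono; simp)+
      ultimately have "u \<epsilon> z \<le> - ln (1 / \<epsilon>) / q + C"
        by (simp add: C_def add_divide_distrib diff_divide_distrib)
      then show ?thesis using z by blast
    qed
  qed
  have "eventually (\<lambda>\<epsilon>. \<epsilon> \<in> {0<..<\<rho>\<^sub>0 / c}) (at_right 0)"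
    using \<theta>(2) c by (intro eventually_at_right_real) simp
  then have "eventually (\<lambda>\<epsilon>. \<exists>x\<in>frontier \<Omega>. u \<epsilon> x \<le> - ln (1 / \<epsilon>) / q + C) (at_right 0)"
    by eventually_elim (use main in auto)
  then show ?thesis by (rule that)
qed

section \<open>Oscillation bounds\<close>

lemma osc_leI:
  assumes "\<And>x y. x \<in> K \<Longrightarrow> y \<in> K \<Longrightarrow> \<bar>f x - f y\<bar> \<le> c" "0 \<le> c"
  shows "osc K f \<le> c"
proof (cases "K = {}")
  case False
  then obtain k where "k \<in> K" by blast
  then have "\<bar>f k - f k\<bar> \<in> {\<bar>f x - f y\<bar> |x y. x \<in> K \<and> y \<in> K}" by blast
  then have "Sup {\<bar>f x - f y\<bar> |x y. x \<in> K \<and> y \<in> K} \<le> c"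
    using assms(1) by (intro cSup_least) blast+
  then show ?thesis using False by (simp add: osc_def)
qed (use assms(2) in \<open>simp add: osc_def\<close>)

lemma osc_geI:
  assumes "x \<in> K" "y \<in> K" "\<And>x y. x \<in> K \<Longrightarrow> y \<in> K \<Longrightarrow> \<bar>f x - f y\<bar> \<le> c"
  shows "\<bar>f x - f y\<bar> \<le> osc K f"
  unfolding osc_def using assms by (auto intro!: cSup_upper bdd_aboveI[of _ c])

lemma osc_uminus: "osc K (\<lambda>x. - f x) = osc K (f :: 'a \<Rightarrow> real)"
proof -
  have "\<bar>- f x - - f y\<bar> = \<bar>f x - f y\<bar>" for x y by linarith
  then show ?thesis unfolding osc_def by simp
qed

lemma osc_eq_diff:
  assumes "xM \<in> K" "xm \<in> K" "\<And>y. y \<in> K \<Longrightarrow> f xm \<le> f y \<and> f y \<le> f xM"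
  shows "osc K f = f xM - f xm"
proof (rule antisym)
  have le: "\<bar>f x - f y\<bar> \<le> f xM - f xm" if "x \<in> K" "y \<in> K" for x y
    using assms(3)[OF that(1)] assms(3)[OF that(2)] by linarith
  show "osc K f \<le> f xM - f xm" using le le[OF assms(1,1)] by (intro osc_leI) auto
  show "f xM - f xm \<le> osc K f" using osc_geI[OF assms(1,2), of f "f xM - f xm"] le by simp
qed

text \<open>The height \<open>M - u\<close> below the maximum is a nonnegative subsolution of
  \<open>\<epsilon>\<^sup>2 L v = q A v\<close>, and it is at most the oscillation of \<open>u\<close> on the closure.\<close>

lemma interior_oscillation_decay:
  fixes \<Omega> :: "'a::euclidean_space set" and u :: "real \<Rightarrow> 'a \<Rightarrow> real"
  assumes \<Omega>: "open \<Omega>" "bounded \<Omega>" "\<Omega> \<noteq> {}" "smooth_boundary \<Omega>"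
    and g: "closure \<Omega> \<subseteq> V" "smooth_on V g" "\<forall>x\<in>closure \<Omega>. g x > 0"
    and par: "A > 0" "B > 0" "p > 0" "q > 0" "\<kappa> < 0"
    and u: "\<And>\<epsilon>. \<epsilon> > 0 \<Longrightarrow> neumann_solution \<Omega> g A B p q \<kappa> \<epsilon> (u \<epsilon>)"
    and K: "compact K" "K \<subseteq> \<Omega>"
  shows "\<exists>CK MK. CK > 0 \<and> MK > 0 \<and>
    (\<forall>\<epsilon>>0. osc K (u \<epsilon>) / osc (closure \<Omega>) (u \<epsilon>) \<le> CK * exp (- MK / \<epsilon>))"
proof -
  have g': "\<And>x. x \<in> \<Omega> \<Longrightarrow> g x > 0" using g(3) closure_subset by blast
  have comp: "compact (closure \<Omega>)" using \<Omega>(2) by simp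
  have "continuous_on (closure \<Omega>) (\<lambda>x. \<bar>g x\<bar> + (\<Sum>b\<in>Basis. \<bar>partial b g x\<bar>))"
    by (intro continuous_intros continuous_on_subset[OF _ g(1)] smooth_on_continuous_on[OF g(2)])
  then obtain G where G: "G \<ge> 1" "\<And>x. x \<in> closure \<Omega> \<Longrightarrow> \<bar>\<bar>g x\<bar> + (\<Sum>b\<in>Basis. \<bar>partial b g x\<bar>)\<bar> \<le> G"
    using compact_continuous_bound[OF comp] by blast
  have gG: "0 < g x \<and> g x \<le> G" "b \<in> Basis \<Longrightarrow> \<bar>partial b g x\<bar> \<le> G" if "x \<in> \<Omega>" for x and b :: 'a
  proof -
    have x: "x \<in> closure \<Omega>" using that closure_subset by blast
    have nn: "(\<Sum>b\<in>Basis. \<bar>partial b g x\<bar>) \<ge> 0" by (intro sum_nonneg) auto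
    then show "0 < g x \<and> g x \<le> G" using G(2)[OF x] g'[OF that] by linarith
    assume "b \<in> Basis"
    then have "\<bar>partial b g x\<bar> \<le> (\<Sum>b\<in>Basis. \<bar>partial b g x\<bar>)" by (intro member_le_sum) auto
    then show "\<bar>partial b g x\<bar> \<le> G" using G(2)[OF x] nn by linarith
  qed
  obtain r where r: "0 < r" "r \<le> 1" "\<And>x. x \<in> K \<Longrightarrow> cball x r \<subseteq> \<Omega>"
  proof -
    obtain e where e: "e > 0" "(\<Union>x\<in>K. cball x e) \<subseteq> \<Omega>"
      using compact_subset_open_imp_cball_epsilon_subset[OF K(1) \<Omega>(1) K(2)] by blast
    show ?thesis
    proof (rule that[of "min 1 e"])
      fix x assume "x \<in> K"
      have "cball x (min 1 e) \<subseteq> cball x e" by (simp add: subset_cball)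
      then show "cball x (min 1 e) \<subseteq> \<Omega>" using e(2) \<open>x \<in> K\<close> by blast
    qed (use e in auto)
  qed
  define k where "k = q * A"
  have k: "k > 0" using par by (simp add: k_def)
  \<comment> \<open>Twice the constant in \<open>interior_decay\<close>, so that the inequality
    \<open>lk\<close> comes out strict.\<close>
  define N where "N = 16 * real DIM('a) * G"
  have N: "N > 0" using G(1) by (simp add: N_def)
  define l where "l = min 1 (k / N)"
  have l: "0 < l" "l \<le> 1" using k N by (auto simp: l_def)
  have lk: "8 * real DIM('a) * G * l < k"
  proof -
    have "N * l \<le> N * (k / N)" using N by (intro mult_left_mono) (auto simp: l_def)
    also have "\<dots> = k" using N by simp
    finally have "2 * (8 * real DIM('a) * G * l) \<le> k" by (simp add: N_def)
    then show ?thesis using k by linarith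
  qed
  define m where "m = l * r\<^sup>2"
  have m: "m > 0" using l r by (simp add: m_def)
  \<comment> \<open>The barrier works for \<open>\<epsilon> \<le> 1\<close> only. For larger
    \<open>\<epsilon>\<close> the factor \<open>exp m\<close> lifts the right-hand side to at least
    1, where the trivial bound of the ratio by 1 suffices.\<close>
  have "osc K (u \<epsilon>) / osc (closure \<Omega>) (u \<epsilon>) \<le> exp m * exp (- m / \<epsilon>)" if \<epsilon>: "\<epsilon> > 0" for \<epsilon>
  proof -
    obtain xM xm where x: "xM \<in> \<Omega>" "xm \<in> frontier \<Omega>"
      "\<And>y. y \<in> closure \<Omega> \<Longrightarrow> u \<epsilon> xm \<le> u \<epsilon> y \<and> u \<epsilon> y \<le> u \<epsilon> xM"
      "0 < u \<epsilon> xM" "u \<epsilon> xM \<le> ln (B / A) / q" "u \<epsilon> xm < u \<epsilon> xM"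
      "\<And>x. x \<in> \<Omega> \<Longrightarrow> \<epsilon>\<^sup>2 * elliptic_op g (u \<epsilon>) x \<le> - (q * A * (u \<epsilon> xM - u \<epsilon> x))"
      "\<And>x. x \<in> \<Omega> \<Longrightarrow> - (B * exp (- q * u \<epsilon> xm)) \<le> \<epsilon>\<^sup>2 * elliptic_op g (u \<epsilon>) x"
      using neumann_solution_extrema[OF \<Omega> g' par(1-4) \<epsilon> par(5) u[OF \<epsilon>]] by blast
    define W where "W = u \<epsilon> xM - u \<epsilon> xm"
    have W: "W > 0" using x(6) by (simp add: W_def)
    have cl: "\<Omega> \<subseteq> closure \<Omega>" by (rule closure_subset)
    have oscW: "osc (closure \<Omega>) (u \<epsilon>) = W"
      unfolding W_def by (rule osc_eq_diff) (use x cl in \<open>auto simp: frontier_def\<close>)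
    have "osc K (u \<epsilon>) \<le> W * (exp m * exp (- m / \<epsilon>))"
    proof (cases "\<epsilon> \<le> 1")
      case True
      have u2: "twice_diff_on \<Omega> (u \<epsilon>)" using u[OF \<epsilon>] unfolding neumann_solution_def by blast
      have dec: "u \<epsilon> xM - u \<epsilon> y \<le> W * exp (- (l * r\<^sup>2) / \<epsilon>)" if y: "y \<in> K" for y
      proof (rule interior_decay[OF \<Omega>(1) r(1,2) r(3)[OF y] gG l lk \<epsilon> True twice_diff_on_const_minus(1)[OF \<Omega>(1) u2]])
        fix z assume z: "z \<in> \<Omega>"
        show "k * (u \<epsilon> xM - u \<epsilon> z) \<le> \<epsilon>\<^sup>2 * elliptic_op g (\<lambda>x. u \<epsilon> xM - u \<epsilon> x) z"
          using x(7)[OF z] twice_diff_on_const_minus(2)[OF \<Omega>(1) u2 z] by (simp add: k_def)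
        show "u \<epsilon> xM - u \<epsilon> z \<le> W" using x(3)[of z] z cl unfolding W_def by auto
      qed (use W in auto)
      have "osc K (u \<epsilon>) \<le> W * exp (- m / \<epsilon>)"
      proof (rule osc_leI)
        fix y z assume yz: "y \<in> K" "z \<in> K"
        \<comment> \<open>Both values lie below the maximum, so their difference is at most the
          larger of the two gaps to it.\<close>
        have "u \<epsilon> y \<le> u \<epsilon> xM" "u \<epsilon> z \<le> u \<epsilon> xM" using x(3) yz K(2) cl by blast+
        then show "\<bar>u \<epsilon> y - u \<epsilon> z\<bar> \<le> W * exp (- m / \<epsilon>)"
          using dec[OF yz(1)] dec[OF yz(2)] unfolding m_def by linarith
      qed (use W in simp)
      also have "\<dots> \<le> W * (exp m * exp (- m / \<epsilon>))" using W m by (intro mult_left_mono) auto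
      finally show ?thesis .
    next
      case False
      have "osc K (u \<epsilon>) \<le> W"
      proof (rule osc_leI)
        fix y z assume yz: "y \<in> K" "z \<in> K"
        then have "y \<in> closure \<Omega>" "z \<in> closure \<Omega>" using K(2) cl by blast+
        then show "\<bar>u \<epsilon> y - u \<epsilon> z\<bar> \<le> W" using x(3)[of y] x(3)[of z] unfolding W_def by linarith
      qed (use W in simp)
      also have "\<dots> = W * 1" by simp
      also have "\<dots> \<le> W * (exp m * exp (- m / \<epsilon>))"
      proof (intro mult_left_mono)
        have "m / \<epsilon> \<le> m / 1" using False m by (intro divide_left_mono) auto
        then show "1 \<le> exp m * exp (- m / \<epsilon>)" unfolding exp_add[symmetric] by simp
      qed (use W in simp)
      finally show ?thesis .
    qed
    then show ?thesis unfolding oscW using W by (simp add: pos_divide_le_eq mult.commute)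
  qed
  then show ?thesis using m by (intro exI[of _ "exp m"] exI[of _ m]) auto
qed

text \<open>The maximum is positive, so the oscillation exceeds minus the value at the boundary
  point from \<open>min_log_bound\<close>.\<close>

lemma oscillation_log_bound:
  fixes \<Omega> :: "'a::euclidean_space set" and u :: "real \<Rightarrow> 'a \<Rightarrow> real"
  assumes \<Omega>: "open \<Omega>" "bounded \<Omega>" "\<Omega> \<noteq> {}" "smooth_boundary \<Omega>"
    and g: "closure \<Omega> \<subseteq> V" "smooth_on V g" "\<forall>x\<in>closure \<Omega>. g x > 0"
    and par: "A > 0" "B > 0" "p > 0" "q > 0" "\<kappa> < 0"
    and u: "\<And>\<epsilon>. \<epsilon> > 0 \<Longrightarrow> neumann_solution \<Omega> g A B p q \<kappa> \<epsilon> (u \<epsilon>)"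
  shows "\<exists>C. eventually (\<lambda>\<epsilon>. osc (closure \<Omega>) (u \<epsilon>) \<ge> ln (1 / \<epsilon>) / q - C) (at_right 0)"
proof -
  have g': "\<And>x. x \<in> \<Omega> \<Longrightarrow> g x > 0" using g(3) closure_subset by blast
  obtain C where C: "eventually (\<lambda>\<epsilon>. \<exists>x\<in>frontier \<Omega>. u \<epsilon> x \<le> - ln (1 / \<epsilon>) / q + C) (at_right 0)"
    by (rule min_log_bound[OF \<Omega> g par u]) blast
  have "eventually (\<lambda>\<epsilon>. osc (closure \<Omega>) (u \<epsilon>) \<ge> ln (1 / \<epsilon>) / q - C) (at_right 0)"
    using C eventually_at_right_less[of "0 :: real"]
  proof eventually_elim
    case (elim \<epsilon>)
    then have \<epsilon>: "\<epsilon> > 0" by simp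
    obtain z where z: "z \<in> frontier \<Omega>" "u \<epsilon> z \<le> - ln (1 / \<epsilon>) / q + C" using elim by blast
    obtain xM xm where x: "xM \<in> \<Omega>" "xm \<in> frontier \<Omega>" "0 < u \<epsilon> xM"
      "\<And>y. y \<in> closure \<Omega> \<Longrightarrow> u \<epsilon> xm \<le> u \<epsilon> y \<and> u \<epsilon> y \<le> u \<epsilon> xM"
      using neumann_solution_extrema[OF \<Omega> g' par(1-4) \<epsilon> par(5) u[OF \<epsilon>]] by blast
    have cl: "frontier \<Omega> \<subseteq> closure \<Omega>" "\<Omega> \<subseteq> closure \<Omega>" using closure_subset by (auto simp: frontier_def)
    have "osc (closure \<Omega>) (u \<epsilon>) = u \<epsilon> xM - u \<epsilon> xm"
      by (rule osc_eq_diff) (use x cl in auto)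
    then show ?case using x(3) x(4)[of z] z cl by auto
  qed
  then show ?thesis by blast
qed

section \<open>Both signs of \<open>A - B\<close>, the positive one by reflection\<close>

theorem theorem2p2:
  fixes \<Omega> :: "'a::euclidean_space set" and g :: "'a \<Rightarrow> real"
    and A B p q :: real and u :: "real \<Rightarrow> 'a \<Rightarrow> real"
  assumes "DIM('a) \<ge> 2"
    and "open \<Omega>" and "connected \<Omega>" and "bounded \<Omega>" and "\<Omega> \<noteq> {}"
    and "smooth_boundary \<Omega>"
    and "\<exists>U. open U \<and> closure \<Omega> \<subseteq> U \<and> smooth_on U g"
    and "\<forall>x\<in>closure \<Omega>. g x > 0"
    and "A > 0" and "B > 0" and "p > 0" and "q > 0"
    and "(A - B) * (p - q) \<ge> 0" and "A \<noteq> B"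
    and "\<forall>\<epsilon>>0. solves_N \<Omega> g A B p q \<epsilon> (u \<epsilon>)"
  shows
    "(\<exists>C. eventually (\<lambda>\<epsilon>. osc (closure \<Omega>) (u \<epsilon>) \<ge> ln (1 / \<epsilon>) / max p q - C) (at_right 0))
   \<and> (A < B \<and> p \<le> q \<longrightarrow>
        (\<forall>\<epsilon>>0. (\<exists>x\<in>\<Omega>. \<forall>y\<in>closure \<Omega>. u \<epsilon> y \<le> u \<epsilon> x)
               \<and> (\<exists>x\<in>frontier \<Omega>. \<forall>y\<in>closure \<Omega>. u \<epsilon> x \<le> u \<epsilon> y)
               \<and> 0 < Sup (u \<epsilon> ` closure \<Omega>) \<and> Sup (u \<epsilon> ` closure \<Omega>) \<le> ln (B / A) / q)
      \<and> (\<exists>C'. eventually (\<lambda>\<epsilon>. Inf (u \<epsilon> ` frontier \<Omega>) \<le> - ln (1 / \<epsilon>) / q + C') (at_right 0)))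
   \<and> (A > B \<and> p \<ge> q \<longrightarrow>
        (\<forall>\<epsilon>>0. (\<exists>x\<in>\<Omega>. \<forall>y\<in>closure \<Omega>. u \<epsilon> x \<le> u \<epsilon> y)
               \<and> (\<exists>x\<in>frontier \<Omega>. \<forall>y\<in>closure \<Omega>. u \<epsilon> y \<le> u \<epsilon> x)
               \<and> - ln (A / B) / p \<le> Inf (u \<epsilon> ` closure \<Omega>) \<and> Inf (u \<epsilon> ` closure \<Omega>) < 0)
      \<and> (\<exists>C''. eventually (\<lambda>\<epsilon>. Sup (u \<epsilon> ` frontier \<Omega>) \<ge> ln (1 / \<epsilon>) / p - C'') (at_right 0)))
   \<and> (\<forall>K. compact K \<and> K \<subseteq> \<Omega> \<longrightarrow>
        (\<exists>CK MK. CK > 0 \<and> MK > 0 \<and>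
           (\<forall>\<epsilon>>0. osc K (u \<epsilon>) / osc (closure \<Omega>) (u \<epsilon>) \<le> CK * exp (- MK / \<epsilon>))))"
proof -
  note N = assms(1) and \<Omega> = assms(2,4,5,6) and gpos = assms(8) and par = assms(9-12)
  obtain V where V: "closure \<Omega> \<subseteq> V" "smooth_on V g" using assms(7) by blast
  have cl: "frontier \<Omega> \<subseteq> closure \<Omega>" "\<Omega> \<subseteq> closure \<Omega>" using closure_subset by (auto simp: frontier_def)
  have gd: "g differentiable (at x)" if "x \<in> \<Omega>" for x
    using smooth_on_differentiable(1)[OF V(2)] V(1) cl(2) that by blast
  have gp: "g x > 0" if "x \<in> \<Omega>" for x using gpos cl(2) that by blast
  have "surface_integral \<Omega> g > 0"
  proof (rule surface_integral_pos[OF N \<Omega>(1-4)])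
    show "continuous_on (frontier \<Omega>) g"
      using smooth_on_continuous_on(1)[OF V(2)] V(1) cl(1) by (meson continuous_on_subset order_trans)
  qed (use gpos cl(1) in blast)
  moreover have "measure lebesgue \<Omega> > 0" by (rule measure_lebesgue_open_pos[OF \<Omega>(1-3)])
  moreover define \<kappa> where "\<kappa> = boundary_const \<Omega> g A B"
  \<comment> \<open>Volume and surface integral are positive, so \<open>\<kappa>\<close> has the
    sign of \<open>A - B\<close>.\<close>
  ultimately have \<kappa>: "A < B \<Longrightarrow> \<kappa> < 0" "A > B \<Longrightarrow> \<kappa> > 0"
    by (auto simp: \<kappa>_def boundary_const_def intro!: divide_neg_pos mult_pos_neg)
  have u: "neumann_solution \<Omega> g A B p q \<kappa> \<epsilon> (u \<epsilon>)" if "\<epsilon> > 0" for \<epsilon>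
    unfolding \<kappa>_def using assms(15) that gd by (intro solves_N_imp_neumann_solution) auto
  have u': "neumann_solution \<Omega> g B A q p (- \<kappa>) \<epsilon> (\<lambda>x. - u \<epsilon> x)" if "\<epsilon> > 0" for \<epsilon>
    using neumann_solution_uminus[OF \<Omega>(1) u[OF that]] .
  have ucont: "continuous_on (closure \<Omega>) (u \<epsilon>)" if "\<epsilon> > 0" for \<epsilon>
    using u[OF that] unfolding neumann_solution_def by blast
  have bdd: "bdd_below (u \<epsilon> ` frontier \<Omega>)" "bdd_above (u \<epsilon> ` frontier \<Omega>)" if "\<epsilon> > 0" for \<epsilon>
  proof -
    have "compact (u \<epsilon> ` frontier \<Omega>)"
      using continuous_on_subset[OF ucont[OF that] cl(1)] compact_frontier_bounded[OF \<Omega>(2)]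
      by (rule compact_continuous_image)
    then show "bdd_below (u \<epsilon> ` frontier \<Omega>)" "bdd_above (u \<epsilon> ` frontier \<Omega>)"
      by (auto intro: compact_imp_bounded bounded_imp_bdd_below bounded_imp_bdd_above)
  qed
  \<comment> \<open>Identifies the rate found in each case, \<open>q\<close> for
    \<open>A < B\<close> and \<open>p\<close> for \<open>A > B\<close>, with
    \<open>max p q\<close>.\<close>
  have pq: "A < B \<Longrightarrow> p \<le> q" "A > B \<Longrightarrow> q \<le> p"
    using assms(13) by (auto simp: zero_le_mult_iff)
  have osc: "\<exists>C. eventually (\<lambda>\<epsilon>. osc (closure \<Omega>) (u \<epsilon>) \<ge> ln (1 / \<epsilon>) / max p q - C) (at_right 0)"
  proof (cases "A < B")
    case True
    then show ?thesis
      using oscillation_log_bound[OF \<Omega> V gpos par \<kappa>(1)[OF True] u] pq(1) by (simp add: max_absorb2)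
  next
    case False
    then have AB: "A > B" using assms(14) by simp
    then have "- \<kappa> < 0" using \<kappa>(2) by simp
    from oscillation_log_bound[OF \<Omega> V gpos par(2,1,4,3) this u'] show ?thesis
      unfolding osc_uminus using pq(2)[OF AB] by (simp add: max_absorb1)
  qed
  have caseI: "(\<forall>\<epsilon>>0. (\<exists>x\<in>\<Omega>. \<forall>y\<in>closure \<Omega>. u \<epsilon> y \<le> u \<epsilon> x)
               \<and> (\<exists>x\<in>frontier \<Omega>. \<forall>y\<in>closure \<Omega>. u \<epsilon> x \<le> u \<epsilon> y)
               \<and> 0 < Sup (u \<epsilon> ` closure \<Omega>) \<and> Sup (u \<epsilon> ` closure \<Omega>) \<le> ln (B / A) / q)
      \<and> (\<exists>C'. eventually (\<lambda>\<epsilon>. Inf (u \<epsilon> ` frontier \<Omega>) \<le> - ln (1 / \<epsilon>) / q + C') (at_right 0))"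
    if AB: "A < B"
  proof (intro conjI allI impI)
    fix \<epsilon> :: real assume \<epsilon>: "\<epsilon> > 0"
    obtain xM xm where x: "xM \<in> \<Omega>" "xm \<in> frontier \<Omega>"
      "\<And>y. y \<in> closure \<Omega> \<Longrightarrow> u \<epsilon> xm \<le> u \<epsilon> y \<and> u \<epsilon> y \<le> u \<epsilon> xM"
      "0 < u \<epsilon> xM" "u \<epsilon> xM \<le> ln (B / A) / q"
      using neumann_solution_extrema[OF \<Omega> gp par \<epsilon> \<kappa>(1)[OF AB] u[OF \<epsilon>]] by blast
    show "\<exists>x\<in>\<Omega>. \<forall>y\<in>closure \<Omega>. u \<epsilon> y \<le> u \<epsilon> x" "\<exists>x\<in>frontier \<Omega>. \<forall>y\<in>closure \<Omega>. u \<epsilon> x \<le> u \<epsilon> y"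
      using x by blast+
    have "Sup (u \<epsilon> ` closure \<Omega>) = u \<epsilon> xM"
      by (rule cSup_eq_maximum) (use x cl in auto)
    then show "0 < Sup (u \<epsilon> ` closure \<Omega>)" "Sup (u \<epsilon> ` closure \<Omega>) \<le> ln (B / A) / q"
      using x by auto
  next
    obtain C where C: "eventually (\<lambda>\<epsilon>. \<exists>x\<in>frontier \<Omega>. u \<epsilon> x \<le> - ln (1 / \<epsilon>) / q + C) (at_right 0)"
      by (rule min_log_bound[OF \<Omega> V gpos par \<kappa>(1)[OF AB] u]) blast
    have "eventually (\<lambda>\<epsilon>. Inf (u \<epsilon> ` frontier \<Omega>) \<le> - ln (1 / \<epsilon>) / q + C) (at_right 0)"
      using C eventually_at_right_less[of "0 :: real"]
    proof eventually_elim
      case (elim \<epsilon>)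
      then obtain z where "z \<in> frontier \<Omega>" "u \<epsilon> z \<le> - ln (1 / \<epsilon>) / q + C" by blast
      then show ?case using cINF_lower[OF bdd(1)] elim by (meson order_trans)
    qed
    then show "\<exists>C'. eventually (\<lambda>\<epsilon>. Inf (u \<epsilon> ` frontier \<Omega>) \<le> - ln (1 / \<epsilon>) / q + C') (at_right 0)" ..
  qed
  have caseII: "(\<forall>\<epsilon>>0. (\<exists>x\<in>\<Omega>. \<forall>y\<in>closure \<Omega>. u \<epsilon> x \<le> u \<epsilon> y)
               \<and> (\<exists>x\<in>frontier \<Omega>. \<forall>y\<in>closure \<Omega>. u \<epsilon> y \<le> u \<epsilon> x)
               \<and> - ln (A / B) / p \<le> Inf (u \<epsilon> ` closure \<Omega>) \<and> Inf (u \<epsilon> ` closure \<Omega>) < 0)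
      \<and> (\<exists>C''. eventually (\<lambda>\<epsilon>. Sup (u \<epsilon> ` frontier \<Omega>) \<ge> ln (1 / \<epsilon>) / p - C'') (at_right 0))"
    if AB: "A > B"
  proof (intro conjI allI impI)
    have k: "- \<kappa> < 0" using \<kappa>(2)[OF AB] by simp
    fix \<epsilon> :: real assume \<epsilon>: "\<epsilon> > 0"
    \<comment> \<open>Extrema of \<open>- u \<epsilon>\<close>: \<open>xM\<close> is thus a minimum
      point of \<open>u \<epsilon>\<close> and \<open>xm\<close> a maximum point.\<close>
    obtain xM xm where x: "xM \<in> \<Omega>" "xm \<in> frontier \<Omega>"
      "\<And>y. y \<in> closure \<Omega> \<Longrightarrow> - u \<epsilon> xm \<le> - u \<epsilon> y \<and> - u \<epsilon> y \<le> - u \<epsilon> xM"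
      "0 < - u \<epsilon> xM" "- u \<epsilon> xM \<le> ln (A / B) / p"
      using neumann_solution_extrema[OF \<Omega> gp par(2,1,4,3) \<epsilon> k u'[OF \<epsilon>]] by blast
    then have le: "u \<epsilon> xM \<le> u \<epsilon> y" "u \<epsilon> y \<le> u \<epsilon> xm" if "y \<in> closure \<Omega>" for y using that by auto
    show "\<exists>x\<in>\<Omega>. \<forall>y\<in>closure \<Omega>. u \<epsilon> x \<le> u \<epsilon> y" "\<exists>x\<in>frontier \<Omega>. \<forall>y\<in>closure \<Omega>. u \<epsilon> y \<le> u \<epsilon> x"
      using x(1,2) le by blast+
    have "Inf (u \<epsilon> ` closure \<Omega>) = u \<epsilon> xM"
      by (rule cInf_eq_minimum) (use x(1) le cl in auto)
    then show "- ln (A / B) / p \<le> Inf (u \<epsilon> ` closure \<Omega>)" "Inf (u \<epsilon> ` closure \<Omega>) < 0"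
      using x(4,5) by auto
  next
    have k: "- \<kappa> < 0" using \<kappa>(2)[OF AB] by simp
    obtain C where C: "eventually (\<lambda>\<epsilon>. \<exists>x\<in>frontier \<Omega>. - u \<epsilon> x \<le> - ln (1 / \<epsilon>) / p + C) (at_right 0)"
      by (rule min_log_bound[OF \<Omega> V gpos par(2,1,4,3) k u']) blast
    have "eventually (\<lambda>\<epsilon>. Sup (u \<epsilon> ` frontier \<Omega>) \<ge> ln (1 / \<epsilon>) / p - C) (at_right 0)"
      using C eventually_at_right_less[of "0 :: real"]
    proof eventually_elim
      case (elim \<epsilon>)
      then obtain z where z: "z \<in> frontier \<Omega>" "- u \<epsilon> z \<le> - ln (1 / \<epsilon>) / p + C" by blast
      then have "ln (1 / \<epsilon>) / p - C \<le> u \<epsilon> z" by simp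
      then show ?case using cSUP_upper[OF z(1) bdd(2)] elim by (meson order_trans)
    qed
    then show "\<exists>C''. eventually (\<lambda>\<epsilon>. Sup (u \<epsilon> ` frontier \<Omega>) \<ge> ln (1 / \<epsilon>) / p - C'') (at_right 0)" ..
  qed
  have caseIII: "\<exists>CK MK. CK > 0 \<and> MK > 0 \<and>
           (\<forall>\<epsilon>>0. osc K (u \<epsilon>) / osc (closure \<Omega>) (u \<epsilon>) \<le> CK * exp (- MK / \<epsilon>))"
    if K: "compact K" "K \<subseteq> \<Omega>" for K
  proof (cases "A < B")
    case True
    then show ?thesis by (rule interior_oscillation_decay[OF \<Omega> V gpos par \<kappa>(1) u K])
  next
    case False
    then have "- \<kappa> < 0" using \<kappa>(2) assms(14) by simp
    from interior_oscillation_decay[OF \<Omega> V gpos par(2,1,4,3) this u' K] show ?thesis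
      unfolding osc_uminus .
  qed
  show ?thesis using osc caseI caseII caseIII by blast
qed

end
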